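(* For any $f \in W_0$ there exists a family of continuous functionals $\gamma^{\lambda} : W_0 \to \mathbb{H}$, $\lambda \in \Lambda$, such that $$f(\mathbf{x}) = \sum_{\lambda = (\mathbf{b},\omega) \in \Lambda^{\#}} \exp(2\pi i x_1\omega_1)\, \gamma^{\lambda}(f)\, \exp(-\pi|\mathbf{x}-\mathbf{b}|^2)\, \exp(2\pi j x_2\omega_2),$$ with convergence in $L^2(\mathbb{R}^2,\mathbb{H})$, where for $\lambda = \#$ the functional $\gamma^{\#}$ is the sharp Poisson functional.
   Context: $\mathbb{H}$ is the algebra of real quaternions $q = q_0 + i q_1 + j q_2 + k q_3$ with modulus $|q|$; $\exp(it) = \cos t + i \sin t$ and $\exp(jt) = \cos t + j\sin t$ for real $t$. $Q = [0,1]^2$, with characteristic function $\mathcal{X}_Q$, and $T_{\mathbf{n}}g(\mathbf{x}) = g(\mathbf{x}-\mathbf{n})$. The Wiener-Amalgam space $W$ consists of all $f \in L^\infty(\mathbb{R}^2,\mathbb{H})$ with $\|f\|_W = \sum_{\mathbf{n}\in\mathbb{Z}^2} \|f\cdot T_{\mathbf{n}}\mathcal{X}_Q\|_\infty < \infty$; $W_0$ is the subspace of continuous functions in $W$, with the norm $\|\cdot\|_W$. Functionals are real-linear maps $W_0\to\mathbb{H}$. The lattice (critical density: cells of volume $1$) is $\Lambda = \{\lambda = (\mathbf{b},\omega) : \mathbf{b},\omega\in\mathbb{Z}^2\} \subset \mathbb{R}^2\times\mathbb{R}^2$. The sharp point $\#$ is the point $(\mathbf{b},\omega)$ with $\mathbf{b}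 = \omega = (1/2,1/2)$, and the relaxed lattice is $\Lambda^{\#} = \Lambda\cup\{\#\}$. The quaternionic Zak transform is $\mathcal{Z}_q f(\mathbf{x},\omega) = \sum_{\mathbf{m}\in\mathbb{Z}^2} \exp(2\pi i m_1\omega_1) f(\mathbf{x}-\mathbf{m})\exp(2\pi j m_2\omega_2)$. Let $\Theta_i(0) = \Theta_j(0) = \sum_{m\in\mathbb{Z}} \exp(-\pi m^2)$. The sharp Poisson functional is $\gamma^{\#}(f) = (i\,\Theta_i(0))^{-1}\, \mathcal{Z}_q f(\#)\, (j\,\Theta_j(0))^{-1}$, where $\mathcal{Z}_q f(\#)$ is the value at $\mathbf{x}=\omega=(1/2,1/2)$. *)

theory Defs
  imports "HOL-Analysis.Analysis" "HOL-Probability.Essential_Supremum"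
begin

section \<open>Real quaternions\<close>

datatype quat = Quat (qre: real) (qim1: real) (qim2: real) (qim3: real)

lemma quat_eq_iff:
  "p = q \<longleftrightarrow> qre p = qre q \<and> qim1 p = qim1 q \<and> qim2 p = qim2 q \<and> qim3 p = qim3 q"
  by (cases p; cases q) simp

instantiation quat :: real_vector
begin

definition "0 = Quat 0 0 0 0"
definition "p + q = Quat (qre p + qre q) (qim1 p + qim1 q) (qim2 p + qim2 q) (qim3 p + qim3 q)"
definition "- p = Quat (- qre p) (- qim1 p) (- qim2 p) (- qim3 p)"
definition "p - q = Quat (qre p - qre q) (qim1 p - qim1 q) (qim2 p - qim2 q) (qim3 p - qim3 q)"
definition "scaleR r p = Quat (r * qre p) (r * qim1 p) (r * qim2 p) (r * qim3 p)"

instance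
  by standard
    (simp_all add: quat_eq_iff zero_quat_def plus_quat_def uminus_quat_def minus_quat_def
      scaleR_quat_def algebra_simps)

end

instantiation quat :: real_div_algebra
begin

definition "1 = Quat 1 0 0 0"

definition "p * q = Quat
  (qre p * qre q - qim1 p * qim1 q - qim2 p * qim2 q - qim3 p * qim3 q)
  (qre p * qim1 q + qim1 p * qre q + qim2 p * qim3 q - qim3 p * qim2 q)
  (qre p * qim2 q - qim1 p * qim3 q + qim2 p * qre q + qim3 p * qim1 q)
  (qre p * qim3 q + qim1 p * qim2 q - qim2 p * qim1 q + qim3 p * qre q)"

definition "inverse p =
  (let d = (qre p)\<^sup>2 + (qim1 p)\<^sup>2 + (qim2 p)\<^sup>2 + (qim3 p)\<^sup>2
   in Quat (qre p / d) (- qim1 p / d) (- qim2 p / d) (- qim3 p / d))"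

definition "p div q = p * inverse (q::quat)"

instance
proof
  fix p q r :: quat and a :: real
  show "(p * q) * r = p * (q * r)" "(p + q) * r = p * r + q * r" "p * (q + r) = p * q + p * r"
    "(a *\<^sub>R p) * q = a *\<^sub>R (p * q)" "p * (a *\<^sub>R q) = a *\<^sub>R (p * q)"
    by (simp_all add: quat_eq_iff times_quat_def plus_quat_def scaleR_quat_def algebra_simps)
  show "1 * p = p" "p * 1 = p" "(0::quat) \<noteq> 1"
    by (simp_all add: quat_eq_iff times_quat_def one_quat_def zero_quat_def)
  show "p div q = p * inverse q"
    by (rule divide_quat_def)
  show "inverse (0::quat) = 0"
    by (simp add: inverse_quat_def zero_quat_def)
  assume "p \<noteq> 0"
  define d where "d = (qre p)\<^sup>2 + (qim1 p)\<^sup>2 + (qim2 p)\<^sup>2 + (qim3 p)\<^sup>2"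
  have d: "d \<noteq> 0"
    using \<open>p \<noteq> 0\<close> unfolding d_def
    by (auto simp: quat_eq_iff zero_quat_def add_nonneg_eq_0_iff)
  have "inverse p = Quat (qre p / d) (- qim1 p / d) (- qim2 p / d) (- qim3 p / d)"
    by (simp add: inverse_quat_def Let_def d_def)
  moreover have "qre p * qre p / d + qim1 p * qim1 p / d + qim2 p * qim2 p / d + qim3 p * qim3 p / d = 1"
    using d by (simp add: d_def power2_eq_square flip: add_divide_distrib)
  ultimately show "inverse p * p = 1" "p * inverse p = 1"
    by (simp_all add: quat_eq_iff times_quat_def one_quat_def mult.commute)
qed

end

instantiation quat :: real_inner
begin

definition "inner p q = qre p * qre q + qim1 p * qim1 q + qim2 p * qim2 q + qim3 p * qim3 q"
definition "norm p = sqrt ((qre p)\<^sup>2 + (qim1 p)\<^sup>2 + (qim2 p)\<^sup>2 + (qim3 p)\<^sup>2)"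
definition "sgn p = inverse (norm p) *\<^sub>R (p::quat)"
definition "dist p q = norm (p - q :: quat)"
definition [code del]:
  "(uniformity :: (quat \<times> quat) filter) = (INF e\<in>{0 <..}. principal {(x, y). dist x y < e})"
definition [code del]:
  "open (U :: quat set) \<longleftrightarrow> (\<forall>x\<in>U. eventually (\<lambda>(x', y). x' = x \<longrightarrow> y \<in> U) uniformity)"

instance
proof
  fix p q r :: quat and a :: real and U :: "quat set"
  show "dist p q = norm (p - q)" by (rule dist_quat_def)
  show "sgn p = inverse (norm p) *\<^sub>R p" by (rule sgn_quat_def)
  show "(uniformity :: (quat \<times> quat) filter) = (INF e\<in>{0 <..}. principal {(x, y). dist x y < e})"
    by (rule uniformity_quat_def)
  show "open U \<longleftrightarrow> (\<forall>x\<in>U. eventually (\<lambda>(x', y). x' = x \<longrightarrow> y \<in> U) uniformity)"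
    by (rule open_quat_def)
  show "inner p q = inner q p" "inner (p + q) r = inner p r + inner q r"
    "inner (a *\<^sub>R p) q = a * inner p q"
    by (simp_all add: inner_quat_def plus_quat_def scaleR_quat_def algebra_simps)
  show "0 \<le> inner p p"
    by (simp add: inner_quat_def)
  show "inner p p = 0 \<longleftrightarrow> p = 0"
    by (auto simp: inner_quat_def quat_eq_iff zero_quat_def add_nonneg_eq_0_iff)
  show "norm p = sqrt (inner p p)"
    by (simp add: inner_quat_def norm_quat_def power2_eq_square)
qed

end

instance quat :: real_normed_div_algebra
proof
  fix p q :: quat
  show "norm (p * q) = norm p * norm q"
    unfolding norm_quat_def real_sqrt_mult[symmetric]
    by (rule arg_cong[where f = sqrt])
      (simp add: times_quat_def power2_eq_square algebra_simps)
qed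

instantiation quat :: euclidean_space
begin

definition "Basis = {Quat 1 0 0 0, Quat 0 1 0 0, Quat 0 0 1 0, Quat 0 0 0 1}"

instance
proof
  show "(Basis :: quat set) \<noteq> {}" "finite (Basis :: quat set)"
    by (simp_all add: Basis_quat_def)
  fix p q :: quat
  show "(\<forall>u\<in>Basis. inner p u = 0) \<longleftrightarrow> p = 0"
    by (cases p) (simp add: Basis_quat_def inner_quat_def zero_quat_def)
  assume "p \<in> Basis" "q \<in> Basis"
  then show "inner p q = (if p = q then 1 else 0)"
    unfolding Basis_quat_def by (elim insertE emptyE; simp add: inner_quat_def)
qed

end

definition quat_i :: quat where "quat_i = Quat 0 1 0 0"
definition quat_j :: quat where "quat_j = Quat 0 0 1 0"

definition exp_i :: "real \<Rightarrow> quat" where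
  "exp_i t = of_real (cos t) + quat_i * of_real (sin t)"

definition exp_j :: "real \<Rightarrow> quat" where
  "exp_j t = of_real (cos t) + quat_j * of_real (sin t)"


section \<open>Wiener amalgam spaces\<close>

definition int_vecs :: "(real^2) set" where
  "int_vecs = {n. \<forall>k. n $ k \<in> \<int>}"

definition Linf_norm :: "(real^2 \<Rightarrow> quat) \<Rightarrow> ennreal" where
  "Linf_norm f = esssup lebesgue (\<lambda>x. ennreal (norm (f x)))"

definition Linf :: "(real^2 \<Rightarrow> quat) set" where
  "Linf = {f. f \<in> borel_measurable lebesgue \<and> Linf_norm f < \<infinity>}"

definition translate :: "real^2 \<Rightarrow> (real^2 \<Rightarrow> 'a) \<Rightarrow> real^2 \<Rightarrow> 'a" where
  "translate n g x = g (x - n)"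

(* cbox 0 1 is the unit square, since 1 :: real^2 is the all-ones vector. *)
definition W_norm :: "(real^2 \<Rightarrow> quat) \<Rightarrow> ennreal" where
  "W_norm f =
    (\<Sum>\<^sub>\<infinity>n\<in>int_vecs. Linf_norm (\<lambda>x. f x * of_real (translate n (indicat_real (cbox 0 1)) x)))"

definition W :: "(real^2 \<Rightarrow> quat) set" where
  "W = {f \<in> Linf. W_norm f < \<infinity>}"

definition W0 :: "(real^2 \<Rightarrow> quat) set" where
  "W0 = {f \<in> W. continuous_on UNIV f}"

definition continuous_functional_W0 :: "((real^2 \<Rightarrow> quat) \<Rightarrow> quat) \<Rightarrow> bool" where
  "continuous_functional_W0 \<gamma> \<longleftrightarrow>
    (\<forall>f\<in>W0. \<forall>g\<in>W0. \<gamma> (\<lambda>x. f x + g x) = \<gamma> f + \<gamma> g) \<and>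
    (\<forall>f\<in>W0. \<forall>a::real. \<gamma> (\<lambda>x. a *\<^sub>R f x) = a *\<^sub>R \<gamma> f) \<and>
    (\<forall>f\<in>W0. \<forall>\<epsilon>>0. \<exists>\<delta>>0. \<forall>g\<in>W0.
      W_norm (\<lambda>x. g x - f x) < ennreal \<delta> \<longrightarrow> norm (\<gamma> g - \<gamma> f) < \<epsilon>)"


section \<open>Relaxed lattice and sharp Poisson functional\<close>

definition lattice :: "((real^2) \<times> (real^2)) set" where
  "lattice = int_vecs \<times> int_vecs"

definition sharp :: "(real^2) \<times> (real^2)" where
  "sharp = (vec (1/2), vec (1/2))"

definition relaxed_lattice :: "((real^2) \<times> (real^2)) set" where
  "relaxed_lattice = lattice \<union> {sharp}"

definition zak :: "(real^2 \<Rightarrow> quat) \<Rightarrow> (real^2) \<times> (real^2) \<Rightarrow> quat" where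
  "zak f = (\<lambda>(x, \<omega>).
    \<Sum>\<^sub>\<infinity>m\<in>int_vecs. exp_i (2 * pi * m$1 * \<omega>$1) * f (x - m) * exp_j (2 * pi * m$2 * \<omega>$2))"

definition theta0 :: real where
  "theta0 = (\<Sum>\<^sub>\<infinity>m\<in>(UNIV::int set). exp (- pi * (of_int m)\<^sup>2))"

definition sharp_poisson :: "(real^2 \<Rightarrow> quat) \<Rightarrow> quat" where
  "sharp_poisson f =
    inverse (quat_i * of_real theta0) * zak f sharp * inverse (quat_j * of_real theta0)"


section \<open>Gabor expansions\<close>

definition gabor_term :: "quat \<Rightarrow> (real^2) \<times> (real^2) \<Rightarrow> real^2 \<Rightarrow> quat" where
  "gabor_term c = (\<lambda>(b, \<omega>) x.
    exp_i (2 * pi * x$1 * \<omega>$1) * c * of_real (exp (- pi * (norm (x - b))\<^sup>2))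
      * exp_j (2 * pi * x$2 * \<omega>$2))"

definition L2 :: "(real^2 \<Rightarrow> quat) set" where
  "L2 = {f \<in> borel_measurable lebesgue. integrable lebesgue (\<lambda>x. (norm (f x))\<^sup>2)}"

definition L2_norm :: "(real^2 \<Rightarrow> quat) \<Rightarrow> real" where
  "L2_norm f = sqrt (LINT x|lebesgue. (norm (f x))\<^sup>2)"

(* Convergence in L2 of a series of functions indexed by a locally finite set \<Lambda> of points of the
   time-frequency plane: the partial sums are taken over axis-parallel boxes exhausting the plane,
   whose sides may grow independently and asymmetrically. (Sums over arbitrary finite subsets of
   \<Lambda>, i.e. unconditional convergence, would force square-summable Gabor coefficients, which fails
   in general at critical density.) *)
definition has_box_sum_L2 ::
    "((real^2) \<times> (real^2) \<Rightarrow> real^2 \<Rightarrow> quat) \<Rightarrow> ((real^2) \<times> (real^2)) set \<Rightarrow> (real^2 \<Rightarrow> quat) \<Rightarrow> bool"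
  where
  "has_box_sum_L2 t \<Lambda> f \<longleftrightarrow> f \<in> L2 \<and> (\<forall>p\<in>\<Lambda>. t p \<in> L2) \<and>
    (\<forall>\<epsilon>>0. \<exists>R. \<forall>u v. cball 0 R \<subseteq> cbox u v \<longrightarrow>
      L2_norm (\<lambda>x. f x - (\<Sum>p\<in>\<Lambda> \<inter> cbox u v. t p x)) < \<epsilon>)"

end

theory Submission
  imports Defs "HOL-Probability.Probability_Measure" "HOL-Library.Nat_Bijection"
begin

text \<open>
  The quaternions form a module over the complex numbers in two commuting ways: numbers a + ib act
  from the left and numbers a + jb act from the right. The Zak transform uses exactly these two
  actions, so it turns a Gabor sum into a product. Write \<theta>(x, y) for the Zak transform of the
  one-dimensional Gaussian, and put y = -\<omega>. The atom with coefficient c at the lattice point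
  with position b and frequency k becomes the Fourier character with index (k, b) applied to
  c, multiplied by \<theta>(x_1, y_1) from the left and by \<theta>(x_2, y_2) from the right
  (\<open>zak_refl_gabor\<close>). Hence the coefficients to use are the Fourier coefficients of the quotient F of
  the Zak transform of f by these two factors, and the error of a box sum in L^2(\<real>^2) is at most
  the norm of \<theta> (F - S_N F) \<theta> on the unit cube, S_N F being a rectangular partial sum of the
  Fourier series of F (\<open>zak_plancherel_le\<close>, \<open>zak_cut_error\<close>).

  The difficulty is that on the unit square \<theta> vanishes at (1/2, 1/2), and only there, to first
  order (\<open>theta_bounds\<close>). So F is integrable, and its coefficients are continuous functionals, but F
  need not be square integrable, and the weight |\<theta>|^2 does not factor over the variables.
  However, up to a constant, |\<theta>(x, y)|^2 is bounded by |1 + e(x)|^2 + |1 + e(y)|^2, where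
  e(t) = exp(2 \<pi> i t). Expanding the product of two such sums leaves weights that do factor.
  In one variable, multiplication by 1 + e(x) adds to each Fourier coefficient its neighbour. On a
  partial sum it therefore produces the partial sum of (1 + e)g and two boundary terms, and each
  boundary term is a single Fourier coefficient, whose square the Cauchy-Schwarz inequality bounds by
  a multiple of \<integral> |x - 1/2|^(1/2) |g|^2 (\<open>admissible_boundary\<close>). Such one-variable estimates multiply
  (\<open>admissible_tensor\<close>). The result, \<open>box_partial_sum_bound\<close>, bounds all S_N uniformly from L^2 with
  weight (|x_1 - 1/2|^(1/2) + |y_1 - 1/2|^(1/2)) (|x_2 - 1/2|^(1/2) + |y_2 - 1/2|^(1/2)) to L^2 with
  the weight \<open>edge_weight\<close>, which dominates |\<theta>(x_1, y_1)|^2 |\<theta>(x_2, y_2)|^2 up to a constant.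

  The quotient F lies in the first of these spaces, because a^(1/2) / (a + b)^2 is at most
  a^(-3/4) b^(-3/4) (\<open>theta_pair_ineqs\<close>), and trigonometric polynomials approximate it there
  (\<open>zak_quot_trig_approx\<close>). Partial sums reproduce a trigonometric polynomial once the box contains its
  frequencies. Together with the uniform bound this gives convergence for every F that comes from a
  function in \<open>W0\<close>. The term at the sharp point is itself a function
  in \<open>W0\<close>: subtract it from f and expand the remainder over the lattice.
\<close>

section \<open>Complex numbers acting on the quaternions from both sides\<close>

definition cexpt :: "real \<Rightarrow> complex" where "cexpt t = cis (2 * pi * t)"

definition emb_i :: "complex \<Rightarrow> quat" where "emb_i z = Quat (Re z) (Im z) 0 0"
definition emb_j :: "complex \<Rightarrow> quat" where "emb_j z = Quat (Re z) 0 (Im z) 0"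

text \<open>
  The scalar \<open>z\<close> acts from the left along \<open>i\<close> and \<open>w\<close> from the right along \<open>j\<close>. The two actions commute, so
  although quaternions do not, actions compose by multiplying the scalars (\<open>bimult_bimult\<close>).
\<close>

definition bimult :: "complex \<Rightarrow> complex \<Rightarrow> quat \<Rightarrow> quat" where
  "bimult z w q = emb_i z * q * emb_j w"

lemma cexpt_add: "cexpt (s + t) = cexpt s * cexpt t"
  by (simp add: cexpt_def distrib_left cis_mult)

lemma cexpt_0 [simp]: "cexpt 0 = 1"
  by (simp add: cexpt_def)

lemma norm_cexpt [simp]: "norm (cexpt t) = 1"
  by (simp add: cexpt_def)

lemma cexpt_minus: "cexpt (- t) = cnj (cexpt t)"
  by (simp add: cexpt_def cis_cnj)

lemma cexpt_of_int [simp]: "cexpt (of_int n) = 1"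
  by (simp add: cexpt_def cis.ctr complex_eq_iff)

lemma continuous_on_cexpt [continuous_intros]:
  "continuous_on S f \<Longrightarrow> continuous_on S (\<lambda>x. cexpt (f x))"
  unfolding cexpt_def by (intro continuous_intros)

lemma cexpt_measurable [measurable]: "cexpt \<in> borel_measurable borel"
  by (intro borel_measurable_continuous_onI continuous_intros)

lemma of_real_quat: "of_real r = Quat r 0 0 0"
  by (simp add: of_real_def scaleR_quat_def one_quat_def)

lemma exp_i_emb: "exp_i (2 * pi * t) = emb_i (cexpt t)"
  by (simp add: exp_i_def emb_i_def of_real_quat quat_i_def times_quat_def plus_quat_def cexpt_def)

lemma exp_j_emb: "exp_j (2 * pi * t) = emb_j (cexpt t)"
  by (simp add: exp_j_def emb_j_def of_real_quat quat_j_def times_quat_def plus_quat_def cexpt_def)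

lemma emb_mult: "emb_i (z * w) = emb_i z * emb_i w" "emb_j (z * w) = emb_j z * emb_j w"
  by (simp_all add: emb_i_def emb_j_def times_quat_def)

lemma emb_one [simp]: "emb_i 1 = 1" "emb_j 1 = 1"
  by (simp_all add: emb_i_def emb_j_def one_quat_def)

lemma norm_emb [simp]: "norm (emb_i z) = norm z" "norm (emb_j z) = norm z"
  by (simp_all add: emb_i_def emb_j_def norm_quat_def cmod_def)

lemma bounded_linear_emb: "bounded_linear emb_i" "bounded_linear emb_j"
  by (auto intro!: bounded_linear_intro[where K = 1]
      simp: emb_i_def emb_j_def plus_quat_def scaleR_quat_def norm_quat_def cmod_def)

lemmas continuous_on_emb [continuous_intros] =
  bounded_linear.continuous_on[OF bounded_linear_emb(1)]
  bounded_linear.continuous_on[OF bounded_linear_emb(2)]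

lemma emb_measurable [measurable]:
  "emb_i \<in> borel_measurable borel" "emb_j \<in> borel_measurable borel"
  by (intro borel_measurable_continuous_onI continuous_intros)+

lemma emb_add: "emb_i (z + w) = emb_i z + emb_i w" "emb_j (z + w) = emb_j z + emb_j w"
  by (simp_all add: emb_i_def emb_j_def plus_quat_def)

lemma bimult_bimult: "bimult z w (bimult z' w' q) = bimult (z * z') (w * w') q"
proof -
  have "emb_j w' * emb_j w = emb_j (w * w')"
    by (simp add: emb_mult(2)[symmetric] mult.commute)
  then show ?thesis
    by (simp add: bimult_def emb_mult(1) mult.assoc)
qed

lemma bimult_one [simp]: "bimult 1 1 q = q"
  by (simp add: bimult_def)

lemma norm_bimult [simp]: "norm (bimult z w q) = norm z * norm w * norm q"
  by (simp add: bimult_def norm_mult)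

lemma bounded_linear_bimult: "bounded_linear (bimult z w)"
  unfolding bimult_def
  by (intro bounded_linear_mult_const bounded_linear_const_mult bounded_linear_ident)

lemmas bimult_linear = bounded_linear_bimult[THEN bounded_linear.linear]

lemma bimult_add: "bimult z w (p + q) = bimult z w p + bimult z w q"
  and bimult_diff: "bimult z w (p - q) = bimult z w p - bimult z w q"
  and bimult_sum: "bimult z w (\<Sum>a\<in>A. f a) = (\<Sum>a\<in>A. bimult z w (f a))"
  and bimult_scaleR: "bimult z w (r *\<^sub>R q) = r *\<^sub>R bimult z w q"
  and bimult_zero [simp]: "bimult z w 0 = 0"
  by (simp_all add: linear_add[OF bimult_linear] linear_diff[OF bimult_linear]
      linear_sum[OF bimult_linear] linear_cmul[OF bimult_linear] linear_0[OF bimult_linear])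

lemma bimult_add_left: "bimult (z + z') w q = bimult z w q + bimult z' w q"
  and bimult_add_right: "bimult z (w + w') q = bimult z w q + bimult z w' q"
  by (simp_all add: bimult_def emb_add algebra_simps)

lemma continuous_on_bimult [continuous_intros]:
  "continuous_on S z \<Longrightarrow> continuous_on S w \<Longrightarrow> continuous_on S q
    \<Longrightarrow> continuous_on S (\<lambda>x. bimult (z x) (w x) (q x))"
  unfolding bimult_def by (intro continuous_intros)

lemma bimult_measurable [measurable (raw)]:
  assumes "z \<in> borel_measurable M" "w \<in> borel_measurable M" "q \<in> borel_measurable M"
  shows "(\<lambda>x. bimult (z x) (w x) (q x)) \<in> borel_measurable M"
  using assms unfolding bimult_def by measurable

lemma inner_bimult:
  assumes "norm z = 1" "norm w = 1"
  shows "inner (bimult z w p) (bimult z w q) = inner p q"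
  using assms by (simp add: dot_norm bimult_add[symmetric])

lemma bimult_cnj_cancel:
  assumes "norm z = 1" "norm w = 1"
  shows "bimult (cnj z) (cnj w) (bimult z w q) = q" "bimult z w (bimult (cnj z) (cnj w) q) = q"
proof -
  have "z * cnj z = 1" "w * cnj w = 1"
    using assms by (simp_all flip: complex_norm_square)
  then show "bimult (cnj z) (cnj w) (bimult z w q) = q" "bimult z w (bimult (cnj z) (cnj w) q) = q"
    by (simp_all add: bimult_bimult mult.commute)
qed

lemma inner_bimult_left:
  assumes "norm z = 1" "norm w = 1"
  shows "inner (bimult z w p) q = inner p (bimult (cnj z) (cnj w) q)"
  using inner_bimult[OF assms, of p "bimult (cnj z) (cnj w) q"] bimult_cnj_cancel[OF assms] by simp

section \<open>Fourier partial sums for two-sided characters\<close>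

definition unit_lebesgue :: "real measure" where
  "unit_lebesgue = density lborel (\<lambda>x. ennreal (indicator {0..1} x))"

lemma sets_unit_lebesgue [measurable_cong, simp]: "sets unit_lebesgue = sets borel"
  by (simp add: unit_lebesgue_def)

lemma space_unit_lebesgue [simp]: "space unit_lebesgue = UNIV"
  by (simp add: unit_lebesgue_def)

interpretation unit_lebesgue: prob_space unit_lebesgue
proof
  show "emeasure unit_lebesgue (space unit_lebesgue) = 1"
    by (simp add: unit_lebesgue_def emeasure_density nn_integral_set_ennreal[symmetric]
        ennreal_indicator)
qed

lemma AE_unit_lebesgue_mem: "AE x in unit_lebesgue. 0 < x \<and> x < 1 \<and> x \<noteq> 1/2"
proof -
  have "AE x in lborel. x \<noteq> (0::real)" "AE x in lborel. x \<noteq> (1::real)" "AE x in lborel. x \<noteq> (1/2::real)"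
    by (rule AE_lborel_singleton)+
  then have "AE x in lborel. 0 < ennreal (indicator {0..1} x) \<longrightarrow> 0 < x \<and> x < 1 \<and> x \<noteq> (1/2::real)"
    by (auto elim!: eventually_rev_mp simp: indicator_def split: if_splits)
  then show ?thesis
    unfolding unit_lebesgue_def by (subst AE_density) auto
qed

lemma nn_integral_unit_lebesgue:
  assumes [measurable]: "f \<in> borel_measurable borel"
  shows "(\<integral>\<^sup>+x. f x \<partial>unit_lebesgue) = (\<integral>\<^sup>+x. f x * indicator {0..1} x \<partial>lborel)"
  unfolding unit_lebesgue_def
  by (subst nn_integral_density) (auto simp: ennreal_indicator mult.commute)

lemma integral_unit_lebesgue:
  fixes f :: "real \<Rightarrow> 'b :: {banach, second_countable_topology}"
  assumes [measurable]: "f \<in> borel_measurable borel"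
  shows "(\<integral>x. f x \<partial>unit_lebesgue) = (\<integral>x. indicator {0..1} x *\<^sub>R f x \<partial>lborel)"
  unfolding unit_lebesgue_def by (subst integral_density) auto

lemma integral_cexpt:
  "(\<integral>x. cexpt (of_int n * x) \<partial>unit_lebesgue) = (if n = 0 then 1 else 0)"
proof (cases "n = 0")
  case True
  then show ?thesis
    using unit_lebesgue.prob_space by simp
next
  case False
  define F where "F = (\<lambda>x. cexpt (of_int n * x) / (2 * of_real pi * \<i> * of_int n))"
  have "has_bochner_integral lborel (\<lambda>x. indicator {0..1} x *\<^sub>R cexpt (of_int n * x)) (F 1 - F 0)"
  proof (rule has_bochner_integral_FTC_Icc)
    fix x :: real
    have "((\<lambda>x. exp (\<i> * of_real (2 * pi * (of_int n * x)))) has_vector_derivative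
        (\<i> * of_real (2 * pi * of_int n)) * exp (\<i> * of_real (2 * pi * (of_int n * x)))) (at x within {0..1})"
      by (auto intro!: derivative_eq_intros has_vector_derivative_real_field simp: algebra_simps)
    from has_vector_derivative_divide[OF this, of "2 * of_real pi * \<i> * of_int n"]
    show "(F has_vector_derivative cexpt (of_int n * x)) (at x within {0..1})"
      using False by (simp add: F_def cexpt_def cis_conv_exp)
    show "continuous_on {0..1} (\<lambda>x. cexpt (of_int n * x))"
      by (intro continuous_intros)
  qed simp
  moreover have "F 1 = F 0"
    by (simp add: F_def)
  ultimately show ?thesis
    using False by (subst integral_unit_lebesgue) (auto simp: has_bochner_integral_iff)
qed

lemma cnj_measurable [measurable (raw)]:
  "f \<in> borel_measurable M \<Longrightarrow> (\<lambda>x. cnj (f x)) \<in> borel_measurable M"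
  by (rule measurable_compose[where g = cnj]) (auto intro!: borel_measurable_continuous_onI continuous_intros)

text \<open>
  A character is a pair of unimodular functions \<open>l n\<close>, \<open>r n\<close> that act on a coefficient from the left
  and from the right. The Fourier coefficient undoes both, so it uses their conjugates.
\<close>

definition coef ::
    "'a measure \<Rightarrow> ('n \<Rightarrow> 'a \<Rightarrow> complex) \<Rightarrow> ('n \<Rightarrow> 'a \<Rightarrow> complex) \<Rightarrow> ('a \<Rightarrow> quat) \<Rightarrow> 'n \<Rightarrow> quat" where
  "coef M l r F n = (\<integral>p. bimult (cnj (l n p)) (cnj (r n p)) (F p) \<partial>M)"

definition psum ::
    "'a measure \<Rightarrow> ('n \<Rightarrow> 'a \<Rightarrow> complex) \<Rightarrow> ('n \<Rightarrow> 'a \<Rightarrow> complex) \<Rightarrow> 'n set \<Rightarrow> ('a \<Rightarrow> quat) \<Rightarrow> 'a \<Rightarrow> quat" where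
  "psum M l r N F p = (\<Sum>n\<in>N. bimult (l n p) (r n p) (coef M l r F n))"

text \<open>
  The index group acts like a dual group: characters multiply when indices add, and every nontrivial
  character has mean zero, whatever quaternion it acts on. This is orthonormality with quaternion
  coefficients.
\<close>

locale char_system = prob_space M for M :: "'a measure" +
  fixes l r :: "'n::ab_group_add \<Rightarrow> 'a \<Rightarrow> complex"
  assumes l_meas [measurable]: "\<And>n. l n \<in> borel_measurable M"
    and r_meas [measurable]: "\<And>n. r n \<in> borel_measurable M"
    and norm_l [simp]: "\<And>n p. norm (l n p) = 1"
    and norm_r [simp]: "\<And>n p. norm (r n p) = 1"
    and l_diff: "\<And>n m p. l (n - m) p = l n p * cnj (l m p)"
    and r_diff: "\<And>n m p. r (n - m) p = r n p * cnj (r m p)"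
    and ortho: "\<And>n q. (\<integral>p. bimult (l n p) (r n p) q \<partial>M) = (if n = 0 then q else 0)"
begin

lemma integrable_bimult_iff [simp]:
  assumes [measurable]: "F \<in> borel_measurable M"
  shows "integrable M (\<lambda>p. bimult (l n p) (r n p) (F p)) \<longleftrightarrow> integrable M F"
    "integrable M (\<lambda>p. bimult (cnj (l n p)) (cnj (r n p)) (F p)) \<longleftrightarrow> integrable M F"
proof -
  have "(\<lambda>p. bimult (l n p) (r n p) (F p)) \<in> borel_measurable M"
    "(\<lambda>p. bimult (cnj (l n p)) (cnj (r n p)) (F p)) \<in> borel_measurable M"
    by measurable
  note this[THEN integrable_norm_iff] integrable_norm_iff[OF assms]
  then show "integrable M (\<lambda>p. bimult (l n p) (r n p) (F p)) \<longleftrightarrow> integrable M F"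
    "integrable M (\<lambda>p. bimult (cnj (l n p)) (cnj (r n p)) (F p)) \<longleftrightarrow> integrable M F"
    by simp_all
qed

lemma coef_add:
  assumes "integrable M F" "integrable M G"
  shows "coef M l r (\<lambda>p. F p + G p) n = coef M l r F n + coef M l r G n"
  using assms by (simp add: coef_def bimult_add)

lemma coef_diff:
  assumes "integrable M F" "integrable M G"
  shows "coef M l r (\<lambda>p. F p - G p) n = coef M l r F n - coef M l r G n"
  using assms by (simp add: coef_def bimult_diff)

lemma psum_diff:
  assumes "integrable M F" "integrable M G"
  shows "psum M l r N (\<lambda>p. F p - G p) p = psum M l r N F p - psum M l r N G p"
  using assms by (simp add: psum_def coef_diff bimult_diff sum_subtractf)

lemma norm_coef_le:
  assumes "integrable M F"
  shows "norm (coef M l r F n) \<le> (\<integral>p. norm (F p) \<partial>M)"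
  unfolding coef_def
  by (rule order_trans[OF integral_norm_bound]) simp

lemma inner_char:
  "inner (bimult (l n p) (r n p) c) (bimult (l m p) (r m p) d) = inner c (bimult (l (m - n) p) (r (m - n) p) d)"
  by (simp add: inner_bimult_left bimult_bimult l_diff r_diff mult.commute)

lemma integral_inner_char:
  "(\<integral>p. inner (bimult (l n p) (r n p) c) (bimult (l m p) (r m p) d) \<partial>M) = (if n = m then inner c d else 0)"
  unfolding inner_char by (subst integral_inner_right) (auto simp: ortho)

lemma trig_norm_sq:
  assumes "finite N"
  shows "(norm (\<Sum>n\<in>N. bimult (l n p) (r n p) (c n)))\<^sup>2 =
    (\<Sum>n\<in>N. \<Sum>m\<in>N. inner (bimult (l n p) (r n p) (c n)) (bimult (l m p) (r m p) (c m)))"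
  by (simp add: power2_norm_eq_inner inner_sum_left inner_sum_right) (rule sum.swap)

lemma parseval_finite:
  assumes "finite N"
  shows "(\<integral>p. (norm (\<Sum>n\<in>N. bimult (l n p) (r n p) (c n)))\<^sup>2 \<partial>M) = (\<Sum>n\<in>N. (norm (c n))\<^sup>2)"
    "integrable M (\<lambda>p. (norm (\<Sum>n\<in>N. bimult (l n p) (r n p) (c n)))\<^sup>2)"
proof -
  have int: "integrable M (\<lambda>p. inner (bimult (l n p) (r n p) (c n)) (bimult (l m p) (r m p) (c m)))" for n m
    unfolding inner_char by (intro integrable_inner_right) simp
  show "(\<integral>p. (norm (\<Sum>n\<in>N. bimult (l n p) (r n p) (c n)))\<^sup>2 \<partial>M) = (\<Sum>n\<in>N. (norm (c n))\<^sup>2)"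
    unfolding trig_norm_sq[OF assms] using assms
    by (simp add: int integral_inner_char sum.delta') (simp add: power2_norm_eq_inner)
  show "integrable M (\<lambda>p. (norm (\<Sum>n\<in>N. bimult (l n p) (r n p) (c n)))\<^sup>2)"
    using assms by (simp add: trig_norm_sq int)
qed

lemma parseval_finite_nn:
  assumes "finite N"
  shows "(\<integral>\<^sup>+p. ennreal ((norm (\<Sum>n\<in>N. bimult (l n p) (r n p) (c n)))\<^sup>2) \<partial>M)
    = ennreal (\<Sum>n\<in>N. (norm (c n))\<^sup>2)"
  using parseval_finite[OF assms, of c] by (subst nn_integral_eq_integral) auto

text \<open>
  The usual argument works with the real inner product: expand the norm of \<open>F\<close> minus its partial sum,
  which is nonnegative, and use that characters act by isometries.
\<close>

lemma bessel:
  assumes N: "finite N" and [measurable]: "F \<in> borel_measurable M"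
    and sq: "integrable M (\<lambda>p. (norm (F p))\<^sup>2)"
  shows "(\<Sum>n\<in>N. (norm (coef M l r F n))\<^sup>2) \<le> (\<integral>p. (norm (F p))\<^sup>2 \<partial>M)"
proof -
  have F: "integrable M F"
  proof (rule Bochner_Integration.integrable_bound)
    show "integrable M (\<lambda>p. 1 + (norm (F p))\<^sup>2)"
      using sq by simp
    have "x \<le> 1 + x\<^sup>2" for x :: real
      using zero_le_power2[of "x - 1/2"] by (simp add: power2_eq_square algebra_simps)
    then show "AE x in M. norm (F x) \<le> norm (1 + (norm (F x))\<^sup>2)"
      by simp
  qed simp
  let ?c = "coef M l r F"
  let ?S = "\<lambda>p. \<Sum>n\<in>N. bimult (l n p) (r n p) (?c n)"
  have cross: "inner (F p) (bimult (l n p) (r n p) d) = inner (bimult (cnj (l n p)) (cnj (r n p)) (F p)) d" for p n d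
    by (simp add: inner_bimult_left)
  have int: "integrable M (\<lambda>p. inner (F p) (?S p))"
    using F by (simp add: inner_sum_right cross)
  have "(\<integral>p. inner (F p) (?S p) \<partial>M) = (\<Sum>n\<in>N. inner (?c n) (?c n))"
    using F by (simp add: inner_sum_right cross) (simp add: coef_def)
  then have cr: "(\<integral>p. inner (F p) (?S p) \<partial>M) = (\<Sum>n\<in>N. (norm (?c n))\<^sup>2)"
    by (simp add: power2_norm_eq_inner)
  have "0 \<le> (\<integral>p. (norm (F p - ?S p))\<^sup>2 \<partial>M)"
    by simp
  also have "\<dots> = (\<integral>p. (norm (F p))\<^sup>2 - 2 * inner (F p) (?S p) + (norm (?S p))\<^sup>2 \<partial>M)"
    by (simp add: power2_norm_eq_inner inner_diff inner_commute algebra_simps)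
  also have "\<dots> = (\<integral>p. (norm (F p))\<^sup>2 \<partial>M) - 2 * (\<Sum>n\<in>N. (norm (?c n))\<^sup>2) + (\<Sum>n\<in>N. (norm (?c n))\<^sup>2)"
    using sq int parseval_finite[OF N, of ?c] by (simp add: cr)
  finally show ?thesis
    by simp
qed

lemma coef_trig:
  assumes "finite N"
  shows "coef M l r (\<lambda>p. \<Sum>n\<in>N. bimult (l n p) (r n p) (c n)) m = (if m \<in> N then c m else 0)"
proof -
  have "coef M l r (\<lambda>p. \<Sum>n\<in>N. bimult (l n p) (r n p) (c n)) m =
      (\<Sum>n\<in>N. \<integral>p. bimult (l (n - m) p) (r (n - m) p) (c n) \<partial>M)"
    unfolding coef_def
    by (simp add: bimult_sum bimult_bimult mult.commute l_diff[symmetric] r_diff[symmetric])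
  also have "\<dots> = (if m \<in> N then c m else 0)"
    using assms by (simp add: ortho sum.delta')
  finally show ?thesis .
qed

lemma psum_trig:
  assumes "finite N" "N \<subseteq> N'" "finite N'"
  shows "psum M l r N' (\<lambda>p. \<Sum>n\<in>N. bimult (l n p) (r n p) (c n)) p = (\<Sum>n\<in>N. bimult (l n p) (r n p) (c n))"
proof -
  have "psum M l r N' (\<lambda>p. \<Sum>n\<in>N. bimult (l n p) (r n p) (c n)) p
      = (\<Sum>n\<in>N'. if n \<in> N then bimult (l n p) (r n p) (c n) else 0)"
    unfolding psum_def coef_trig[OF assms(1)] by (intro sum.cong) auto
  also have "\<dots> = (\<Sum>n\<in>N. bimult (l n p) (r n p) (c n))"
    using assms by (simp add: sum.If_cases Int_absorb1)
  finally show ?thesis .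
qed

end

text \<open>
  A bound for partial sums between two weighted L^2 spaces. It is required of integrable functions
  only, with both sides in \<open>[0, \<infinity>]\<close>, so that it can be applied slice by slice
  under Tonelli's theorem.
\<close>

definition admissible ::
    "'a measure \<Rightarrow> ('n \<Rightarrow> 'a \<Rightarrow> complex) \<Rightarrow> ('n \<Rightarrow> 'a \<Rightarrow> complex) \<Rightarrow> 'n set
      \<Rightarrow> ('a \<Rightarrow> ennreal) \<Rightarrow> ('a \<Rightarrow> ennreal) \<Rightarrow> bool" where
  "admissible M l r N \<alpha> \<beta> \<longleftrightarrow> (\<forall>G. integrable M G \<longrightarrow>
    (\<integral>\<^sup>+p. \<alpha> p * ennreal ((norm (psum M l r N G p))\<^sup>2) \<partial>M) \<le> (\<integral>\<^sup>+p. \<beta> p * ennreal ((norm (G p))\<^sup>2) \<partial>M))"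

lemma (in char_system) admissible_one:
  assumes "finite N"
  shows "admissible M l r N (\<lambda>_. 1) (\<lambda>_. 1)"
  unfolding admissible_def
proof (intro allI impI)
  fix G :: "'a \<Rightarrow> quat" assume G: "integrable M G"
  then have [measurable]: "G \<in> borel_measurable M"
    by simp
  show "(\<integral>\<^sup>+p. 1 * ennreal ((norm (psum M l r N G p))\<^sup>2) \<partial>M) \<le> (\<integral>\<^sup>+p. 1 * ennreal ((norm (G p))\<^sup>2) \<partial>M)"
  proof (cases "(\<integral>\<^sup>+p. ennreal ((norm (G p))\<^sup>2) \<partial>M) = \<infinity>")
    case False
    then have sq: "integrable M (\<lambda>p. (norm (G p))\<^sup>2)"
      by (intro integrableI_bounded) (auto simp: less_top)
    show ?thesis
      using bessel[OF assms _ sq]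
      by (simp add: psum_def parseval_finite_nn[OF assms] nn_integral_eq_integral[OF sq])
  qed simp
qed

definition tensor :: "('n \<Rightarrow> 'a \<Rightarrow> complex) \<Rightarrow> ('m \<Rightarrow> 'b \<Rightarrow> complex) \<Rightarrow> 'n \<times> 'm \<Rightarrow> 'a \<times> 'b \<Rightarrow> complex" where
  "tensor l l' n p = l (fst n) (fst p) * l' (snd n) (snd p)"

lemma char_system_tensor:
  assumes "char_system M l r" "char_system M' l' r'"
  shows "char_system (M \<Otimes>\<^sub>M M') (tensor l l') (tensor r r')"
proof -
  interpret A: char_system M l r by fact
  interpret B: char_system M' l' r' by fact
  interpret P: pair_prob_space M M' ..
  have meas [measurable]: "tensor l l' n \<in> borel_measurable (M \<Otimes>\<^sub>M M')"
    "tensor r r' n \<in> borel_measurable (M \<Otimes>\<^sub>M M')" for n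
    unfolding tensor_def[abs_def] by measurable
  have norm: "norm (tensor l l' n p) = 1" "norm (tensor r r' n p) = 1" for n p
    by (simp_all add: tensor_def norm_mult)
  show ?thesis
  proof
    show "tensor l l' (n - m) p = tensor l l' n p * cnj (tensor l l' m p)"
      "tensor r r' (n - m) p = tensor r r' n p * cnj (tensor r r' m p)" for n m p
      by (simp_all add: tensor_def A.l_diff B.l_diff A.r_diff B.r_diff)
    fix n q
    have int: "integrable (M \<Otimes>\<^sub>M M') (\<lambda>p. bimult (tensor l l' n p) (tensor r r' n p) q)"
      by (rule P.integrable_const_bound[where B = "norm q"]) (auto simp: norm)
    have "(\<integral>p. bimult (tensor l l' n p) (tensor r r' n p) q \<partial>(M \<Otimes>\<^sub>M M'))
        = (\<integral>p. \<integral>p'. bimult (tensor l l' n (p, p')) (tensor r r' n (p, p')) q \<partial>M' \<partial>M)"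
      by (rule P.integral_fst'[OF int, symmetric])
    also have "\<dots> = (\<integral>p. bimult (l (fst n) p) (r (fst n) p) (\<integral>p'. bimult (l' (snd n) p') (r' (snd n) p') q \<partial>M') \<partial>M)"
      by (simp add: tensor_def bimult_bimult[symmetric] integral_bounded_linear[OF bounded_linear_bimult])
    also have "\<dots> = (if n = 0 then q else 0)"
      by (auto simp: A.ortho B.ortho prod_eq_iff)
    finally show "(\<integral>p. bimult (tensor l l' n p) (tensor r r' n p) q \<partial>(M \<Otimes>\<^sub>M M')) = (if n = 0 then q else 0)" .
  qed (simp_all add: norm meas)
qed

text \<open>
  A partial sum over \<open>N \<times> N'\<close> is a partial sum over \<open>N'\<close> in the second variable followed by one over
  \<open>N\<close> in the first. Apply the first bound for each fixed second variable, exchange the integrals, and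
  apply the second bound for almost every fixed first variable. The exchange of sums with the action
  of the other variable is where commutation of left and right scalars enters.
\<close>

lemma admissible_tensor:
  fixes M :: "'b measure" and l r :: "'a::ab_group_add \<Rightarrow> 'b \<Rightarrow> complex"
    and M' :: "'d measure" and l' r' :: "'c::ab_group_add \<Rightarrow> 'd \<Rightarrow> complex"
  assumes "char_system M l r" "char_system M' l' r'"
  assumes adm: "admissible M l r N \<alpha> \<beta>" and adm': "admissible M' l' r' N' \<alpha>' \<beta>'"
  assumes fin: "finite N" "finite N'"
    and [measurable]: "\<alpha> \<in> borel_measurable M" "\<beta> \<in> borel_measurable M"
      "\<alpha>' \<in> borel_measurable M'" "\<beta>' \<in> borel_measurable M'"
  shows "admissible (M \<Otimes>\<^sub>M M') (tensor l l') (tensor r r') (N \<times> N')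
    (\<lambda>(p, p'). \<alpha> p * \<alpha>' p') (\<lambda>(p, p'). \<beta> p * \<beta>' p')"
  unfolding admissible_def
proof (intro allI impI)
  interpret A: char_system M l r by fact
  interpret B: char_system M' l' r' by fact
  interpret P: pair_prob_space M M' ..
  fix G :: "'b \<times> 'd \<Rightarrow> quat" assume G: "integrable (M \<Otimes>\<^sub>M M') G"
  then have [measurable]: "G \<in> borel_measurable (M \<Otimes>\<^sub>M M')"
    by simp
  let ?l = "tensor l l'" and ?r = "tensor r r'"
  let ?G' = "\<lambda>n' p. coef M' l' r' (\<lambda>p'. G (p, p')) n'"
  let ?H = "\<lambda>p p'. psum M' l' r' N' (\<lambda>p'. G (p, p')) p'"
  have intn: "integrable (M \<Otimes>\<^sub>M M') (\<lambda>(p, p'). bimult (cnj (l' n' p')) (cnj (r' n' p')) (G (p, p')))" for n'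
  proof (rule Bochner_Integration.integrable_bound[OF G])
    show "(\<lambda>(p, p'). bimult (cnj (l' n' p')) (cnj (r' n' p')) (G (p, p'))) \<in> borel_measurable (M \<Otimes>\<^sub>M M')"
      by measurable
  qed auto
  have G'int: "integrable M (?G' n')" for n'
    unfolding coef_def using P.integrable_fst[OF intn] .
  then have [measurable]: "?G' n' \<in> borel_measurable M" for n'
    by simp
  have Hmeas [measurable]: "case_prod ?H \<in> borel_measurable (M \<Otimes>\<^sub>M M')"
    unfolding psum_def by measurable
  have Hint: "integrable M (\<lambda>p. ?H p p')" for p'
    unfolding psum_def
    by (intro Bochner_Integration.integrable_sum integrable_bounded_linear[OF bounded_linear_bimult] G'int)
  have coef: "coef (M \<Otimes>\<^sub>M M') ?l ?r G (n, n') = coef M l r (?G' n') n" for n n'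
  proof -
    let ?f = "\<lambda>p p'. bimult (cnj (l n p * l' n' p')) (cnj (r n p * r' n' p')) (G (p, p'))"
    have int: "integrable (M \<Otimes>\<^sub>M M') (case_prod ?f)"
    proof (rule Bochner_Integration.integrable_bound[OF G])
      show "case_prod ?f \<in> borel_measurable (M \<Otimes>\<^sub>M M')"
        by measurable
    qed (auto simp: norm_mult)
    have slice: "AE p in M. integrable M' (\<lambda>p'. G (p, p'))"
      by (rule P.AE_integrable_fst') (fact G)
    have "coef (M \<Otimes>\<^sub>M M') ?l ?r G (n, n') = (\<integral>p. \<integral>p'. ?f p p' \<partial>M' \<partial>M)"
      unfolding coef_def P.integral_fst[OF int] by (simp add: tensor_def case_prod_beta')
    also have "\<dots> = (\<integral>p. bimult (cnj (l n p)) (cnj (r n p)) (?G' n' p) \<partial>M)"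
    proof (rule integral_cong_AE)
      show "AE p in M. (\<integral>p'. ?f p p' \<partial>M') = bimult (cnj (l n p)) (cnj (r n p)) (?G' n' p)"
        using slice
      proof eventually_elim
        case (elim p)
        then have "integrable M' (\<lambda>p'. bimult (cnj (l' n' p')) (cnj (r' n' p')) (G (p, p')))"
          by simp
        from integral_bounded_linear[OF bounded_linear_bimult this, of "cnj (l n p)" "cnj (r n p)"]
        show ?case
          by (simp add: coef_def bimult_bimult)
      qed
      show "(\<lambda>p. \<integral>p'. ?f p p' \<partial>M') \<in> borel_measurable M"
        using P.integrable_fst[OF int] by simp
    qed measurable
    finally show ?thesis
      by (simp add: coef_def)
  qed
  have psum: "psum (M \<Otimes>\<^sub>M M') ?l ?r (N \<times> N') G (p, p') = psum M l r N (\<lambda>z. ?H z p') p" for p p'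
  proof -
    have cH: "coef M l r (\<lambda>z. ?H z p') n
        = (\<Sum>n'\<in>N'. bimult (l' n' p') (r' n' p') (coef M l r (?G' n') n))" for n
    proof -
      have i: "integrable M (\<lambda>z. bimult (cnj (l n z)) (cnj (r n z)) (?G' n' z))" for n'
        using G'int by simp
      have "coef M l r (\<lambda>z. ?H z p') n
          = (\<integral>z. (\<Sum>n'\<in>N'. bimult (l' n' p') (r' n' p') (bimult (cnj (l n z)) (cnj (r n z)) (?G' n' z))) \<partial>M)"
        by (simp add: coef_def psum_def bimult_sum bimult_bimult mult.commute)
      also have "\<dots> = (\<Sum>n'\<in>N'. \<integral>z. bimult (l' n' p') (r' n' p') (bimult (cnj (l n z)) (cnj (r n z)) (?G' n' z)) \<partial>M)"
        by (intro Bochner_Integration.integral_sum integrable_bounded_linear[OF bounded_linear_bimult] i)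
      also have "\<dots> = (\<Sum>n'\<in>N'. bimult (l' n' p') (r' n' p') (coef M l r (?G' n') n))"
        by (simp add: integral_bounded_linear[OF bounded_linear_bimult i, unfolded coef_def] coef_def)
      finally show ?thesis .
    qed
    have "psum (M \<Otimes>\<^sub>M M') ?l ?r (N \<times> N') G (p, p')
        = (\<Sum>(n, n')\<in>N \<times> N'. bimult (l n p * l' n' p') (r n p * r' n' p') (coef M l r (?G' n') n))"
      unfolding psum_def by (intro sum.cong) (auto simp: coef tensor_def)
    also have "\<dots> = (\<Sum>n\<in>N. \<Sum>n'\<in>N'. bimult (l n p * l' n' p') (r n p * r' n' p') (coef M l r (?G' n') n))"
      by (rule sum.cartesian_product[symmetric])
    also have "\<dots> = psum M l r N (\<lambda>z. ?H z p') p"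
      unfolding psum_def[of M] cH by (simp add: bimult_sum bimult_bimult)
    finally show ?thesis .
  qed
  have slice: "AE p in M. integrable M' (\<lambda>p'. G (p, p'))"
    by (rule P.AE_integrable_fst') (fact G)
  have meas_ps: "(\<lambda>(p, p'). psum M l r N (\<lambda>z. ?H z p') p) \<in> borel_measurable (M \<Otimes>\<^sub>M M')"
    unfolding psum[symmetric] unfolding psum_def tensor_def by (simp add: case_prod_beta')
  have mL: "(\<lambda>(p, p'). (\<alpha> p * \<alpha>' p') * ennreal ((norm (psum M l r N (\<lambda>z. ?H z p') p))\<^sup>2))
      \<in> borel_measurable (M \<Otimes>\<^sub>M M')"
    using meas_ps by measurable
  have "(\<integral>\<^sup>+p. (case p of (p, p') \<Rightarrow> \<alpha> p * \<alpha>' p') *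
          ennreal ((norm (psum (M \<Otimes>\<^sub>M M') ?l ?r (N \<times> N') G p))\<^sup>2) \<partial>(M \<Otimes>\<^sub>M M'))
      = (\<integral>\<^sup>+p. (case p of (p, p') \<Rightarrow> (\<alpha> p * \<alpha>' p') * ennreal ((norm (psum M l r N (\<lambda>z. ?H z p') p))\<^sup>2))
          \<partial>(M \<Otimes>\<^sub>M M'))"
    by (intro nn_integral_cong) (auto simp: psum)
  also have "\<dots> = (\<integral>\<^sup>+p'. \<integral>\<^sup>+p. (\<alpha> p * \<alpha>' p') * ennreal ((norm (psum M l r N (\<lambda>z. ?H z p') p))\<^sup>2) \<partial>M \<partial>M')"
    using P.nn_integral_snd[OF mL, symmetric] by simp
  also have "\<dots> = (\<integral>\<^sup>+p'. \<alpha>' p' * (\<integral>\<^sup>+p. \<alpha> p * ennreal ((norm (psum M l r N (\<lambda>z. ?H z p') p))\<^sup>2) \<partial>M) \<partial>M')"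
    by (intro nn_integral_cong, subst nn_integral_cmult[symmetric])
      (auto simp: psum_def[of M] ac_simps)
  also have "\<dots> \<le> (\<integral>\<^sup>+p'. \<alpha>' p' * (\<integral>\<^sup>+p. \<beta> p * ennreal ((norm (?H p p'))\<^sup>2) \<partial>M) \<partial>M')"
    by (intro nn_integral_mono mult_left_mono adm[unfolded admissible_def, rule_format] Hint) simp
  also have "\<dots> = (\<integral>\<^sup>+p'. \<integral>\<^sup>+p. \<beta> p * (\<alpha>' p' * ennreal ((norm (?H p p'))\<^sup>2)) \<partial>M \<partial>M')"
    using Hint by (intro nn_integral_cong, subst nn_integral_cmult[symmetric])
      (auto simp: ac_simps dest!: borel_measurable_integrable)
  also have "\<dots> = (\<integral>\<^sup>+p. \<integral>\<^sup>+p'. \<beta> p * (\<alpha>' p' * ennreal ((norm (?H p p'))\<^sup>2)) \<partial>M' \<partial>M)"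
    by (rule P.Fubini') measurable
  also have "\<dots> = (\<integral>\<^sup>+p. \<beta> p * (\<integral>\<^sup>+p'. \<alpha>' p' * ennreal ((norm (?H p p'))\<^sup>2) \<partial>M') \<partial>M)"
    by (intro nn_integral_cong nn_integral_cmult) (auto simp: psum_def)
  also have "\<dots> \<le> (\<integral>\<^sup>+p. \<beta> p * (\<integral>\<^sup>+p'. \<beta>' p' * ennreal ((norm (G (p, p')))\<^sup>2) \<partial>M') \<partial>M)"
    using slice
    by (intro nn_integral_mono_AE, eventually_elim)
      (intro mult_left_mono adm'[unfolded admissible_def, rule_format], simp_all)
  also have "\<dots> = (\<integral>\<^sup>+p. \<integral>\<^sup>+p'. (\<beta> p * \<beta>' p') * ennreal ((norm (G (p, p')))\<^sup>2) \<partial>M' \<partial>M)"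
    by (intro nn_integral_cong_AE, use AE_space slice in eventually_elim)
      (subst nn_integral_cmult[symmetric], auto simp: ac_simps dest!: borel_measurable_integrable)
  also have "\<dots> = (\<integral>\<^sup>+p. (case p of (p, p') \<Rightarrow> \<beta> p * \<beta>' p') * ennreal ((norm (G p))\<^sup>2) \<partial>(M \<Otimes>\<^sub>M M'))"
    by (subst B.nn_integral_fst[symmetric]) (auto simp: case_prod_beta')
  finally show "(\<integral>\<^sup>+p. (case p of (p, p') \<Rightarrow> \<alpha> p * \<alpha>' p') *
          ennreal ((norm (psum (M \<Otimes>\<^sub>M M') ?l ?r (N \<times> N') G p))\<^sup>2) \<partial>(M \<Otimes>\<^sub>M M'))
      \<le> (\<integral>\<^sup>+p. (case p of (p, p') \<Rightarrow> \<beta> p * \<beta>' p') * ennreal ((norm (G p))\<^sup>2) \<partial>(M \<Otimes>\<^sub>M M'))" .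
qed

section \<open>Partial sums in one variable\<close>

text \<open>
  The switch \<open>s\<close> selects whether the one-dimensional characters act from the left or from the right, so
  that both variants share all proofs in one variable.
\<close>

definition lchar1 :: "bool \<Rightarrow> int \<Rightarrow> real \<Rightarrow> complex" where
  "lchar1 s n t = (if s then cexpt (of_int n * t) else 1)"

definition rchar1 :: "bool \<Rightarrow> int \<Rightarrow> real \<Rightarrow> complex" where
  "rchar1 s n t = (if s then 1 else cexpt (of_int n * t))"

definition onesided :: "bool \<Rightarrow> complex \<Rightarrow> quat \<Rightarrow> quat" where
  "onesided s z q = (if s then bimult z 1 q else bimult 1 z q)"

lemma bimult_char: "bimult (lchar1 s n t) (rchar1 s n t) q = onesided s (cexpt (of_int n * t)) q"
  "bimult (cnj (lchar1 s n t)) (cnj (rchar1 s n t)) q = onesided s (cnj (cexpt (of_int n * t))) q"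
  by (simp_all add: lchar1_def rchar1_def onesided_def)

lemma onesided_mult: "onesided s z (onesided s w q) = onesided s (z * w) q"
  by (simp add: onesided_def bimult_bimult)

lemma onesided_add: "onesided s (z + w) q = onesided s z q + onesided s w q"
  by (simp add: onesided_def bimult_add_left bimult_add_right)

lemma onesided_add_right: "onesided s z (p + q) = onesided s z p + onesided s z q"
  by (simp add: onesided_def bimult_add)

lemma onesided_zero [simp]: "onesided s z 0 = 0"
  by (simp add: onesided_def)

lemma onesided_zero_left [simp]: "onesided s 0 q = 0"
  using onesided_add[of s 0 0 q] by simp

lemma onesided_sum: "onesided s z (\<Sum>a\<in>A. f a) = (\<Sum>a\<in>A. onesided s z (f a))"
  by (simp add: onesided_def bimult_sum)

lemma norm_onesided [simp]: "norm (onesided s z q) = norm z * norm q"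
  by (simp add: onesided_def)

lemma onesided_measurable [measurable (raw)]:
  assumes "z \<in> borel_measurable M" "q \<in> borel_measurable M"
  shows "(\<lambda>x. onesided s (z x) (q x)) \<in> borel_measurable M"
  using assms unfolding onesided_def by (cases s) simp_all

lemma bounded_linear_onesided: "bounded_linear (\<lambda>z. onesided s z q)"
proof (rule bounded_linear_intro[where K = "norm q"])
  show "onesided s (r *\<^sub>R z) q = r *\<^sub>R onesided s z q" for r z
    by (simp add: onesided_def bimult_def bounded_linear_emb[THEN bounded_linear.linear, THEN linear_cmul])
qed (simp_all add: onesided_add mult.commute)

lemma char_system_1d: "char_system unit_lebesgue (lchar1 s) (rchar1 s)"
proof
  fix n m :: int and p :: real and q :: quat
  show "lchar1 s n \<in> borel_measurable unit_lebesgue" "rchar1 s n \<in> borel_measurable unit_lebesgue"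
    unfolding lchar1_def[abs_def] rchar1_def[abs_def] by measurable
  show "norm (lchar1 s n p) = 1" "norm (rchar1 s n p) = 1"
    by (simp_all add: lchar1_def rchar1_def)
  have "cexpt (of_int (n - m) * p) = cexpt (of_int n * p) * cnj (cexpt (of_int m * p))"
    by (simp add: cexpt_minus[symmetric] cexpt_add[symmetric] algebra_simps)
  then show "lchar1 s (n - m) p = lchar1 s n p * cnj (lchar1 s m p)" "rchar1 s (n - m) p = rchar1 s n p * cnj (rchar1 s m p)"
    by (simp_all add: lchar1_def rchar1_def)
  have "integrable unit_lebesgue (\<lambda>t. cexpt (of_int n * t))"
    by (rule unit_lebesgue.integrable_const_bound[where B = 1]) auto
  from integral_bounded_linear[OF bounded_linear_onesided this, of s q]
  show "(\<integral>p. bimult (lchar1 s n p) (rchar1 s n p) q \<partial>unit_lebesgue) = (if n = 0 then q else 0)"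
    unfolding bimult_char integral_cexpt by (cases "n = 0") (simp_all, simp add: onesided_def)
qed

lemma nn_integral_power_singularity:
  assumes "0 \<le> a" "a < 1"
  shows "(\<integral>\<^sup>+x. ennreal (\<bar>x - 1/2\<bar> powr (- a)) \<partial>unit_lebesgue) < \<infinity>"
proof -
  have base: "(\<lambda>x::real. x powr (- a)) integrable_on cbox 0 (1/2)"
    using integrable_on_powr_from_0[of "- a" "1/2"] assms by simp
  have "(\<lambda>x::real. (x - 1/2) powr (- a)) integrable_on {1/2..1}"
    using integrable_affinity[OF base, of 1 "- 1/2"] by (simp add: add.commute)
  then have R: "(\<lambda>x::real. \<bar>x - 1/2\<bar> powr (- a)) integrable_on {1/2..1}"
    by (rule integrable_eq) auto
  have "(\<lambda>x::real. (1/2 - x) powr (- a)) integrable_on {0..1/2}"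
    using integrable_affinity[OF base, of "-1" "1/2"] by simp
  then have L: "(\<lambda>x::real. \<bar>x - 1/2\<bar> powr (- a)) integrable_on {0..1/2}"
    by (rule integrable_eq) auto
  have "(\<lambda>x::real. \<bar>x - 1/2\<bar> powr (- a)) integrable_on {0..1}"
    by (rule Henstock_Kurzweil_Integration.integrable_combine[OF _ _ L R]) auto
  then have "(\<lambda>x::real. \<bar>x - 1/2\<bar> powr (- a)) absolutely_integrable_on {0..1}"
    by (subst absolutely_integrable_on_iff_nonneg) auto
  then have "integrable lborel (\<lambda>x::real. indicator {0..1} x *\<^sub>R (\<bar>x - 1/2\<bar> powr (- a)))"
    unfolding set_integrable_def by (subst (asm) integrable_completion) auto
  then have "(\<integral>\<^sup>+x. ennreal (indicator {0..1} x *\<^sub>R (\<bar>x - 1/2\<bar> powr (- a))) \<partial>lborel) < \<infinity>"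
    by (subst nn_integral_eq_integral) auto
  also have "(\<integral>\<^sup>+x. ennreal (indicator {0..1} x *\<^sub>R (\<bar>x - 1/2\<bar> powr (- a))) \<partial>lborel)
      = (\<integral>\<^sup>+x. ennreal (\<bar>x - 1/2\<bar> powr (- a)) \<partial>unit_lebesgue)"
    by (subst nn_integral_unit_lebesgue) (auto intro!: nn_integral_cong simp: indicator_def)
  finally show ?thesis .
qed

lemma one_plus_cexpt: "norm (1 + cexpt x) = 2 * \<bar>cos (pi * x)\<bar>"
proof -
  have "(norm (1 + cexpt x))\<^sup>2 = (1 + cos (2 * (pi * x)))\<^sup>2 + (sin (2 * (pi * x)))\<^sup>2"
    by (simp add: cmod_power2 cexpt_def mult.assoc)
  also have "\<dots> = 2 + 2 * cos (2 * (pi * x))"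
    using sin_cos_squared_add[of "2 * (pi * x)"] by (simp add: power2_eq_square algebra_simps)
  also have "\<dots> = (2 * \<bar>cos (pi * x)\<bar>)\<^sup>2"
    by (simp add: cos_double_cos power_mult_distrib)
  finally show ?thesis
    by (rule power2_eq_imp_eq) auto
qed

lemma one_plus_cexpt_le: "norm (1 + cexpt x) \<le> 2 * pi * \<bar>x - 1/2\<bar>"
proof -
  have "\<bar>cos (pi * x)\<bar> = \<bar>sin (pi * (1/2 - x))\<bar>"
    by (simp add: cos_sin_eq algebra_simps)
  also have "\<dots> \<le> \<bar>pi * (1/2 - x)\<bar>"
    by (rule abs_sin_x_le_abs_x)
  finally show ?thesis
    by (simp add: one_plus_cexpt abs_mult abs_minus_commute)
qed

lemma one_plus_cexpt_sq_le:
  assumes "0 \<le> x" "x \<le> 1"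
  shows "(norm (1 + cexpt x))\<^sup>2 \<le> 4 * pi\<^sup>2 * sqrt \<bar>x - 1/2\<bar>"
proof -
  have "\<bar>x - 1/2\<bar> \<le> 1"
    using assms by linarith
  then have "\<bar>x - 1/2\<bar>\<^sup>2 \<le> \<bar>x - 1/2\<bar>"
    using mult_left_le[of "\<bar>x - 1/2\<bar>" "\<bar>x - 1/2\<bar>"] by (simp add: power2_eq_square)
  then have "\<bar>x - 1/2\<bar>\<^sup>2 \<le> sqrt \<bar>x - 1/2\<bar>"
    using real_le_rsqrt order_trans by blast
  then have root: "4 * pi\<^sup>2 * \<bar>x - 1/2\<bar>\<^sup>2 \<le> 4 * pi\<^sup>2 * sqrt \<bar>x - 1/2\<bar>"
    by (rule mult_left_mono) simp
  have "(norm (1 + cexpt x))\<^sup>2 \<le> (2 * pi * \<bar>x - 1/2\<bar>)\<^sup>2"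
    by (intro power_mono one_plus_cexpt_le) simp
  also have "\<dots> = 4 * pi\<^sup>2 * \<bar>x - 1/2\<bar>\<^sup>2"
    unfolding power_mult_distrib by simp
  also note root
  finally show ?thesis .
qed

text \<open>
  One coefficient is at most the L^1 norm, and |x - 1/2|^(-1/2) is integrable: this is the
  Cauchy-Schwarz inequality with the weight |x - 1/2|^(1/2).
\<close>

lemma norm_coef_sq_le:
  assumes G: "integrable unit_lebesgue G"
  shows "ennreal ((norm (coef unit_lebesgue (lchar1 s) (rchar1 s) G n))\<^sup>2)
    \<le> (\<integral>\<^sup>+x. ennreal (\<bar>x - 1/2\<bar> powr (- 1/2)) \<partial>unit_lebesgue)
      * (\<integral>\<^sup>+x. ennreal (sqrt \<bar>x - 1/2\<bar> * (norm (G x))\<^sup>2) \<partial>unit_lebesgue)"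
proof -
  interpret char_system unit_lebesgue "lchar1 s" "rchar1 s"
    by (rule char_system_1d)
  have [measurable]: "G \<in> borel_measurable borel"
    using borel_measurable_integrable[OF G] by simp
  \<comment> \<open>The product of the two factors below is the norm of G away from \<open>1/2\<close>.\<close>
  define f where "f = (\<lambda>x::real. \<bar>x - 1/2\<bar> powr (- 1/4))"
  define g where "g = (\<lambda>x::real. \<bar>x - 1/2\<bar> powr (1/4) * norm (G x))"
  have [measurable]: "f \<in> borel_measurable borel" "g \<in> borel_measurable borel"
    unfolding f_def g_def by measurable
  have "ennreal (norm (coef unit_lebesgue (lchar1 s) (rchar1 s) G n)) \<le> ennreal (\<integral>x. norm (G x) \<partial>unit_lebesgue)"
    by (intro ennreal_leI norm_coef_le G)
  also have "\<dots> = (\<integral>\<^sup>+x. ennreal (norm (G x)) \<partial>unit_lebesgue)"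
    using G by (subst nn_integral_eq_integral) auto
  also have "\<dots> = (\<integral>\<^sup>+x. ennreal (f x) * ennreal (g x) \<partial>unit_lebesgue)"
    using AE_unit_lebesgue_mem
    by (intro nn_integral_cong_AE, eventually_elim)
      (simp add: f_def g_def ennreal_mult[symmetric] powr_minus field_simps)
  finally have "(ennreal (norm (coef unit_lebesgue (lchar1 s) (rchar1 s) G n)))\<^sup>2
      \<le> (\<integral>\<^sup>+x. ennreal (f x) * ennreal (g x) \<partial>unit_lebesgue)\<^sup>2"
    by (rule power_mono) simp
  also have "\<dots> \<le> (\<integral>\<^sup>+x. (ennreal (f x))\<^sup>2 \<partial>unit_lebesgue) * (\<integral>\<^sup>+x. (ennreal (g x))\<^sup>2 \<partial>unit_lebesgue)"
    by (rule Cauchy_Schwarz_nn_integral) auto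
  also have "(\<lambda>x. (ennreal (f x))\<^sup>2) = (\<lambda>x. ennreal (\<bar>x - 1/2\<bar> powr (- 1/2)))"
    by (simp add: f_def ennreal_power power2_eq_square ennreal_mult[symmetric] powr_add[symmetric])
  also have "(\<lambda>x. (ennreal (g x))\<^sup>2) = (\<lambda>x. ennreal (sqrt \<bar>x - 1/2\<bar> * (norm (G x))\<^sup>2))"
    by (simp add: g_def ennreal_power power_mult_distrib)
      (simp add: power2_eq_square powr_add[symmetric] powr_half_sqrt)
  finally show ?thesis
    by (simp add: ennreal_power)
qed

text \<open>
  Summation by parts. Multiplying by 1 + e(x) adds neighbouring coefficients. The new first and last
  coefficients are single old ones, because their other neighbour lies outside the range of summation.
\<close>

lemma psum_one_plus:
  fixes a b :: int
  assumes "a \<le> b"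
  shows "onesided s (1 + cexpt x) (\<Sum>n\<in>{a..b}. onesided s (cexpt (of_int n * x)) (c n))
    = (\<Sum>n\<in>{a..b+1}. onesided s (cexpt (of_int n * x))
        ((if n \<le> b then c n else 0) + (if a < n then c (n - 1) else 0)))"
proof -
  let ?E = "\<lambda>n. onesided s (cexpt (of_int n * x))"
  have step: "onesided s (1 + cexpt x) (?E n q) = ?E n q + ?E (n + 1) q" for n q
  proof -
    have "(1 + cexpt x) * cexpt (of_int n * x) = cexpt (of_int n * x) + cexpt (of_int (n + 1) * x)"
      by (simp add: cexpt_add[symmetric] algebra_simps)
    then show ?thesis
      by (simp only: onesided_mult onesided_add)
  qed
  have A: "(\<Sum>n\<in>{a..b}. ?E n (c n)) = (\<Sum>n\<in>{a..b+1}. ?E n (if n \<le> b then c n else 0))"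
    by (rule sum.mono_neutral_cong_left) auto
  have "(\<Sum>n\<in>{a..b}. ?E (n + 1) (c n)) = (\<Sum>n\<in>{a+1..b+1}. ?E n (c (n - 1)))"
    by (rule sum.reindex_bij_witness[where i = "\<lambda>n. n - 1" and j = "\<lambda>n. n + 1"]) auto
  also have "\<dots> = (\<Sum>n\<in>{a..b+1}. ?E n (if a < n then c (n - 1) else 0))"
    by (rule sum.mono_neutral_cong_left) auto
  finally have B: "(\<Sum>n\<in>{a..b}. ?E (n + 1) (c n))
    = (\<Sum>n\<in>{a..b+1}. ?E n (if a < n then c (n - 1) else 0))" .
  show ?thesis
    unfolding onesided_sum step sum.distrib onesided_add_right by (rule arg_cong2[where f = "(+)", OF A B])
qed

text \<open>
  The coefficients of (1 + e) times the partial sum are those of (1 + e)g in the interior, where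
  Bessel's inequality applies since |1 + e(x)|^2 is at most a multiple of |x - 1/2|^(1/2), and single
  coefficients of g at the two ends. The constant depends neither on the interval nor on the side.
\<close>

lemma admissible_boundary:
  obtains C where "C > 0"
    "\<And>s a b. admissible unit_lebesgue (lchar1 s) (rchar1 s) {a..b}
      (\<lambda>x. ennreal ((norm (1 + cexpt x))\<^sup>2)) (\<lambda>x. ennreal (C * sqrt \<bar>x - 1/2\<bar>))"
proof -
  define K where "K = enn2real (\<integral>\<^sup>+x. ennreal (\<bar>x - 1/2\<bar> powr (- 1/2)) \<partial>unit_lebesgue)"
  have K: "(\<integral>\<^sup>+x. ennreal (\<bar>x - 1/2\<bar> powr (- 1/2)) \<partial>unit_lebesgue) = ennreal K" "K \<ge> 0"
    using nn_integral_power_singularity[of "1/2"] by (auto simp: K_def less_top)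
  \<comment> \<open>The interior contributes \<open>4 * pi^2\<close> and each of the two ends contributes \<open>K\<close>.\<close>
  define C where "C = 4 * pi\<^sup>2 + 2 * K"
  have "C > 0"
    using K(2) by (auto simp: C_def intro!: add_pos_nonneg)
  moreover have "admissible unit_lebesgue (lchar1 s) (rchar1 s) {a..b}
      (\<lambda>x. ennreal ((norm (1 + cexpt x))\<^sup>2)) (\<lambda>x. ennreal (C * sqrt \<bar>x - 1/2\<bar>))" for s a b
    unfolding admissible_def
  proof (intro allI impI)
    interpret char_system unit_lebesgue "lchar1 s" "rchar1 s"
      by (rule char_system_1d)
    fix G :: "real \<Rightarrow> quat" assume G: "integrable unit_lebesgue G"
    have [measurable]: "G \<in> borel_measurable borel"
      using borel_measurable_integrable[OF G] by simp
    let ?c = "coef unit_lebesgue (lchar1 s) (rchar1 s) G"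
    let ?L = "\<integral>\<^sup>+p. ennreal ((norm (1 + cexpt p))\<^sup>2)
        * ennreal ((norm (psum unit_lebesgue (lchar1 s) (rchar1 s) {a..b} G p))\<^sup>2) \<partial>unit_lebesgue"
    let ?R = "\<integral>\<^sup>+x. ennreal (sqrt \<bar>x - 1/2\<bar> * (norm (G x))\<^sup>2) \<partial>unit_lebesgue"
    have R: "(\<integral>\<^sup>+p. ennreal (C * sqrt \<bar>p - 1/2\<bar>) * ennreal ((norm (G p))\<^sup>2) \<partial>unit_lebesgue)
        = ennreal C * ?R"
      using \<open>C > 0\<close> by (subst nn_integral_cmult[symmetric])
        (auto simp: ennreal_mult[symmetric] mult.assoc intro!: nn_integral_cong)
    have "?L \<le> ennreal C * ?R"
    proof (cases "a \<le> b \<and> ?R < \<infinity>")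
      case False
      then consider "a > b" | "?R = \<infinity>"
        by (auto simp: less_top[symmetric])
      then show ?thesis
      proof cases
        case 2
        then show ?thesis
          using \<open>C > 0\<close> by (simp add: ennreal_mult_top)
      qed (simp add: psum_def)
    next
      case True
      define r where "r = enn2real ?R"
      have r: "?R = ennreal r" "r \<ge> 0"
        using True by (auto simp: r_def)
      \<comment> \<open>The Fourier coefficients of \<open>1 + e\<close> times the partial sum.\<close>
      define d where "d n = (if n \<le> b then ?c n else 0) + (if a < n then ?c (n - 1) else 0)" for n
      define H where "H = (\<lambda>x. onesided s (1 + cexpt x) (G x))"
      have [measurable]: "H \<in> borel_measurable borel"
        unfolding H_def by measurable
      have Hle: "(norm (H x))\<^sup>2 \<le> 4 * pi\<^sup>2 * (sqrt \<bar>x - 1/2\<bar> * (norm (G x))\<^sup>2)" if "0 < x" "x < 1" for x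
      proof -
        have "(norm (1 + cexpt x))\<^sup>2 \<le> 4 * pi\<^sup>2 * sqrt \<bar>x - 1/2\<bar>"
          using that by (intro one_plus_cexpt_sq_le) auto
        from mult_right_mono[OF this zero_le_power2, of "norm (G x)"] show ?thesis
          by (simp only: H_def norm_onesided power_mult_distrib mult.assoc)
      qed
      have Hnn: "(\<integral>\<^sup>+x. ennreal ((norm (H x))\<^sup>2) \<partial>unit_lebesgue) \<le> ennreal (4 * pi\<^sup>2 * r)"
      proof -
        have "(\<integral>\<^sup>+x. ennreal ((norm (H x))\<^sup>2) \<partial>unit_lebesgue)
            \<le> (\<integral>\<^sup>+x. ennreal (4 * pi\<^sup>2) * ennreal (sqrt \<bar>x - 1/2\<bar> * (norm (G x))\<^sup>2) \<partial>unit_lebesgue)"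
          using AE_unit_lebesgue_mem
          by (intro nn_integral_mono_AE, eventually_elim) (simp add: ennreal_mult[symmetric] Hle)
        also have "\<dots> = ennreal (4 * pi\<^sup>2) * ennreal r"
          by (subst nn_integral_cmult) (auto simp: r)
        also have "\<dots> = ennreal (4 * pi\<^sup>2 * r)"
          using r(2) by (intro ennreal_mult[symmetric]) auto
        finally show ?thesis .
      qed
      then have Hsq: "integrable unit_lebesgue (\<lambda>x. (norm (H x))\<^sup>2)"
        by (intro integrableI_bounded) (auto simp: le_less_trans)
      have Hint: "(\<integral>x. (norm (H x))\<^sup>2 \<partial>unit_lebesgue) \<le> 4 * pi\<^sup>2 * r"
        using Hnn r(2) by (subst (asm) nn_integral_eq_integral[OF Hsq]) (auto simp: ennreal_le_iff)
      have edge: "(norm (?c n))\<^sup>2 \<le> K * r" for n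
      proof -
        have "ennreal ((norm (?c n))\<^sup>2) \<le> ennreal (K * r)"
          using norm_coef_sq_le[OF G, of s n, unfolded K(1) r(1)] K(2) r(2) by (simp add: ennreal_mult)
        then show ?thesis
          using K(2) r(2) by (simp add: ennreal_le_iff)
      qed
      have inner: "d n = coef unit_lebesgue (lchar1 s) (rchar1 s) H n" if "n \<in> {a<..b}" for n
      proof -
        have "onesided s (cnj (cexpt (of_int n * x))) (H x) = onesided s (cnj (cexpt (of_int n * x))) (G x)
            + onesided s (cnj (cexpt (of_int (n - 1) * x))) (G x)" for x
        proof -
          have "cnj (cexpt (of_int n * x)) * (1 + cexpt x)
              = cnj (cexpt (of_int n * x)) + cnj (cexpt (of_int (n - 1) * x))"
            by (simp add: cexpt_minus[symmetric] cexpt_add[symmetric] algebra_simps)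
          from this[THEN arg_cong, of "\<lambda>z. onesided s z (G x)"] show ?thesis
            unfolding H_def onesided_mult onesided_add[symmetric] .
        qed
        then have "coef unit_lebesgue (lchar1 s) (rchar1 s) H n = ?c n + ?c (n - 1)"
          using integrable_bimult_iff(2)[of G n] integrable_bimult_iff(2)[of G "n - 1"] G
          unfolding coef_def bimult_char by simp
        then show ?thesis
          using that by (simp add: d_def)
      qed
      have "?L = (\<integral>\<^sup>+p. ennreal ((norm (\<Sum>n\<in>{a..b+1}. bimult (lchar1 s n p) (rchar1 s n p) (d n)))\<^sup>2) \<partial>unit_lebesgue)"
      proof (rule nn_integral_cong)
        fix p
        have "norm (1 + cexpt p) * norm (psum unit_lebesgue (lchar1 s) (rchar1 s) {a..b} G p)
            = norm (\<Sum>n\<in>{a..b+1}. bimult (lchar1 s n p) (rchar1 s n p) (d n))"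
          using arg_cong[OF psum_one_plus[OF conjunct1[OF True], of s p ?c], of norm]
          unfolding norm_onesided psum_def bimult_char d_def .
        then show "ennreal ((norm (1 + cexpt p))\<^sup>2) * ennreal ((norm (psum unit_lebesgue (lchar1 s) (rchar1 s) {a..b} G p))\<^sup>2)
            = ennreal ((norm (\<Sum>n\<in>{a..b+1}. bimult (lchar1 s n p) (rchar1 s n p) (d n)))\<^sup>2)"
          by (simp add: ennreal_mult[symmetric] power_mult_distrib[symmetric])
      qed
      also have "\<dots> = ennreal (\<Sum>n\<in>{a..b+1}. (norm (d n))\<^sup>2)"
        by (rule parseval_finite_nn) simp
      also have "{a..b+1} = insert a (insert (b + 1) {a<..b})"
        using True by auto
      also have "(\<Sum>n\<in>insert a (insert (b + 1) {a<..b}). (norm (d n))\<^sup>2)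
          = (norm (d a))\<^sup>2 + ((norm (d (b + 1)))\<^sup>2 + (\<Sum>n\<in>{a<..b}. (norm (d n))\<^sup>2))"
        using True by simp
      also have "ennreal \<dots> \<le> ennreal (K * r + (K * r + 4 * pi\<^sup>2 * r))"
      proof (intro ennreal_leI add_mono)
        show "(norm (d a))\<^sup>2 \<le> K * r" "(norm (d (b + 1)))\<^sup>2 \<le> K * r"
          using edge[of a] edge[of b] True by (simp_all add: d_def)
        have "(\<Sum>n\<in>{a<..b}. (norm (d n))\<^sup>2) = (\<Sum>n\<in>{a<..b}. (norm (coef unit_lebesgue (lchar1 s) (rchar1 s) H n))\<^sup>2)"
          by (intro sum.cong) (auto simp: inner)
        also have "\<dots> \<le> (\<integral>x. (norm (H x))\<^sup>2 \<partial>unit_lebesgue)"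
          by (rule bessel) (auto simp: Hsq)
        also note Hint
        finally show "(\<Sum>n\<in>{a<..b}. (norm (d n))\<^sup>2) \<le> 4 * pi\<^sup>2 * r" .
      qed
      also have "K * r + (K * r + 4 * pi\<^sup>2 * r) = C * r"
        by (simp add: C_def algebra_simps)
      finally show ?thesis
        using \<open>C > 0\<close> r by (simp add: ennreal_mult)
    qed
    then show "?L \<le> (\<integral>\<^sup>+p. ennreal (C * sqrt \<bar>p - 1/2\<bar>) * ennreal ((norm (G p))\<^sup>2) \<partial>unit_lebesgue)"
      by (simp only: R)
  qed
  ultimately show ?thesis
    using that by blast
qed

section \<open>Partial sums over index_boxes in four variables\<close>

type_synonym phase = "(real \<times> real) \<times> (real \<times> real)"
type_synonym index = "(int \<times> int) \<times> (int \<times> int)"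

abbreviation "square_lebesgue \<equiv> unit_lebesgue \<Otimes>\<^sub>M unit_lebesgue"
abbreviation "cube_lebesgue \<equiv> square_lebesgue \<Otimes>\<^sub>M square_lebesgue"

definition lchar2 :: "int \<times> int \<Rightarrow> real \<times> real \<Rightarrow> complex" where
  "lchar2 = tensor (lchar1 True) (lchar1 False)"

definition rchar2 :: "int \<times> int \<Rightarrow> real \<times> real \<Rightarrow> complex" where
  "rchar2 = tensor (rchar1 True) (rchar1 False)"

definition lchar4 :: "index \<Rightarrow> phase \<Rightarrow> complex" where
  "lchar4 = tensor lchar2 lchar2"

definition rchar4 :: "index \<Rightarrow> phase \<Rightarrow> complex" where
  "rchar4 = tensor rchar2 rchar2"

lemma char_system_2d: "char_system square_lebesgue lchar2 rchar2"
  unfolding lchar2_def rchar2_def by (rule char_system_tensor[OF char_system_1d char_system_1d])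

lemma char_system_4d: "char_system cube_lebesgue lchar4 rchar4"
  unfolding lchar4_def rchar4_def by (rule char_system_tensor[OF char_system_2d char_system_2d])

interpretation sq: char_system square_lebesgue lchar2 rchar2
  by (rule char_system_2d)

interpretation cube: char_system cube_lebesgue lchar4 rchar4
  by (rule char_system_4d)

interpretation sq_pair: pair_prob_space unit_lebesgue unit_lebesgue ..

interpretation cube_pair: pair_prob_space square_lebesgue square_lebesgue ..

lemma lchar4_eq: "lchar4 ((k1, k2), (b1, b2)) ((x1, x2), (y1, y2)) = cexpt (of_int k1 * x1) * cexpt (of_int b1 * y1)"
  and rchar4_eq: "rchar4 ((k1, k2), (b1, b2)) ((x1, x2), (y1, y2)) = cexpt (of_int k2 * x2) * cexpt (of_int b2 * y2)"
  and lchar2_eq: "lchar2 (k1, k2) (x1, x2) = cexpt (of_int k1 * x1)"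
  and rchar2_eq: "rchar2 (k1, k2) (x1, x2) = cexpt (of_int k2 * x2)"
  by (simp_all add: lchar4_def rchar4_def lchar2_def rchar2_def tensor_def lchar1_def rchar1_def)

definition offcentre :: "real set" where "offcentre = {0<..<1} - {1/2}"

lemma offcentre_borel [measurable]: "offcentre \<in> sets borel"
  by (simp add: offcentre_def)

lemma AE_offcentre: "AE x in unit_lebesgue. x \<in> offcentre"
  using AE_unit_lebesgue_mem by eventually_elim (simp add: offcentre_def)

lemma AE_square: "AE x in square_lebesgue. fst x \<in> offcentre \<and> snd x \<in> offcentre"
proof (rule sq_pair.AE_pair_measure)
  show "{x \<in> space square_lebesgue. fst x \<in> offcentre \<and> snd x \<in> offcentre} \<in> sets square_lebesgue"
    by measurable
  show "AE x in unit_lebesgue. AE y in unit_lebesgue. fst (x, y) \<in> offcentre \<and> snd (x, y) \<in> offcentre"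
    using AE_offcentre
  proof eventually_elim
    case (elim x)
    show ?case
      using AE_offcentre by eventually_elim (use elim in simp)
  qed
qed

lemma AE_cube:
  "AE p in cube_lebesgue. (fst (fst p) \<in> offcentre \<and> snd (fst p) \<in> offcentre)
    \<and> fst (snd p) \<in> offcentre \<and> snd (snd p) \<in> offcentre"
proof (rule cube_pair.AE_pair_measure)
  show "{p \<in> space cube_lebesgue. (fst (fst p) \<in> offcentre \<and> snd (fst p) \<in> offcentre)
    \<and> fst (snd p) \<in> offcentre \<and> snd (snd p) \<in> offcentre} \<in> sets cube_lebesgue"
    by measurable
  show "AE x in square_lebesgue. AE y in square_lebesgue.
    (fst (fst (x, y)) \<in> offcentre \<and> snd (fst (x, y)) \<in> offcentre)
    \<and> fst (snd (x, y)) \<in> offcentre \<and> snd (snd (x, y)) \<in> offcentre"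
    using AE_square
  proof eventually_elim
    case (elim x)
    show ?case
      using AE_square by eventually_elim (use elim in simp)
  qed
qed

text \<open>
  The weight that controls the quotient of the Zak transform by the theta functions near their zeros.
\<close>

definition sing_weight :: "phase \<Rightarrow> real" where
  "sing_weight = (\<lambda>((x1, x2), (y1, y2)).
    (sqrt \<bar>x1 - 1/2\<bar> + sqrt \<bar>y1 - 1/2\<bar>) * (sqrt \<bar>x2 - 1/2\<bar> + sqrt \<bar>y2 - 1/2\<bar>))"

text \<open>
  An upper bound, up to a constant, for the squared theta factors. It is a sum of four products of
  functions of one variable each, which is what the tensor estimate needs.
\<close>

definition edge_weight :: "phase \<Rightarrow> real" where
  "edge_weight = (\<lambda>((x1, x2), (y1, y2)).
    ((norm (1 + cexpt x1))\<^sup>2 + (norm (1 + cexpt y1))\<^sup>2) * ((norm (1 + cexpt x2))\<^sup>2 + (norm (1 + cexpt y2))\<^sup>2))"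

lemma sing_weight_measurable [measurable]: "sing_weight \<in> borel_measurable cube_lebesgue"
  unfolding sing_weight_def case_prod_beta' by measurable

lemma edge_weight_measurable [measurable]: "edge_weight \<in> borel_measurable cube_lebesgue"
  unfolding edge_weight_def case_prod_beta' by measurable

lemma sing_weight_nonneg: "sing_weight p \<ge> 0"
  by (auto simp: sing_weight_def split: prod.splits)

lemma edge_weight_nonneg: "edge_weight p \<ge> 0"
  by (auto simp: edge_weight_def split: prod.splits)

abbreviation energy :: "(phase \<Rightarrow> real) \<Rightarrow> (phase \<Rightarrow> quat) \<Rightarrow> ennreal" where
  "energy w G \<equiv> \<integral>\<^sup>+p. ennreal (w p * (norm (G p))\<^sup>2) \<partial>cube_lebesgue"

abbreviation box_sum where "box_sum \<equiv> psum cube_lebesgue lchar4 rchar4"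

definition index_boxes :: "index set set" where
  "index_boxes = {({a..b} \<times> {a'..b'}) \<times> ({c..d} \<times> {c'..d'}) | a b a' b' c d c' d'. True}"

lemma finite_index_boxes: "N \<in> index_boxes \<Longrightarrow> finite N"
  by (auto simp: index_boxes_def)

lemma psum_measurable [measurable]: "box_sum N G \<in> borel_measurable cube_lebesgue"
  unfolding psum_def[abs_def] by measurable

text \<open>
  Expand \<open>edge_weight\<close> into its four products. Each selects one singular variable from \<open>x1\<close>, \<open>y1\<close> and one
  from \<open>x2\<close>, \<open>y2\<close>. The boundary estimate applies to the selected variables and Bessel's inequality to the
  others, and the four right-hand sides add up to a multiple of \<open>sing_weight\<close>.
\<close>

lemma box_partial_sum_bound:
  obtains C where "C > 0"
    "\<And>N G. N \<in> index_boxes \<Longrightarrow> integrable cube_lebesgue G \<Longrightarrow>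
      energy edge_weight (box_sum N G)
      \<le> ennreal C * energy sing_weight G"
proof -
  obtain C where C: "C > 0" "\<And>s a b. admissible unit_lebesgue (lchar1 s) (rchar1 s) {a..b}
      (\<lambda>x. ennreal ((norm (1 + cexpt x))\<^sup>2)) (\<lambda>x. ennreal (C * sqrt \<bar>x - 1/2\<bar>))"
    using admissible_boundary by blast
  \<comment> \<open>Output and input weight of one variable; \<open>u\<close> tells whether it is the selected singular variable.\<close>
  define wa where "wa u x = (if u then (norm (1 + cexpt x))\<^sup>2 else 1)" for u x
  define wb where "wb u x = (if u then C * sqrt \<bar>x - 1/2\<bar> else 1)" for u x
  have [measurable]: "wa u \<in> borel_measurable borel" "wb u \<in> borel_measurable borel" for u
    unfolding wa_def[abs_def] wb_def[abs_def] by measurable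
  have nonneg: "wa u x \<ge> 0" "wb u x \<ge> 0" for u x
    using C(1) by (auto simp: wa_def wb_def)
  have one: "admissible unit_lebesgue (lchar1 s) (rchar1 s) {a..b} (\<lambda>x. ennreal (wa u x)) (\<lambda>x. ennreal (wb u x))" for s u a b
  proof (cases u)
    case True
    then show ?thesis using C(2) by (simp add: wa_def wb_def)
  next
    case False
    then show ?thesis
      using char_system.admissible_one[OF char_system_1d, of "{a..b}"] by (simp add: wa_def wb_def)
  qed
  define A where "A u v = (\<lambda>((x1, x2), (y1, y2)). (wa u x1 * wa v x2) * (wa (\<not> u) y1 * wa (\<not> v) y2))" for u v
  define B where "B u v = (\<lambda>((x1, x2), (y1, y2)). (wb u x1 * wb v x2) * (wb (\<not> u) y1 * wb (\<not> v) y2))" for u v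
  have [measurable]: "A u v \<in> borel_measurable cube_lebesgue" "B u v \<in> borel_measurable cube_lebesgue" for u v
    unfolding A_def B_def case_prod_beta' by measurable
  have ABnonneg: "A u v p \<ge> 0" "B u v p \<ge> 0" for u v p
    by (auto simp: A_def B_def nonneg split: prod.splits)
  have adm: "admissible cube_lebesgue lchar4 rchar4 N (\<lambda>p. ennreal (A u v p)) (\<lambda>p. ennreal (B u v p))" if "N \<in> index_boxes" for N u v
  proof -
    obtain a b a' b' c d c' d' where N: "N = ({a..b} \<times> {a'..b'}) \<times> ({c..d} \<times> {c'..d'})"
      using \<open>N \<in> index_boxes\<close> unfolding index_boxes_def by blast
    have two: "admissible square_lebesgue lchar2 rchar2 ({a..b} \<times> {a'..b'})
        (\<lambda>(x, x'). ennreal (wa u x) * ennreal (wa v x')) (\<lambda>(x, x'). ennreal (wb u x) * ennreal (wb v x'))"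
      for a b a' b' u v
      unfolding lchar2_def rchar2_def
      by (rule admissible_tensor[OF char_system_1d char_system_1d one one]) auto
    have "admissible cube_lebesgue lchar4 rchar4 N
        (\<lambda>(x, y). (\<lambda>(x, x'). ennreal (wa u x) * ennreal (wa v x')) x * (\<lambda>(x, x'). ennreal (wa (\<not> u) x) * ennreal (wa (\<not> v) x')) y)
        (\<lambda>(x, y). (\<lambda>(x, x'). ennreal (wb u x) * ennreal (wb v x')) x * (\<lambda>(x, x'). ennreal (wb (\<not> u) x) * ennreal (wb (\<not> v) x')) y)"
      unfolding lchar4_def rchar4_def N
      by (rule admissible_tensor[OF char_system_2d char_system_2d two two]) auto
    then show ?thesis
      unfolding A_def B_def by (simp add: case_prod_beta' ennreal_mult nonneg)
  qed
  have sumA: "edge_weight p = A True True p + A True False p + A False True p + A False False p" for p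
    by (auto simp: edge_weight_def A_def wa_def algebra_simps split: prod.splits)
  have sumB: "B True True p + B True False p + B False True p + B False False p = C\<^sup>2 * sing_weight p" for p
    by (auto simp: sing_weight_def B_def wb_def algebra_simps power2_eq_square split: prod.splits)
  have "energy edge_weight (box_sum N G)
      \<le> ennreal (C\<^sup>2) * energy sing_weight G"
    if N: "N \<in> index_boxes" and G: "integrable cube_lebesgue G" for N G
  proof -
    have [measurable]: "G \<in> borel_measurable cube_lebesgue"
      using G by simp
    let ?a = "\<lambda>u v p. ennreal (A u v p) * ennreal ((norm (box_sum N G p))\<^sup>2)"
    let ?b = "\<lambda>u v p. ennreal (B u v p) * ennreal ((norm (G p))\<^sup>2)"
    have le: "integral\<^sup>N cube_lebesgue (?a u v) \<le> integral\<^sup>N cube_lebesgue (?b u v)" for u v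
      using adm[OF N] G unfolding admissible_def by blast
    have "energy edge_weight (box_sum N G)
        = (\<integral>\<^sup>+p. ?a True True p + ?a True False p + ?a False True p + ?a False False p \<partial>cube_lebesgue)"
      by (intro nn_integral_cong) (simp add: sumA ABnonneg ennreal_mult[symmetric] ennreal_plus[symmetric] distrib_right del: ennreal_plus)
    also have "\<dots> = integral\<^sup>N cube_lebesgue (?a True True) + integral\<^sup>N cube_lebesgue (?a True False)
        + integral\<^sup>N cube_lebesgue (?a False True) + integral\<^sup>N cube_lebesgue (?a False False)"
      by (simp add: nn_integral_add)
    also have "\<dots> \<le> integral\<^sup>N cube_lebesgue (?b True True) + integral\<^sup>N cube_lebesgue (?b True False)
        + integral\<^sup>N cube_lebesgue (?b False True) + integral\<^sup>N cube_lebesgue (?b False False)"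
      by (intro add_mono le)
    also have "\<dots> = (\<integral>\<^sup>+p. ?b True True p + ?b True False p + ?b False True p + ?b False False p \<partial>cube_lebesgue)"
      by (simp add: nn_integral_add)
    also have "\<dots> = (\<integral>\<^sup>+p. ennreal (C\<^sup>2) * ennreal (sing_weight p * (norm (G p))\<^sup>2) \<partial>cube_lebesgue)"
    proof (intro nn_integral_cong)
      fix p
      show "?b True True p + ?b True False p + ?b False True p + ?b False False p
          = ennreal (C\<^sup>2) * ennreal (sing_weight p * (norm (G p))\<^sup>2)"
        by (simp add: ABnonneg ennreal_mult[symmetric] ennreal_plus[symmetric] sing_weight_nonneg
            distrib_right[symmetric] sumB mult.assoc del: ennreal_plus)
    qed
    also have "\<dots> = ennreal (C\<^sup>2) * energy sing_weight G"
      by (rule nn_integral_cmult) measurable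
    finally show ?thesis .
  qed
  then show ?thesis
    using that[of "C\<^sup>2"] C(1) by simp
qed

section \<open>Size of the theta function\<close>

text \<open>
  The chord of the concave sine over [0, \<pi>/2] lies below its graph.
\<close>

lemma sin_ge_linear:
  assumes "0 \<le> t" "t \<le> (1/2::real)"
  shows "2 * t \<le> sin (pi * t)"
proof -
  have cvx: "convex_on {0..pi/2} (\<lambda>x. - sin x)"
  proof (rule f''_ge0_imp_convex)
    show "((\<lambda>x. - sin x) has_real_derivative - cos x) (at x)" for x :: real
      by (auto intro!: derivative_eq_intros)
    show "((\<lambda>x. - cos x) has_real_derivative sin x) (at x)" for x :: real
      by (auto intro!: derivative_eq_intros)
    show "0 \<le> sin x" if "x \<in> {0..pi/2}" for x :: real
      using that by (intro sin_ge_zero) (auto intro: order_trans)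
  qed simp
  have "- sin ((1 - 2 * t) *\<^sub>R 0 + (2 * t) *\<^sub>R (pi/2)) \<le> (1 - 2 * t) * (- sin 0) + (2 * t) * (- sin (pi/2))"
    by (rule convex_onD[OF cvx]) (use assms in auto)
  then show ?thesis
    by (simp add: mult.commute)
qed

lemma one_plus_cexpt_ge:
  assumes "0 \<le> x" "x \<le> 1"
  shows "4 * \<bar>x - 1/2\<bar> \<le> norm (1 + cexpt x)"
proof -
  have "\<bar>cos (pi * x)\<bar> = \<bar>sin (pi * (1/2 - x))\<bar>"
    by (simp add: cos_sin_eq algebra_simps)
  also have "\<dots> = \<bar>sin (pi * \<bar>x - 1/2\<bar>)\<bar>"
  proof (cases "x \<le> 1/2")
    case False
    have "sin (pi * (1/2 - x)) = - sin (pi * (x - 1/2))"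
      by (metis sin_minus minus_diff_eq mult_minus_right)
    then show ?thesis using False by simp
  qed (simp add: abs_of_nonpos)
  finally have "\<bar>cos (pi * x)\<bar> \<ge> 2 * \<bar>x - 1/2\<bar>"
    using sin_ge_linear[of "\<bar>x - 1/2\<bar>"] assms by linarith
  then show ?thesis
    by (simp add: one_plus_cexpt)
qed

lemma summable_on_exp_neg_abs: "(\<lambda>m::int. exp (- \<bar>real_of_int m\<bar>)) summable_on UNIV"
proof -
  have geo: "(\<lambda>n::nat. exp (- real n)) summable_on UNIV"
  proof (rule norm_summable_imp_summable_on)
    have "summable (\<lambda>n. exp (- 1 :: real) ^ n)"
      by (rule summable_geometric) simp
    then show "summable (\<lambda>n. norm (exp (- real n)))"
      by (simp add: exp_of_nat_mult[symmetric])
  qed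
  have "(\<lambda>m::int. exp (- \<bar>real_of_int m\<bar>)) summable_on range int"
    using geo by (subst summable_on_reindex) (auto simp: o_def)
  moreover have "(\<lambda>m::int. exp (- \<bar>real_of_int m\<bar>)) summable_on range (\<lambda>n. - int n)"
    using geo by (subst summable_on_reindex) (auto simp: o_def inj_on_def)
  ultimately have "(\<lambda>m::int. exp (- \<bar>real_of_int m\<bar>)) summable_on (range int \<union> range (\<lambda>n. - int n))"
    by (rule summable_on_union)
  also have "range int \<union> range (\<lambda>n. - int n) = UNIV"
    by (metis (no_types, lifting) UNIV_eq_I UnCI int_cases2 rangeI)
  finally show ?thesis .
qed

text \<open>
  For \<open>u = x - m\<close> the square dominates a line, u^2 \<ge> 2|u| - 1. This gives summable bounds that are
  uniform for bounded \<open>x\<close>.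
\<close>

lemma gaussian_le_exp:
  assumes "\<bar>x\<bar> \<le> R"
  shows "exp (- pi * (x - of_int m)\<^sup>2) \<le> exp (1 + 2 * R) * exp (- \<bar>real_of_int m\<bar>)"
proof -
  let ?u = "x - of_int m"
  have "0 \<le> (\<bar>?u\<bar> - 1)\<^sup>2"
    by simp
  then have "2 * \<bar>?u\<bar> - 1 \<le> ?u\<^sup>2"
    by (simp add: power2_eq_square algebra_simps)
  also have "?u\<^sup>2 \<le> pi * ?u\<^sup>2"
    using pi_ge_two by (intro mult_le_cancel_right1[THEN iffD2]) auto
  finally have "- pi * ?u\<^sup>2 \<le> 1 - 2 * \<bar>?u\<bar>"
    by simp
  also have "\<dots> \<le> 1 + 2 * R + - \<bar>real_of_int m\<bar>"
  proof -
    have "\<bar>real_of_int m\<bar> \<le> \<bar>x\<bar> + \<bar>?u\<bar>" "0 \<le> \<bar>real_of_int m\<bar>"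
      by arith+
    then show ?thesis
      using assms by (smt (verit))
  qed
  finally show ?thesis
    unfolding exp_add[symmetric] by simp
qed

definition theta_term :: "real \<Rightarrow> real \<Rightarrow> int \<Rightarrow> complex" where
  "theta_term x y m = cexpt (- of_int m * y) * of_real (exp (- pi * (x - of_int m)\<^sup>2))"

text \<open>
  Up to the sign of its second argument this is the Zak transform of the Gaussian on the line.
\<close>

definition theta :: "real \<Rightarrow> real \<Rightarrow> complex" where
  "theta x y = (\<Sum>\<^sub>\<infinity>m. theta_term x y m)"

lemma norm_theta_term: "norm (theta_term x y m) = exp (- pi * (x - of_int m)\<^sup>2)"
  by (simp add: theta_term_def norm_mult)

lemma theta_term_abs_summable: "(\<lambda>m. norm (theta_term x y m)) summable_on UNIV"
  unfolding norm_theta_term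
  by (rule summable_on_comparison_test[OF summable_on_cmult_right[OF summable_on_exp_neg_abs]])
    (use gaussian_le_exp[OF order_refl] in auto)

lemma theta_term_summable: "theta_term x y summable_on UNIV"
  using theta_term_abs_summable by (rule abs_summable_summable)

lemma continuous_theta: "continuous_on UNIV (\<lambda>(x, y). theta x y)"
proof -
  have "continuous_on {p :: real \<times> real. \<bar>fst p\<bar> < R} (\<lambda>p. theta (fst p) (snd p))" for R
  proof -
    have "uniform_limit {p :: real \<times> real. \<bar>fst p\<bar> < R} (\<lambda>X p. \<Sum>m\<in>X. theta_term (fst p) (snd p) m)
        (\<lambda>p. \<Sum>\<^sub>\<infinity>m. theta_term (fst p) (snd p) m) (finite_subsets_at_top UNIV)"
    proof (rule Weierstrass_m_test_general)
      show "(\<lambda>m. exp (1 + 2 * R) * exp (- \<bar>real_of_int m\<bar>)) summable_on UNIV"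
        by (intro summable_on_cmult_right summable_on_exp_neg_abs)
      show "norm (theta_term (fst p) (snd p) m) \<le> exp (1 + 2 * R) * exp (- \<bar>real_of_int m\<bar>)"
        if "p \<in> {p. \<bar>fst p\<bar> < R}" for p m
        unfolding norm_theta_term using that by (intro gaussian_le_exp) auto
    qed
    then show ?thesis
      unfolding theta_def
      by (rule uniform_limit_theorem[rotated])
        (auto intro!: always_eventually continuous_intros simp: theta_term_def)
  qed
  then have "isCont (\<lambda>p. theta (fst p) (snd p)) p" for p
  proof -
    have "open {q :: real \<times> real. \<bar>fst q\<bar> < \<bar>fst p\<bar> + 1}"
      by (intro open_Collect_less continuous_intros)
    then show ?thesis
      using \<open>\<And>R. continuous_on {p :: real \<times> real. \<bar>fst p\<bar> < R} (\<lambda>p. theta (fst p) (snd p))\<close>[of "\<bar>fst p\<bar> + 1"]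
      by (cases p) (simp add: continuous_on_eq_continuous_at)
  qed
  then show ?thesis
    by (auto simp: continuous_at_imp_continuous_on case_prod_beta')
qed

lemma continuous_on_theta [continuous_intros]:
  assumes "continuous_on S f" "continuous_on S g"
  shows "continuous_on S (\<lambda>p. theta (f p) (g p))"
  using continuous_on_compose2[OF continuous_theta continuous_on_Pair[OF assms]] by simp

lemma theta_measurable [measurable (raw)]:
  assumes "f \<in> borel_measurable M" "g \<in> borel_measurable M"
  shows "(\<lambda>p. theta (f p) (g p)) \<in> borel_measurable M"
  using borel_measurable_continuous_Pair[OF assms continuous_theta[unfolded case_prod_beta']] by simp

text \<open>
  The terms at \<open>- k\<close> and \<open>k + 1\<close> are mirror images with respect to \<open>x = 1/2\<close>, and they cancel at
  \<open>x = y = 1/2\<close>.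
\<close>

lemma theta_pairs: "((\<lambda>k. theta_term x y (- int k) + theta_term x y (int k + 1)) has_sum theta x y) UNIV"
    "(\<lambda>k. norm (theta_term x y (- int k) + theta_term x y (int k + 1))) summable_on UNIV"
proof -
  have inj: "inj_on (\<lambda>k. - int k) UNIV" "inj_on (\<lambda>k. int k + 1) UNIV"
    by (auto simp: inj_on_def)
  have U: "(UNIV :: int set) = range (\<lambda>k. - int k) \<union> range (\<lambda>k. int k + 1)"
  proof -
    have "m \<in> range (\<lambda>k. - int k) \<union> range (\<lambda>k. int k + 1)" for m
    proof (cases "m \<le> 0")
      case True
      then have "m = - int (nat (- m))" by simp
      then show ?thesis by blast
    next
      case False
      then have "m = int (nat (m - 1)) + 1" by simp
      then show ?thesis by blast
    qed
    then show ?thesis by blast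
  qed
  have disj: "range (\<lambda>k. - int k) \<inter> range (\<lambda>k. int k + 1) = {}"
    by auto
  have s1: "theta_term x y summable_on range (\<lambda>k. - int k)" "theta_term x y summable_on range (\<lambda>k. int k + 1)"
    by (auto intro: summable_on_subset_banach[OF theta_term_summable])
  then have h: "((\<lambda>k. theta_term x y (- int k)) has_sum (\<Sum>\<^sub>\<infinity>m\<in>range (\<lambda>k. - int k). theta_term x y m)) UNIV"
    "((\<lambda>k. theta_term x y (int k + 1)) has_sum (\<Sum>\<^sub>\<infinity>m\<in>range (\<lambda>k. int k + 1). theta_term x y m)) UNIV"
    using has_sum_reindex[OF inj(1)] has_sum_reindex[OF inj(2)] has_sum_infsum by (force simp: o_def)+
  have "theta x y = (\<Sum>\<^sub>\<infinity>m\<in>range (\<lambda>k. - int k). theta_term x y m) + (\<Sum>\<^sub>\<infinity>m\<in>range (\<lambda>k. int k + 1). theta_term x y m)"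
    unfolding theta_def by (subst U) (rule infsum_Un_disjoint[OF s1 disj])
  then show "((\<lambda>k. theta_term x y (- int k) + theta_term x y (int k + 1)) has_sum theta x y) UNIV"
    using has_sum_add[OF h] by simp
  have "(\<lambda>m. norm (theta_term x y m)) summable_on range (\<lambda>k. - int k)"
    "(\<lambda>m. norm (theta_term x y m)) summable_on range (\<lambda>k. int k + 1)"
    by (auto intro: summable_on_subset_banach[OF theta_term_abs_summable])
  then have "(\<lambda>k. norm (theta_term x y (- int k)) + norm (theta_term x y (int k + 1))) summable_on UNIV"
    by (intro summable_on_add) (simp_all add: summable_on_reindex[OF inj(1)] summable_on_reindex[OF inj(2)] o_def)
  then show "(\<lambda>k. norm (theta_term x y (- int k) + theta_term x y (int k + 1))) summable_on UNIV"
    by (rule summable_on_comparison_test) (auto intro: norm_triangle_ineq)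
qed

lemma exp_pi_ge: "exp (- pi) \<le> 2/17"
proof -
  have "exp 3 \<ge> 1 + 3 + 3\<^sup>2 / (2::real)"
    using exp_lower_Taylor_quadratic[of 3] by simp
  also have "exp (3::real) \<le> exp pi"
    using pi_gt3 by simp
  finally show ?thesis
    by (simp add: exp_minus field_simps)
qed

text \<open>
  With z = exp(2 \<pi> (x - 1/2) - 2 \<pi> i (y - 1/2)), the term at k + 1 is - z^(2k+1) times the term
  at -k, so every pair contains the factor 1 - z. The remaining geometric sum has 2k + 1 \<le> 3^k
  terms and the Gaussian contributes exp(- \<pi> k^2) \<le> (2/17)^k, whence the ratio 6/17.
\<close>

lemma theta_pair:
  fixes x y :: real and k :: nat
  defines "z \<equiv> of_real (exp (2 * pi * (x - 1/2))) * cnj (cexpt (y - 1/2))"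
  assumes x: "0 \<le> x" "x \<le> 1"
  defines "A \<equiv> exp (- pi * x\<^sup>2)"
  shows "k = 0 \<Longrightarrow> theta_term x y (- int k) + theta_term x y (int k + 1) = of_real A * (1 - z)"
    and "norm (theta_term x y (- int k) + theta_term x y (int k + 1)) \<le> A * norm (1 - z) * (6/17) ^ k"
proof -
  define s where "s = x - 1/2"
  have half: "cexpt (y - 1/2) = - cexpt y"
    using cexpt_add[of y "- 1/2"] by (simp add: cexpt_def complex_eq_iff)
  have key: "theta_term x y (int k + 1) = - theta_term x y (- int k) * z ^ (2 * k + 1)"
  proof -
    have "z ^ (2 * k + 1) = of_real (exp (2 * pi * s) ^ (2 * k + 1)) * (- cnj (cexpt y)) ^ (2 * k + 1)"
      unfolding z_def half s_def by (simp add: power_mult_distrib)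
    also have "(- cnj (cexpt y)) ^ (2 * k + 1) = - cexpt (- of_int (2 * int k + 1) * y)"
    proof -
      have "cnj (cexpt y) ^ n = cexpt (- real n * y)" for n
        by (induction n) (simp_all add: cexpt_minus[symmetric] cexpt_add[symmetric] algebra_simps)
      from this[of "2 * k + 1"] show ?thesis
        by (simp add: power_minus_odd algebra_simps del: power_Suc)
    qed
    also have "exp (2 * pi * s) ^ (2 * k + 1) = exp (2 * pi * s * real (2 * k + 1))"
      by (subst exp_of_nat_mult[symmetric]) (simp add: mult.commute)
    finally have z: "z ^ (2 * k + 1) = - (of_real (exp (2 * pi * s * real (2 * k + 1))) * cexpt (- of_int (2 * int k + 1) * y))"
      by simp
    have e: "exp (- pi * (x - of_int (int k + 1))\<^sup>2) = exp (- pi * (x - of_int (- int k))\<^sup>2) * exp (2 * pi * s * real (2 * k + 1))"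
      unfolding exp_add[symmetric] by (simp add: s_def power2_eq_square algebra_simps)
    have c: "cexpt (- of_int (int k + 1) * y) = cexpt (- of_int (- int k) * y) * cexpt (- of_int (2 * int k + 1) * y)"
      unfolding cexpt_add[symmetric] by (simp add: algebra_simps)
    show ?thesis
      unfolding theta_term_def z e c by (simp add: ac_simps)
  qed
  have "theta_term x y (- int k) + theta_term x y (int k + 1) = theta_term x y (- int k) * (1 - z ^ (2 * k + 1))"
    unfolding key by (simp add: algebra_simps)
  then have eq: "theta_term x y (- int k) + theta_term x y (int k + 1)
      = theta_term x y (- int k) * ((1 - z) * (\<Sum>l<2 * k + 1. z ^ l))"
    by (simp only: one_diff_power_eq)
  show "theta_term x y (- int k) + theta_term x y (int k + 1) = of_real A * (1 - z)" if "k = 0"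
    unfolding eq using that by (simp add: theta_term_def A_def)
  have nz: "norm z = exp (2 * pi * s)"
    by (simp add: z_def norm_mult s_def)
  have "norm (\<Sum>l<2 * k + 1. z ^ l) \<le> (\<Sum>l<2 * k + 1. exp (2 * pi * s * real l))"
    by (rule order_trans[OF norm_sum]) (simp add: norm_power nz exp_of_nat2_mult[symmetric])
  also have "\<dots> \<le> (\<Sum>l<2 * k + 1. exp (pi * real k) * exp (2 * pi * s * real k))"
  proof (rule sum_mono)
    fix l assume "l \<in> {..<2 * k + 1}"
    then have l: "\<bar>real l - real k\<bar> \<le> real k"
      by auto
    have "2 * pi * s * (real l - real k) \<le> \<bar>2 * pi * s\<bar> * \<bar>real l - real k\<bar>"
      by (metis abs_ge_self abs_mult)
    also have "\<dots> \<le> pi * real k"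
    proof (rule mult_mono)
      have "\<bar>s\<bar> \<le> 1/2"
        using x unfolding s_def by linarith
      then show "\<bar>2 * pi * s\<bar> \<le> pi"
        by (simp add: abs_mult)
    qed (use l in auto)
    finally have "2 * pi * s * real l \<le> pi * real k + 2 * pi * s * real k"
      by (simp add: algebra_simps)
    then show "exp (2 * pi * s * real l) \<le> exp (pi * real k) * exp (2 * pi * s * real k)"
      unfolding exp_add[symmetric] by simp
  qed
  also have "\<dots> = real (2 * k + 1) * (exp (pi * real k) * exp (2 * pi * s * real k))"
    by simp
  finally have S: "norm (\<Sum>l<2 * k + 1. z ^ l) \<le> real (2 * k + 1) * (exp (pi * real k) * exp (2 * pi * s * real k))" .
  have "norm (theta_term x y (- int k) + theta_term x y (int k + 1))
      \<le> exp (- pi * (x + real k)\<^sup>2) * (norm (1 - z) * (real (2 * k + 1) * (exp (pi * real k) * exp (2 * pi * s * real k))))"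
    unfolding eq norm_mult norm_theta_term using S by (intro mult_mono) (auto intro: mult_left_mono)
  also have "\<dots> = A * norm (1 - z) * (real (2 * k + 1) * exp (- pi * (real k)\<^sup>2))"
  proof -
    have "exp (- pi * (x + real k)\<^sup>2) * (exp (pi * real k) * exp (2 * pi * s * real k)) = A * exp (- pi * (real k)\<^sup>2)"
      unfolding A_def exp_add[symmetric] by (simp add: s_def power2_eq_square algebra_simps)
    then show ?thesis
      by (metis (no_types, opaque_lifting) mult.assoc mult.left_commute)
  qed
  also have "\<dots> \<le> A * norm (1 - z) * (6/17) ^ k"
  proof (rule mult_left_mono)
    have "real (2 * k + 1) \<le> 3 ^ k"
      by (induction k) auto
    moreover have "exp (- pi * (real k)\<^sup>2) \<le> (2/17) ^ k"
    proof -
      have "real k \<le> (real k)\<^sup>2"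
        by (cases k) (auto simp: power2_eq_square)
      then have "exp (- pi * (real k)\<^sup>2) \<le> exp (real k * (- pi))"
        by simp
      also have "\<dots> = exp (- pi) ^ k"
        by (rule exp_of_nat_mult)
      also have "\<dots> \<le> (2/17) ^ k"
        by (intro power_mono exp_pi_ge) simp
      finally show ?thesis .
    qed
    ultimately have "real (2 * k + 1) * exp (- pi * (real k)\<^sup>2) \<le> 3 ^ k * (2/17) ^ k"
      by (intro mult_mono) auto
    then show "real (2 * k + 1) * exp (- pi * (real k)\<^sup>2) \<le> (6/17) ^ k"
      by (simp add: power_mult_distrib[symmetric])
  qed (simp add: A_def)
  finally show "norm (theta_term x y (- int k) + theta_term x y (int k + 1)) \<le> A * norm (1 - z) * (6/17) ^ k" .
qed

text \<open>
  Summing the pairs with \<open>k \<ge> 1\<close> as a geometric series of ratio \<open>6/17\<close> gives \<open>6/11 < 1\<close> times the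
  leading pair. So theta is comparable to the factor 1 - z, and has no zero but that of this factor.
\<close>

lemma theta_approx:
  fixes x y :: real
  defines "z \<equiv> of_real (exp (2 * pi * (x - 1/2))) * cnj (cexpt (y - 1/2))"
  assumes x: "0 \<le> x" "x \<le> 1"
  shows "norm (theta x y - of_real (exp (- pi * x\<^sup>2)) * (1 - z)) \<le> 6/11 * (exp (- pi * x\<^sup>2) * norm (1 - z))"
proof -
  define B where "B = exp (- pi * x\<^sup>2) * norm (1 - z)"
  define u where "u k = theta_term x y (- int k) + theta_term x y (int k + 1)" for k
  have u0: "u 0 = of_real (exp (- pi * x\<^sup>2)) * (1 - z)"
    unfolding u_def z_def by (rule theta_pair(1)[OF x]) simp
  have "u sums theta x y"
    using has_sum_imp_sums[OF theta_pairs(1)] unfolding u_def by blast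
  then have tail: "(\<lambda>k. u (Suc k)) sums (theta x y - u 0)"
    by (simp add: sums_Suc_iff)
  have bnd: "norm (u (Suc k)) \<le> B * (6/17) * (6/17) ^ k" for k
    using theta_pair(2)[OF x, where k = "Suc k" and y = y] unfolding u_def B_def z_def by (simp add: mult.assoc)
  have geo: "(\<lambda>k. B * (6/17) * (6/17) ^ k) sums (B * (6/17) * (1 / (1 - 6/17)))"
    by (intro sums_mult geometric_sums) simp
  have "norm (theta x y - u 0) \<le> B * (6/17) * (1 / (1 - 6/17))"
    using norm_suminf_le[of "\<lambda>k. u (Suc k)" "\<lambda>k. B * (6/17) * (6/17) ^ k"] bnd sums_unique[OF tail]
      sums_unique[OF geo] sums_summable[OF geo] by simp
  then show ?thesis
    by (simp add: u0 B_def mult.commute)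
qed

lemma exp_minus_one_bounds:
  fixes a :: real
  shows "\<bar>a\<bar> * exp (- \<bar>a\<bar>) \<le> \<bar>exp a - 1\<bar>" "\<bar>exp a - 1\<bar> \<le> \<bar>a\<bar> * exp \<bar>a\<bar>"
proof -
  have 1: "b * exp (- b) \<le> 1 - exp (- b)" "1 - exp (- b) \<le> b" "b \<le> exp b - 1" "exp b - 1 \<le> b * exp b" if "b \<ge> 0" for b :: real
  proof -
    have "1 + b \<le> exp b" "1 + (- b) \<le> exp (- b)"
      by (rule exp_ge_add_one_self)+
    then show "b \<le> exp b - 1" "1 - exp (- b) \<le> b" by linarith+
    have "(1 + b) * exp (- b) \<le> exp b * exp (- b)"
      using \<open>1 + b \<le> exp b\<close> by (intro mult_right_mono) auto
    then show "b * exp (- b) \<le> 1 - exp (- b)"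
      by (simp add: exp_minus field_simps)
    have "(1 + (- b)) * exp b \<le> exp (- b) * exp b"
      using \<open>1 + (- b) \<le> exp (- b)\<close> by (intro mult_right_mono) auto
    then show "exp b - 1 \<le> b * exp b"
      by (simp add: exp_minus field_simps)
  qed
  have e: "b * exp (- b) \<le> b" "b \<le> b * exp b" if "b \<ge> 0" for b :: real
    using that by (auto simp: mult_le_cancel_left1 mult_le_cancel_left2)
  show "\<bar>a\<bar> * exp (- \<bar>a\<bar>) \<le> \<bar>exp a - 1\<bar>" "\<bar>exp a - 1\<bar> \<le> \<bar>a\<bar> * exp \<bar>a\<bar>"
    using 1[of "\<bar>a\<bar>"] e[of "\<bar>a\<bar>"] by (cases "a \<ge> 0"; simp; linarith)+
qed

text \<open>
  The number 1 - z from \<open>theta_approx\<close> vanishes to first order exactly when |z| = 1, that is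
  x = 1/2, and z has argument zero, that is y = 1/2.
\<close>

lemma theta_bounds:
  obtains c C where "c > 0" "C > 0"
    "\<And>x y. x \<in> {0..1} \<Longrightarrow> y \<in> {0..1} \<Longrightarrow> c * (\<bar>x - 1/2\<bar> + \<bar>y - 1/2\<bar>) \<le> norm (theta x y)"
    "\<And>x y. x \<in> {0..1} \<Longrightarrow> y \<in> {0..1} \<Longrightarrow>
      (norm (theta x y))\<^sup>2 \<le> C * ((norm (1 + cexpt x))\<^sup>2 + (norm (1 + cexpt y))\<^sup>2)"
proof -
  define c1 where "c1 = min (2 * pi * exp (- pi)) 2 / 2"
  define c where "c = 5/11 * (exp (- pi) * c1)"
  have c1: "c1 > 0" by (simp add: c1_def)
  then have "c > 0" by (simp add: c_def)
  define C1 where "C1 = exp pi * 2"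
  define C where "C = (17/11)\<^sup>2 * (2 * C1\<^sup>2)"
  have C1: "C1 > 0" by (simp add: C1_def)
  then have "C > 0" by (simp add: C_def)
  have main: "c * (\<bar>x - 1/2\<bar> + \<bar>y - 1/2\<bar>) \<le> norm (theta x y) \<and>
      (norm (theta x y))\<^sup>2 \<le> C * ((norm (1 + cexpt x))\<^sup>2 + (norm (1 + cexpt y))\<^sup>2)"
    if x: "x \<in> {0..1}" and y: "y \<in> {0..1}" for x y :: real
  proof -
    define z where "z = of_real (exp (2 * pi * (x - 1/2))) * cnj (cexpt (y - 1/2))"
    define w where "w = cnj (cexpt (y - 1/2))"
    have half: "cexpt (y - 1/2) = - cexpt y"
      using cexpt_add[of y "- 1/2"] by (simp add: cexpt_def complex_eq_iff)
    have w1: "norm w = 1" "norm (1 - w) = norm (1 + cexpt y)"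
    proof -
      have "1 - w = cnj (1 + cexpt y)"
        by (simp add: w_def half)
      then show "norm (1 - w) = norm (1 + cexpt y)"
        by (simp only: complex_mod_cnj)
    qed (simp add: w_def)
    define \<rho> where "\<rho> = exp (2 * pi * (x - 1/2))"
    have z: "z = of_real \<rho> * w"
      by (simp add: z_def w_def \<rho>_def)
    have nz: "norm z = \<rho>"
      by (simp add: z norm_mult w1 \<rho>_def)
    have a: "\<bar>2 * pi * (x - 1/2)\<bar> \<le> pi"
    proof -
      have "\<bar>x - 1/2\<bar> \<le> 1/2"
        using x unfolding atLeastAtMost_iff by linarith
      then show ?thesis
        by (simp add: abs_mult)
    qed
    have lo1: "\<bar>\<rho> - 1\<bar> \<le> norm (1 - z)"
      using norm_triangle_ineq3[of z 1] by (simp add: nz norm_minus_commute)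
    have "norm (1 - w) \<le> norm (1 - z) + norm (z - w)"
      by (rule norm_triangle_ineq4[of "1 - z" "w - z", simplified, unfolded norm_minus_commute[of w z]])
    also have "norm (z - w) = \<bar>\<rho> - 1\<bar>"
    proof -
      have "z - w = of_real (\<rho> - 1) * w" by (simp add: z algebra_simps)
      then show ?thesis by (simp only: norm_mult w1 norm_of_real mult_1_right)
    qed
    finally have lo2: "norm (1 + cexpt y) \<le> 2 * norm (1 - z)"
      using lo1 w1 by linarith
    have "2 * pi * exp (- pi) * \<bar>x - 1/2\<bar> = \<bar>2 * pi * (x - 1/2)\<bar> * exp (- pi)"
      by (simp add: abs_mult)
    also have "\<dots> \<le> \<bar>2 * pi * (x - 1/2)\<bar> * exp (- \<bar>2 * pi * (x - 1/2)\<bar>)"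
      using a by (intro mult_left_mono) auto
    also have "\<dots> \<le> \<bar>\<rho> - 1\<bar>"
      unfolding \<rho>_def by (rule exp_minus_one_bounds)
    finally have lo3: "2 * pi * exp (- pi) * \<bar>x - 1/2\<bar> \<le> norm (1 - z)"
      using lo1 by linarith
    have lo4: "2 * \<bar>y - 1/2\<bar> \<le> norm (1 - z)"
      using one_plus_cexpt_ge[of y] y lo2 by auto
    have "min (2 * pi * exp (- pi)) 2 * \<bar>x - 1/2\<bar> \<le> norm (1 - z)"
      by (rule order_trans[OF mult_right_mono lo3]) auto
    moreover have "min (2 * pi * exp (- pi)) 2 * \<bar>y - 1/2\<bar> \<le> norm (1 - z)"
      by (rule order_trans[OF mult_right_mono lo4]) auto
    ultimately have lo: "c1 * (\<bar>x - 1/2\<bar> + \<bar>y - 1/2\<bar>) \<le> norm (1 - z)"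
      unfolding c1_def distrib_left by simp
    have "norm (1 - z) \<le> norm (1 - w) + norm (w - z)"
      by (rule norm_triangle_ineq4[of "1 - w" "z - w", simplified, unfolded norm_minus_commute[of z w]])
    also have "norm (w - z) = \<bar>\<rho> - 1\<bar>"
      using \<open>norm (z - w) = \<bar>\<rho> - 1\<bar>\<close> by (simp add: norm_minus_commute)
    finally have tri: "norm (1 - z) \<le> norm (1 + cexpt y) + \<bar>\<rho> - 1\<bar>"
      by (simp add: w1)
    have "\<bar>\<rho> - 1\<bar> \<le> \<bar>2 * pi * (x - 1/2)\<bar> * exp \<bar>2 * pi * (x - 1/2)\<bar>"
      unfolding \<rho>_def by (rule exp_minus_one_bounds)
    also have "\<dots> \<le> (2 * norm (1 + cexpt x)) * exp pi"
    proof (rule mult_mono)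
      have "\<bar>2 * pi * (x - 1/2)\<bar> = (2 * pi) * \<bar>x - 1/2\<bar>"
        by (simp add: abs_mult)
      also have "\<dots> \<le> 8 * \<bar>x - 1/2\<bar>"
        using pi_less_4 by (intro mult_right_mono) auto
      finally show "\<bar>2 * pi * (x - 1/2)\<bar> \<le> 2 * norm (1 + cexpt x)"
        using one_plus_cexpt_ge[of x] x by auto
    qed (use a in auto)
    also have "\<dots> = C1 * norm (1 + cexpt x)"
      by (simp add: C1_def)
    finally have "\<bar>\<rho> - 1\<bar> \<le> C1 * norm (1 + cexpt x)" .
    moreover have "norm (1 + cexpt y) \<le> C1 * norm (1 + cexpt y)"
      using mult_right_mono[of 1 C1 "norm (1 + cexpt y)"] exp_ge_add_one_self[of pi] pi_gt_zero
      by (simp add: C1_def)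
    ultimately have up: "norm (1 - z) \<le> C1 * (norm (1 + cexpt x) + norm (1 + cexpt y))"
      using tri unfolding distrib_left by linarith
    define A where "A = exp (- pi * x\<^sup>2)"
    have "x\<^sup>2 \<le> 1"
      using x by (auto simp: power_le_one)
    then have A: "exp (- pi) \<le> A" "A \<le> 1"
      by (auto simp: A_def mult_le_cancel_left1 mult_le_0_iff)
    have approx: "norm (theta x y - of_real A * (1 - z)) \<le> 6/11 * (A * norm (1 - z))"
      using theta_approx[of x y] x unfolding z_def A_def by simp
    have nA: "norm (of_real A * (1 - z)) = A * norm (1 - z)"
      by (simp add: norm_mult A_def)
    have "5/11 * (A * norm (1 - z)) \<le> norm (theta x y)"
      using norm_triangle_ineq3[of "theta x y" "of_real A * (1 - z)"] approx nA by linarith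
    moreover have "exp (- pi) * (c1 * (\<bar>x - 1/2\<bar> + \<bar>y - 1/2\<bar>)) \<le> A * norm (1 - z)"
      using A lo c1 by (intro mult_mono) (auto intro: order_trans[OF _ A(1)])
    ultimately have lower: "c * (\<bar>x - 1/2\<bar> + \<bar>y - 1/2\<bar>) \<le> norm (theta x y)"
      unfolding c_def by (simp add: mult.assoc)
    have "norm (theta x y) \<le> 17/11 * (A * norm (1 - z))"
      using norm_triangle_ineq2[of "theta x y" "of_real A * (1 - z)"] approx nA by linarith
    also have "A * norm (1 - z) \<le> 1 * (C1 * (norm (1 + cexpt x) + norm (1 + cexpt y)))"
      using A up by (intro mult_mono) (auto simp: A_def)
    finally have "norm (theta x y) \<le> 17/11 * (C1 * (norm (1 + cexpt x) + norm (1 + cexpt y)))"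
      by simp
    then have "(norm (theta x y))\<^sup>2 \<le> (17/11 * (C1 * (norm (1 + cexpt x) + norm (1 + cexpt y))))\<^sup>2"
      by (intro power_mono) auto
    also have "\<dots> = (17/11)\<^sup>2 * C1\<^sup>2 * (norm (1 + cexpt x) + norm (1 + cexpt y))\<^sup>2"
      by (simp only: power_mult_distrib mult.assoc)
    also have "\<dots> \<le> (17/11)\<^sup>2 * C1\<^sup>2 * (2 * ((norm (1 + cexpt x))\<^sup>2 + (norm (1 + cexpt y))\<^sup>2))"
    proof (rule mult_left_mono)
      have "(a + b)\<^sup>2 \<le> 2 * (a\<^sup>2 + b\<^sup>2)" for a b :: real
        using zero_le_power2[of "a - b"] by (simp add: power2_eq_square algebra_simps)
      then show "(norm (1 + cexpt x) + norm (1 + cexpt y))\<^sup>2 \<le> 2 * ((norm (1 + cexpt x))\<^sup>2 + (norm (1 + cexpt y))\<^sup>2)" .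
    qed simp
    also have "\<dots> = C * ((norm (1 + cexpt x))\<^sup>2 + (norm (1 + cexpt y))\<^sup>2)"
      by (simp add: C_def)
    finally show ?thesis
      using lower by blast
  qed
  show ?thesis
    using that[OF \<open>c > 0\<close> \<open>C > 0\<close>] main by blast
qed

section \<open>Functions in the Wiener amalgam space\<close>

definition plane_point :: "real \<times> real \<Rightarrow> real^2" where
  "plane_point p = vector [fst p, snd p]"

definition int_point :: "int \<times> int \<Rightarrow> real^2" where
  "int_point m = plane_point (of_int (fst m), of_int (snd m))"

lemma plane_point_nth [simp]: "plane_point p $ 1 = fst p" "plane_point p $ 2 = snd p"
  by (simp_all add: plane_point_def)

lemma int_point_nth [simp]: "int_point m $ 1 = of_int (fst m)" "int_point m $ 2 = of_int (snd m)"
  by (simp_all add: int_point_def)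

lemma vec2_eq_iff: "x = y \<longleftrightarrow> x $ 1 = y $ 1 \<and> x $ 2 = (y $ 2 :: 'a)" for x y :: "'a^2"
  by (simp add: vec_eq_iff forall_2)

lemma inj_int_point: "inj int_point"
  by (auto simp: inj_on_def vec2_eq_iff prod_eq_iff)

lemma range_int_point: "range int_point = int_vecs"
proof -
  have "n \<in> range int_point" if "n \<in> int_vecs" for n
  proof -
    have "n $ 1 \<in> \<int>" "n $ 2 \<in> \<int>"
      using that by (auto simp: int_vecs_def)
    then obtain a b where "n $ 1 = of_int a" "n $ 2 = of_int b"
      by (metis Ints_cases)
    then have "n = int_point (a, b)"
      by (simp add: vec2_eq_iff)
    then show ?thesis by blast
  qed
  then show ?thesis
    by (auto simp: int_vecs_def forall_2)
qed

lemma infsum_int_vecs: "(\<Sum>\<^sub>\<infinity>n\<in>int_vecs. g n) = (\<Sum>\<^sub>\<infinity>m. g (int_point m))"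
  unfolding range_int_point[symmetric] using inj_int_point by (simp add: infsum_reindex o_def)

lemma continuous_on_plane_point [continuous_intros]:
  assumes "continuous_on S f" "continuous_on S g"
  shows "continuous_on S (\<lambda>x. plane_point (f x, g x))"
proof -
  have "plane_point (f x, g x) = f x *\<^sub>R axis 1 1 + g x *\<^sub>R axis 2 1" for x
    by (simp add: vec2_eq_iff axis_def)
  then show ?thesis
    using assms by (auto intro!: continuous_intros)
qed

lemma plane_point_measurable [measurable (raw)]:
  assumes "f \<in> borel_measurable M" "g \<in> borel_measurable M"
  shows "(\<lambda>x. plane_point (f x, g x)) \<in> borel_measurable M"
proof -
  have "plane_point (f x, g x) = f x *\<^sub>R axis 1 1 + g x *\<^sub>R axis 2 1" for x
    by (simp add: vec2_eq_iff axis_def)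
  then show ?thesis
    using assms by simp
qed

definition cell_sup :: "(real^2 \<Rightarrow> quat) \<Rightarrow> int \<times> int \<Rightarrow> ennreal" where
  "cell_sup f m = Linf_norm (\<lambda>x. f x * of_real (translate (int_point m) (indicat_real (cbox 0 1)) x))"

lemma W_norm_eq: "W_norm f = (\<Sum>\<^sub>\<infinity>m. cell_sup f m)"
  by (simp add: W_norm_def infsum_int_vecs cell_sup_def)

lemma unit_square_interior:
  "box 0 1 \<subseteq> (cbox 0 1 :: (real^2) set)" "closure (box 0 1) = (cbox 0 1 :: (real^2) set)"
proof -
  have "(1/2) *\<^sub>R 1 \<in> box 0 (1::real^2)"
    by (simp add: mem_box_cart)
  then have "box 0 (1::real^2) \<noteq> {}" by blast
  then show "closure (box 0 1) = (cbox 0 1 :: (real^2) set)"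
    by (rule closure_box)
qed (rule box_subset_cbox)

text \<open>
  For a continuous function an essential bound on a cell holds everywhere on it: a point of the open
  cell that violates it has a neighbourhood that does, and this is not a null set; the boundary of the
  cell follows by closure.
\<close>

lemma norm_le_cell_sup:
  fixes f :: "real^2 \<Rightarrow> quat"
  assumes cont: "continuous_on UNIV f" and x: "x \<in> cbox 0 1" and fin: "cell_sup f m < \<infinity>"
  shows "norm (f (x + int_point m)) \<le> enn2real (cell_sup f m)"
proof -
  define K where "K = enn2real (cell_sup f m)"
  have K: "cell_sup f m = ennreal K"
    using fin by (simp add: K_def)
  define S where "S = {z \<in> box 0 1. norm (f (z + int_point m)) > K}"
  have c: "continuous_on UNIV (\<lambda>z. norm (f (z + int_point m)))"
    by (intro continuous_intros continuous_on_compose2[OF cont]) auto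
  have S: "open S"
  proof -
    have "S = box 0 1 \<inter> {z. norm (f (z + int_point m)) > K}"
      by (auto simp: S_def)
    then show ?thesis
      using open_Collect_less[OF continuous_on_const c, of K] by auto
  qed
  have "AE y in lebesgue. ennreal (norm (f y * of_real (translate (int_point m) (indicat_real (cbox 0 1)) y))) \<le> ennreal K"
    unfolding K[symmetric] cell_sup_def Linf_norm_def by (rule esssup_AE)
  then obtain N where N: "N \<in> null_sets lebesgue"
    "\<And>y. y \<notin> N \<Longrightarrow> ennreal (norm (f y * of_real (translate (int_point m) (indicat_real (cbox 0 1)) y))) \<le> ennreal K"
    by (auto elim!: AE_E3)
  have "(+) (int_point m) ` S \<subseteq> N"
  proof
    fix y assume "y \<in> (+) (int_point m) ` S"
    then obtain z where z: "y = int_point m + z" "z \<in> box 0 1" "norm (f (z + int_point m)) > K"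
      by (auto simp: S_def)
    have "0 \<le> K"
      by (simp add: K_def)
    then have "\<not> ennreal (norm (f y * of_real (translate (int_point m) (indicat_real (cbox 0 1)) y))) \<le> ennreal K"
      using z box_subset_cbox[of 0 "1::real^2"]
      by (auto simp: translate_def norm_mult add.commute ennreal_le_iff indicator_def)
    with N show "y \<in> N" by blast
  qed
  moreover have "negligible N"
    using N(1) by (simp add: negligible_iff_null_sets)
  ultimately have "negligible ((+) (int_point m) ` S)"
    using negligible_subset by blast
  then have "S = {}"
    using open_not_negligible[of "(+) (int_point m) ` S"] open_translation[OF S, of "int_point m"] by auto
  then have "norm (f (z + int_point m)) \<le> K" if "z \<in> box 0 1" for z
    using that by (auto simp: S_def not_less)
  then have "norm (f (x + int_point m)) \<le> K"
    using continuous_le_on_closure[of "box 0 1" "\<lambda>z. norm (f (z + int_point m))" x K] x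
      continuous_on_subset[OF c] unfolding unit_square_interior(2) by auto
  then show ?thesis
    by (simp add: K_def)
qed

lemma W0_cell_bounds:
  assumes f: "f \<in> W0"
  obtains a where "\<And>m. a m \<ge> 0" "a summable_on UNIV" "infsum a UNIV \<le> enn2real (W_norm f)"
    "\<And>m x. x \<in> cbox 0 1 \<Longrightarrow> norm (f (x + int_point m)) \<le> a m"
proof -
  define a where "a m = enn2real (cell_sup f m)" for m
  define K where "K = enn2real (W_norm f)"
  have K: "(\<Sum>\<^sub>\<infinity>m. cell_sup f m) = ennreal K"
    using f by (simp add: W0_def W_def K_def W_norm_eq)
  have sums: "sum (cell_sup f) F \<le> ennreal K" if "finite F" for F
  proof -
    have "sum (cell_sup f) F = infsum (cell_sup f) F"
      using that by simp
    also have "\<dots> \<le> infsum (cell_sup f) UNIV"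
      by (rule infsum_mono_neutral) (auto intro: nonneg_summable_on_complete)
    finally show ?thesis
      by (simp add: K)
  qed
  have fin: "cell_sup f m < \<infinity>" for m
    using sums[of "{m}"] by (auto simp: le_less_trans)
  then have ea: "ennreal (a m) = cell_sup f m" for m
    by (simp add: a_def)
  have suma: "sum a F \<le> K" if "finite F" for F
  proof -
    have "ennreal (sum a F) = sum (cell_sup f) F"
      by (subst sum_ennreal[symmetric]) (simp_all only: ea, simp add: a_def)
    then have "ennreal (sum a F) \<le> ennreal K"
      using sums[OF that] by simp
    then show ?thesis
      by (subst (asm) ennreal_le_iff) (simp_all add: K_def)
  qed
  show thesis
  proof
    show "a m \<ge> 0" for m
      by (simp add: a_def)
    show s: "a summable_on UNIV"
      by (rule nonneg_bdd_above_summable_on) (use suma in \<open>auto simp: a_def bdd_above_def\<close>)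
    show "infsum a UNIV \<le> enn2real (W_norm f)"
      unfolding K_def[symmetric] using s suma by (intro infsum_le_finite_sums) auto
    show "norm (f (x + int_point m)) \<le> a m" if "x \<in> cbox 0 1" for m x
      unfolding a_def using f fin that by (intro norm_le_cell_sup) (auto simp: W0_def)
  qed
qed

lemma W0_continuous: "f \<in> W0 \<Longrightarrow> continuous_on UNIV f"
  by (simp add: W0_def)

lemma W0_measurable: "f \<in> W0 \<Longrightarrow> f \<in> borel_measurable borel"
  by (intro borel_measurable_continuous_onI W0_continuous)

lemma cell_decomposition:
  obtains m and z :: "real^2" where "z \<in> cbox 0 1" "y = z + int_point m"
proof
  let ?m = "(\<lfloor>y $ 1\<rfloor>, \<lfloor>y $ 2\<rfloor>)"
  show "y = (y - int_point ?m) + int_point ?m" by simp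
  show "y - int_point ?m \<in> cbox 0 1"
    by (simp add: mem_box_cart forall_2) linarith
qed

text \<open>
  To be used with bounds that are given pointwise on the cells; \<open>W0_cell_bounds\<close> is the converse.
\<close>

lemma W0_I:
  assumes cont: "continuous_on UNIV f" and a: "a summable_on UNIV"
    and le: "\<And>m x. x \<in> cbox 0 1 \<Longrightarrow> norm (f (x + int_point m)) \<le> a m"
  shows "f \<in> W0"
proof -
  have a0: "a m \<ge> 0" for m
    using order_trans[OF norm_ge_zero le[of 0 m]] by (simp add: mem_box_cart)
  have [measurable]: "f \<in> borel_measurable borel"
    using cont by (rule borel_measurable_continuous_onI)
  have fb: "f \<in> borel_measurable lebesgue"
    by (rule measurable_completion) simp
  have cell: "cell_sup f m \<le> ennreal (a m)" for m
    unfolding cell_sup_def Linf_norm_def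
  proof (rule esssup_I)
    show "(\<lambda>x. ennreal (norm (f x * of_real (translate (int_point m) (indicat_real (cbox 0 1)) x)))) \<in> borel_measurable lebesgue"
      unfolding translate_def by (rule measurable_completion) measurable
    have "norm (f x * of_real (translate (int_point m) (indicat_real (cbox 0 1)) x)) \<le> a m" for x
      using le[of "x - int_point m" m] a0[of m] by (auto simp: translate_def norm_mult indicator_def)
    then show "AE x in lebesgue. ennreal (norm (f x * of_real (translate (int_point m) (indicat_real (cbox 0 1)) x))) \<le> ennreal (a m)"
      by (intro always_eventually allI ennreal_leI)
  qed
  have am: "a m \<le> infsum a UNIV" for m
    using infsum_mono_neutral[of a "{m}" a UNIV] a a0 by auto
  have "Linf_norm f \<le> ennreal (infsum a UNIV)"
    unfolding Linf_norm_def
  proof (rule esssup_I)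
    show "(\<lambda>x. ennreal (norm (f x))) \<in> borel_measurable lebesgue"
      using fb by simp
    have "norm (f y) \<le> infsum a UNIV" for y
      using cell_decomposition[of y] le am order_trans by metis
    then show "AE x in lebesgue. ennreal (norm (f x)) \<le> ennreal (infsum a UNIV)"
      by (intro always_eventually allI ennreal_leI)
  qed
  then have "f \<in> Linf"
    using fb by (auto simp: Linf_def intro: le_less_trans)
  moreover have "W_norm f < \<infinity>"
  proof -
    have "W_norm f \<le> ennreal (infsum a UNIV)"
      unfolding W_norm_eq
    proof (rule infsum_le_finite_sums)
      fix F :: "(int \<times> int) set" assume F: "finite F"
      have "sum (cell_sup f) F \<le> (\<Sum>m\<in>F. ennreal (a m))"
        by (intro sum_mono cell)
      also have "\<dots> = ennreal (sum a F)"
        using a0 by simp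
      also have "\<dots> \<le> ennreal (infsum a UNIV)"
        using F a a0 by (intro ennreal_leI finite_sum_le_infsum) auto
      finally show "sum (cell_sup f) F \<le> ennreal (infsum a UNIV)" .
    qed (auto intro: nonneg_summable_on_complete)
    then show ?thesis
      by (auto intro: le_less_trans)
  qed
  ultimately show ?thesis
    using cont by (simp add: W0_def W_def)
qed

lemma W0_add:
  assumes "f \<in> W0" "g \<in> W0"
  shows "(\<lambda>x. f x + g x) \<in> W0"
proof -
  obtain a where a: "a summable_on UNIV" "\<And>m x. x \<in> cbox 0 1 \<Longrightarrow> norm (f (x + int_point m)) \<le> a m"
    using W0_cell_bounds[OF assms(1)] by metis
  obtain b where b: "b summable_on UNIV" "\<And>m x. x \<in> cbox 0 1 \<Longrightarrow> norm (g (x + int_point m)) \<le> b m"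
    using W0_cell_bounds[OF assms(2)] by metis
  show ?thesis
  proof (rule W0_I)
    show "(\<lambda>m. a m + b m) summable_on UNIV"
      using a(1) b(1) by (rule summable_on_add)
    show "norm (f (x + int_point m) + g (x + int_point m)) \<le> a m + b m" if "x \<in> cbox 0 1" for x m
      using a(2)[OF that] b(2)[OF that] by (rule norm_triangle_mono)
  qed (intro continuous_intros W0_continuous assms)
qed

lemma W0_scaleR:
  assumes "f \<in> W0"
  shows "(\<lambda>x. r *\<^sub>R f x) \<in> W0"
proof -
  obtain a where a: "a summable_on UNIV" "\<And>m x. x \<in> cbox 0 1 \<Longrightarrow> norm (f (x + int_point m)) \<le> a m"
    using W0_cell_bounds[OF assms(1)] by metis
  show ?thesis
  proof (rule W0_I)
    show "(\<lambda>m. \<bar>r\<bar> * a m) summable_on UNIV"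
      using a(1) by (rule summable_on_cmult_right)
    show "norm (r *\<^sub>R f (x + int_point m)) \<le> \<bar>r\<bar> * a m" if "x \<in> cbox 0 1" for x m
      using a(2)[OF that] by (simp add: mult_left_mono)
  qed (intro continuous_intros W0_continuous assms)
qed

lemma W0_diff:
  assumes "f \<in> W0" "g \<in> W0"
  shows "(\<lambda>x. f x - g x) \<in> W0"
  using W0_add[OF assms(1) W0_scaleR[OF assms(2), of "-1"]] by simp

lemma W0_zero: "(\<lambda>_. 0) \<in> W0"
  by (rule W0_I[where a = "\<lambda>_. 0"]) (auto intro: continuous_intros)

lemma W0_sum:
  assumes "finite A" "\<And>i. i \<in> A \<Longrightarrow> f i \<in> W0"
  shows "(\<lambda>x. \<Sum>i\<in>A. f i x) \<in> W0"
  using assms by (induction A rule: finite_induct) (auto simp: W0_zero intro: W0_add)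

section \<open>The Zak transform\<close>

text \<open>
  Finite partial sums converge uniformly, and coefficients are continuous for the uniform norm.
\<close>

lemma (in char_system) coef_abs_summable:
  assumes a: "(\<lambda>n. norm (a n)) summable_on UNIV"
    and Z: "\<And>p. Z p = (\<Sum>\<^sub>\<infinity>n. bimult (l n p) (r n p) (a n))"
    and [measurable]: "Z \<in> borel_measurable M"
  shows "coef M l r Z n = a n" "\<And>p. norm (Z p) \<le> (\<Sum>\<^sub>\<infinity>n. norm (a n))"
proof -
  let ?F = "\<lambda>X p. \<Sum>n\<in>X. bimult (l n p) (r n p) (a n)"
  have unif: "uniform_limit UNIV ?F Z (finite_subsets_at_top UNIV)"
    unfolding Z by (rule Weierstrass_m_test_general[where M = "\<lambda>n. norm (a n)"]) (auto simp: a)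
  show Zle: "norm (Z p) \<le> (\<Sum>\<^sub>\<infinity>n. norm (a n))" for p
    unfolding Z using norm_infsum_bound[of "\<lambda>n. bimult (l n p) (r n p) (a n)" UNIV] a by simp
  have Zint: "integrable M Z"
    by (rule integrable_const_bound[where B = "\<Sum>\<^sub>\<infinity>n. norm (a n)"]) (auto simp: Zle)
  have "norm (coef M l r Z n - a n) \<le> \<epsilon>" if "\<epsilon> > 0" for \<epsilon>
  proof -
    have "eventually (\<lambda>X. \<forall>p\<in>UNIV. dist (?F X p) (Z p) < \<epsilon>) (finite_subsets_at_top UNIV)"
      by (rule uniform_limitD[OF unif that])
    moreover have "eventually (\<lambda>X. finite X \<and> {n} \<subseteq> X) (finite_subsets_at_top UNIV)"
      unfolding eventually_finite_subsets_at_top by (rule exI[of _ "{n}"]) auto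
    ultimately have "eventually (\<lambda>X. (\<forall>p. dist (?F X p) (Z p) < \<epsilon>) \<and> finite X \<and> n \<in> X) (finite_subsets_at_top UNIV)"
      by eventually_elim auto
    then obtain X where X: "\<And>p. dist (?F X p) (Z p) < \<epsilon>" "finite X" "n \<in> X"
      using eventually_happens'[OF finite_subsets_at_top_neq_bot] by blast
    have Fint: "integrable M (?F X)"
      by (intro Bochner_Integration.integrable_sum) simp
    have "coef M l r Z n - a n = coef M l r (\<lambda>p. Z p - ?F X p) n"
      using X by (simp add: coef_diff[OF Zint Fint] coef_trig)
    also have "norm \<dots> \<le> (\<integral>p. norm (Z p - ?F X p) \<partial>M)"
      by (intro norm_coef_le Bochner_Integration.integrable_diff Zint Fint)
    also have "\<dots> \<le> (\<integral>p. \<epsilon> \<partial>M)"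
    proof (rule integral_mono)
      show "integrable M (\<lambda>p. norm (Z p - ?F X p))"
        by (intro integrable_norm Bochner_Integration.integrable_diff Zint Fint)
      show "norm (Z p - ?F X p) \<le> \<epsilon>" for p
        using X(1)[of p] by (simp add: dist_norm norm_minus_commute)
    qed simp
    also have "\<dots> = \<epsilon>"
      by (simp add: prob_space)
    finally show ?thesis .
  qed
  then have "norm (coef M l r Z n - a n) \<le> 0"
    using field_le_epsilon[of "norm (coef M l r Z n - a n)" 0] by simp
  then show "coef M l r Z n = a n"
    by simp
qed

lemma (in char_system) abs_summable_bessel:
  assumes a: "(\<lambda>n. norm (a n)) summable_on UNIV"
    and Z: "\<And>p. Z p = (\<Sum>\<^sub>\<infinity>n. bimult (l n p) (r n p) (a n))"
    and Zm [measurable]: "Z \<in> borel_measurable M"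
    and N: "finite N"
  shows "(\<Sum>n\<in>N. ennreal ((norm (a n))\<^sup>2)) \<le> (\<integral>\<^sup>+p. ennreal ((norm (Z p))\<^sup>2) \<partial>M)"
proof -
  have sq: "integrable M (\<lambda>p. (norm (Z p))\<^sup>2)"
    by (rule integrable_const_bound[where B = "(\<Sum>\<^sub>\<infinity>n. norm (a n))\<^sup>2"])
      (auto intro!: power_mono coef_abs_summable(2)[OF a Z Zm])
  have "(\<Sum>n\<in>N. (norm (a n))\<^sup>2) \<le> (\<integral>p. (norm (Z p))\<^sup>2 \<partial>M)"
    using bessel[OF N Zm sq] by (simp add: coef_abs_summable(1)[OF a Z Zm])
  then show ?thesis
    by (subst nn_integral_eq_integral[OF sq]) (auto simp: ennreal_leI)
qed

lemma summable_on_product: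
  fixes f :: "'a \<Rightarrow> real" and g :: "'b \<Rightarrow> real"
  assumes "f summable_on UNIV" "g summable_on UNIV" "\<And>x. f x \<ge> 0" "\<And>y. g y \<ge> 0"
  shows "(\<lambda>p. f (fst p) * g (snd p)) summable_on UNIV"
proof -
  have "(\<lambda>p. f (fst p) * g (snd p)) summable_on (SIGMA x:UNIV. UNIV)"
  proof (rule summable_on_SigmaI)
    show "((\<lambda>y. f (fst (x, y)) * g (snd (x, y))) has_sum f x * infsum g UNIV) UNIV" for x
      using assms(2) by (auto intro!: has_sum_cmult_right)
    show "(\<lambda>x. f x * infsum g UNIV) summable_on UNIV"
      by (rule summable_on_cmult_left[OF assms(1)])
  qed (use assms in auto)
  then show ?thesis by simp
qed

lemma bounded_linear_bimult_left: "bounded_linear (\<lambda>z. bimult z w q)"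
proof (rule bounded_linear_intro[where K = "norm w * norm q"])
  show "bimult (r *\<^sub>R z) w q = r *\<^sub>R bimult z w q" for r z
    by (simp add: bimult_def bounded_linear_emb[THEN bounded_linear.linear, THEN linear_cmul])
qed (simp_all add: bimult_add_left ac_simps)

lemma bounded_linear_bimult_right: "bounded_linear (\<lambda>w. bimult z w q)"
proof (rule bounded_linear_intro[where K = "norm z * norm q"])
  show "bimult z (r *\<^sub>R w) q = r *\<^sub>R bimult z w q" for r w
    by (simp add: bimult_def bounded_linear_emb[THEN bounded_linear.linear, THEN linear_cmul])
qed (simp_all add: bimult_add_right ac_simps)

lemma infsum_bounded_linear_image:
  assumes "bounded_linear h" "f summable_on A"
  shows "(\<Sum>\<^sub>\<infinity>x\<in>A. h (f x)) = h (\<Sum>\<^sub>\<infinity>x\<in>A. f x)"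
  using has_sum_bounded_linear[OF assms(1) has_sum_infsum[OF assms(2)]] by (rule infsumI)

lemma infsum_bimult_product:
  fixes f :: "'a \<Rightarrow> complex" and g :: "'b \<Rightarrow> complex"
  assumes f: "(\<lambda>x. norm (f x)) summable_on UNIV" and g: "(\<lambda>x. norm (g x)) summable_on UNIV"
  shows "(\<Sum>\<^sub>\<infinity>p. bimult (f (fst p)) (g (snd p)) q) = bimult (\<Sum>\<^sub>\<infinity>x. f x) (\<Sum>\<^sub>\<infinity>y. g y) q"
proof -
  have fs: "f summable_on UNIV" and gs: "g summable_on UNIV"
    using f g by (auto intro: abs_summable_summable)
  have "(\<lambda>p. norm (bimult (f (fst p)) (g (snd p)) q)) summable_on UNIV"
    using summable_on_cmult_left[OF summable_on_product[OF f g], of "norm q"] by simp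
  then have "(\<lambda>p. bimult (f (fst p)) (g (snd p)) q) summable_on (SIGMA x:UNIV. UNIV)"
    using abs_summable_summable by force
  then have "(\<Sum>\<^sub>\<infinity>p\<in>(SIGMA x:UNIV. UNIV). bimult (f (fst p)) (g (snd p)) q)
      = (\<Sum>\<^sub>\<infinity>x. \<Sum>\<^sub>\<infinity>y. bimult (f (fst (x, y))) (g (snd (x, y))) q)"
    by (rule infsum_Sigma_banach[symmetric])
  also have "\<dots> = (\<Sum>\<^sub>\<infinity>x. bimult (f x) (\<Sum>\<^sub>\<infinity>y. g y) q)"
    by (simp add: infsum_bounded_linear_image[OF bounded_linear_bimult_right gs])
  also have "\<dots> = bimult (\<Sum>\<^sub>\<infinity>x. f x) (\<Sum>\<^sub>\<infinity>y. g y) q"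
    by (rule infsum_bounded_linear_image[OF bounded_linear_bimult_left fs])
  finally show ?thesis by simp
qed

lemma gabor_term_eq:
  "gabor_term c (b, \<omega>) x = bimult (cexpt (x $ 1 * \<omega> $ 1) * of_real (exp (- pi * (x $ 1 - b $ 1)\<^sup>2)))
    (cexpt (x $ 2 * \<omega> $ 2) * of_real (exp (- pi * (x $ 2 - b $ 2)\<^sup>2))) c"
proof -
  have n: "(norm (x - b))\<^sup>2 = (x $ 1 - b $ 1)\<^sup>2 + (x $ 2 - b $ 2)\<^sup>2"
    by (simp add: norm_vec_def L2_set_def sum_2)
  have e: "emb_i (of_real r) = of_real r" "emb_j (of_real r) = of_real r" for r
    by (simp_all add: emb_i_def emb_j_def of_real_quat)
  have "exp (- pi * (norm (x - b))\<^sup>2) = exp (- pi * (x $ 1 - b $ 1)\<^sup>2) * exp (- pi * (x $ 2 - b $ 2)\<^sup>2)"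
    unfolding n exp_add[symmetric] by (simp add: algebra_simps)
  then show ?thesis
    unfolding gabor_term_def prod.case bimult_def emb_mult e
      exp_i_emb[of "x $ 1 * \<omega> $ 1", unfolded mult.assoc[symmetric]]
      exp_j_emb[of "x $ 2 * \<omega> $ 2", unfolded mult.assoc[symmetric]]
    by (simp add: of_real_def mult.assoc mult.commute[of "exp _" "exp _"])
qed

lemma norm_gabor_term:
  "norm (gabor_term c (b, \<omega>) x) = exp (- pi * (x $ 1 - b $ 1)\<^sup>2) * exp (- pi * (x $ 2 - b $ 2)\<^sup>2) * norm c"
  by (simp add: gabor_term_eq norm_mult)

lemma gabor_term_add: "gabor_term (c + d) p x = gabor_term c p x + gabor_term d p x"
  by (cases p) (simp add: gabor_term_eq bimult_add)

lemma gabor_term_scaleR: "gabor_term (r *\<^sub>R c) p x = r *\<^sub>R gabor_term c p x"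
  by (cases p) (simp add: gabor_term_eq bimult_scaleR)

lemma gabor_term_W0: "gabor_term c p \<in> W0"
proof -
  obtain b \<omega> where p: "p = (b, \<omega>)" by fastforce
  define E where "E i = exp (1 + 2 * (1 + \<bar>b $ i\<bar>))" for i
  have le: "exp (- pi * (x + of_int m - b $ i)\<^sup>2) \<le> E i * exp (- \<bar>real_of_int m\<bar>)" if "0 \<le> x" "x \<le> 1" for x m i
    using gaussian_le_exp[of "x - b $ i" "1 + \<bar>b $ i\<bar>" "- m"] that by (simp add: E_def algebra_simps)
  show ?thesis
  proof (rule W0_I)
    show "continuous_on UNIV (gabor_term c p)"
      unfolding p gabor_term_eq[abs_def] by (intro continuous_intros)
    show "(\<lambda>m :: int \<times> int. (E 1 * exp (- \<bar>real_of_int (fst m)\<bar>)) * (E 2 * exp (- \<bar>real_of_int (snd m)\<bar>)) * norm c) summable_on UNIV"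
      by (intro summable_on_cmult_left
          summable_on_product[where f = "\<lambda>m. E 1 * exp (- \<bar>real_of_int m\<bar>)" and g = "\<lambda>m. E 2 * exp (- \<bar>real_of_int m\<bar>)"]
          summable_on_cmult_right summable_on_exp_neg_abs) (simp_all add: E_def)
    show "norm (gabor_term c p (x + int_point m)) \<le> (E 1 * exp (- \<bar>real_of_int (fst m)\<bar>)) * (E 2 * exp (- \<bar>real_of_int (snd m)\<bar>)) * norm c"
      if "x \<in> cbox 0 1" for x m
    proof -
      have "0 \<le> x $ 1" "x $ 1 \<le> 1" "0 \<le> x $ 2" "x $ 2 \<le> 1"
        using that by (auto simp: mem_box_cart)
      then show ?thesis
        unfolding p norm_gabor_term using le[of "x $ 1" "fst m" 1] le[of "x $ 2" "snd m" 2]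
        by (intro mult_right_mono mult_mono) (auto simp: E_def)
    qed
  qed
qed

definition zak_summand :: "(real^2 \<Rightarrow> quat) \<Rightarrow> phase \<Rightarrow> int \<times> int \<Rightarrow> quat" where
  "zak_summand f p m = bimult (lchar2 m (snd p)) (rchar2 m (snd p)) (f (plane_point (fst p) + int_point m))"

text \<open>
  The Zak transform with the second argument negated. With this sign, a Gabor atom at position \<open>b\<close>
  becomes a character of index \<open>b\<close> rather than \<open>- b\<close>, and the sum runs over \<open>x + m\<close>.
\<close>

definition zak_refl :: "(real^2 \<Rightarrow> quat) \<Rightarrow> phase \<Rightarrow> quat" where
  "zak_refl f p = (\<Sum>\<^sub>\<infinity>m. zak_summand f p m)"

definition unit_square :: "(real \<times> real) set" where "unit_square = {0..1} \<times> {0..1}"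

lemma zak_eq_zak_refl: "zak f (plane_point x, plane_point (- fst y, - snd y)) = zak_refl f (x, y)"
proof -
  have "zak f (plane_point x, plane_point (- fst y, - snd y)) = (\<Sum>\<^sub>\<infinity>m. zak_summand f (x, y) (- m))"
    unfolding zak_def prod.case infsum_int_vecs
  proof (rule infsum_cong)
    fix m :: "int \<times> int"
    have "plane_point x - int_point m = plane_point x + int_point (- m)"
      by (simp add: vec2_eq_iff)
    moreover have "exp_i (2 * pi * int_point m $ 1 * plane_point (- fst y, - snd y) $ 1) = emb_i (lchar2 (- m) y)"
      using exp_i_emb[of "- (of_int (fst m) * fst y)"] by (cases m; cases y) (simp add: lchar2_eq mult.assoc)
    moreover have "exp_j (2 * pi * int_point m $ 2 * plane_point (- fst y, - snd y) $ 2) = emb_j (rchar2 (- m) y)"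
      using exp_j_emb[of "- (of_int (snd m) * snd y)"] by (cases m; cases y) (simp add: rchar2_eq mult.assoc)
    ultimately show "exp_i (2 * pi * int_point m $ 1 * plane_point (- fst y, - snd y) $ 1) * f (plane_point x - int_point m) *
        exp_j (2 * pi * int_point m $ 2 * plane_point (- fst y, - snd y) $ 2) = zak_summand f (x, y) (- m)"
      by (simp only: zak_summand_def bimult_def fst_conv snd_conv)
  qed
  also have "\<dots> = zak_refl f (x, y)"
    unfolding zak_refl_def by (rule infsum_reindex_bij_betw[where g = uminus and f = "zak_summand f (x, y)"]) (simp add: bij_uminus)
  finally show ?thesis .
qed

lemma plane_point_unit_square: "x \<in> unit_square \<Longrightarrow> plane_point x \<in> cbox 0 1"
  by (auto simp: unit_square_def mem_box_cart forall_2)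

lemma zak_summand_bounds:
  assumes f: "f \<in> W0"
  obtains a where "a summable_on UNIV" "infsum a UNIV \<le> enn2real (W_norm f)"
    "\<And>x y m. x \<in> unit_square \<Longrightarrow> norm (f (plane_point x + int_point m)) \<le> a m"
    "\<And>x y m. x \<in> unit_square \<Longrightarrow> norm (zak_summand f (x, y) m) \<le> a m"
proof -
  obtain a where a: "a summable_on UNIV" "infsum a UNIV \<le> enn2real (W_norm f)"
    "\<And>m x. x \<in> cbox 0 1 \<Longrightarrow> norm (f (x + int_point m)) \<le> a m"
    using W0_cell_bounds[OF f] by metis
  show thesis
    by (rule that[OF a(1,2)]) (auto simp: zak_summand_def intro!: a(3) plane_point_unit_square)
qed

lemma zak_summand_abs_summable:
  assumes "f \<in> W0" "x \<in> unit_square"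
  shows "(\<lambda>m. norm (f (plane_point x + int_point m))) summable_on UNIV" "zak_summand f (x, y) summable_on UNIV"
proof -
  obtain a where a: "a summable_on UNIV"
    "\<And>m. norm (f (plane_point x + int_point m)) \<le> a m"
    using zak_summand_bounds[OF assms(1)] assms(2) by metis
  show s: "(\<lambda>m. norm (f (plane_point x + int_point m))) summable_on UNIV"
    by (rule summable_on_comparison_test[OF a(1)]) (auto simp: a)
  have "(\<lambda>m. norm (zak_summand f (x, y) m)) summable_on UNIV"
    using s by (simp add: zak_summand_def)
  then show "zak_summand f (x, y) summable_on UNIV"
    by (rule abs_summable_summable)
qed

lemma norm_zak_refl_le:
  assumes f: "f \<in> W0" and x: "x \<in> unit_square"
  shows "norm (zak_refl f (x, y)) \<le> enn2real (W_norm f)"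
proof -
  obtain a where a: "a summable_on UNIV" "infsum a UNIV \<le> enn2real (W_norm f)"
    "\<And>m. norm (zak_summand f (x, y) m) \<le> a m"
    using zak_summand_bounds[OF f] x by metis
  have "norm (zak_refl f (x, y)) \<le> infsum a UNIV"
    unfolding zak_refl_def
    by (rule norm_infsum_le[where f = "zak_summand f (x, y)" and g = a and X = UNIV])
      (use zak_summand_abs_summable[OF f x] a in auto)
  with a(2) show ?thesis by simp
qed

lemma zak_refl_add:
  assumes "f \<in> W0" "g \<in> W0" "x \<in> unit_square"
  shows "zak_refl (\<lambda>x. f x + g x) (x, y) = zak_refl f (x, y) + zak_refl g (x, y)"
proof -
  have "zak_summand (\<lambda>x. f x + g x) (x, y) = (\<lambda>m. zak_summand f (x, y) m + zak_summand g (x, y) m)"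
    by (auto simp: zak_summand_def bimult_add)
  then show ?thesis
    unfolding zak_refl_def by (simp add: infsum_add zak_summand_abs_summable assms)
qed

lemma zak_refl_scaleR: "zak_refl (\<lambda>x. c *\<^sub>R f x) p = c *\<^sub>R zak_refl f p"
proof -
  have "zak_summand (\<lambda>x. c *\<^sub>R f x) p = (\<lambda>m. c *\<^sub>R zak_summand f p m)"
    by (auto simp: zak_summand_def bimult_scaleR)
  then show ?thesis
    unfolding zak_refl_def by (simp add: infsum_scaleR_right)
qed

lemma zak_refl_diff:
  assumes "f \<in> W0" "g \<in> W0" "x \<in> unit_square"
  shows "zak_refl (\<lambda>x. f x - g x) (x, y) = zak_refl f (x, y) - zak_refl g (x, y)"
  using zak_refl_add[OF assms(1) W0_scaleR[OF assms(2), of "-1"] assms(3)] by (simp add: zak_refl_scaleR[of "-1", simplified])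

lemma zak_refl_sum:
  assumes "finite A" "\<And>i. i \<in> A \<Longrightarrow> f i \<in> W0" "x \<in> unit_square"
  shows "zak_refl (\<lambda>x. \<Sum>i\<in>A. f i x) (x, y) = (\<Sum>i\<in>A. zak_refl (f i) (x, y))"
  using assms(1,2)
proof (induction A rule: finite_induct)
  case empty
  then show ?case by (simp add: zak_refl_def zak_summand_def)
next
  case (insert i A)
  then show ?case
    using zak_refl_add[of "f i" "\<lambda>x. \<Sum>i\<in>A. f i x" x y] W0_sum[of A f] assms(3) by simp
qed

lemma zak_refl_continuous:
  assumes f: "f \<in> W0"
  shows "continuous_on (unit_square \<times> UNIV) (zak_refl f)"
proof -
  obtain a where a: "a summable_on UNIV" "\<And>x y m. x \<in> unit_square \<Longrightarrow> norm (zak_summand f (x, y) m) \<le> a m"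
    using zak_summand_bounds[OF f] by metis
  have "uniform_limit (unit_square \<times> UNIV) (\<lambda>X p. \<Sum>m\<in>X. zak_summand f p m) (\<lambda>p. \<Sum>\<^sub>\<infinity>m. zak_summand f p m) (finite_subsets_at_top UNIV)"
    by (rule Weierstrass_m_test_general[OF _ a(1)]) (use a(2) in auto)
  moreover have "continuous_on (unit_square \<times> UNIV) (\<lambda>p. zak_summand f p m)" for m
  proof -
    have eq: "(\<lambda>p. zak_summand f p m) = (\<lambda>p. bimult (cexpt (of_int (fst m) * fst (snd p))) (cexpt (of_int (snd m) * snd (snd p)))
        (f (plane_point (fst (fst p), snd (fst p)) + int_point m)))"
      by (cases m) (auto simp: zak_summand_def lchar2_eq rchar2_eq)
    show ?thesis
      unfolding eq by (intro continuous_intros continuous_on_compose2[OF W0_continuous[OF f]]) auto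
  qed
  ultimately show ?thesis
    unfolding zak_refl_def[abs_def]
    by (intro uniform_limit_theorem[where F = "finite_subsets_at_top UNIV" and f = "\<lambda>X p. \<Sum>m\<in>X. zak_summand f p m"])
      (auto intro!: always_eventually continuous_on_sum)
qed

text \<open>
  Integer translations do not change the modulation \<open>cexpt (x * k)\<close>. Reindexing the sum over \<open>m\<close> by \<open>b - m\<close>
  leaves the character of index \<open>b\<close> and a product of two theta series.
\<close>

lemma zak_refl_gabor:
  "zak_refl (gabor_term c (int_point b, int_point k)) ((x1, x2), (y1, y2)) =
    bimult (theta x1 y1) (theta x2 y2) (bimult (lchar4 (k, b) ((x1, x2), (y1, y2))) (rchar4 (k, b) ((x1, x2), (y1, y2))) c)"
proof -
  let ?p = "((x1, x2), (y1, y2))"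
  let ?q = "bimult (lchar4 (k, b) ?p) (rchar4 (k, b) ?p) c"
  have one: "cexpt (of_int m * y) * (cexpt ((x + of_int m) * of_int k) * of_real (exp (- pi * (x + of_int m - of_int b)\<^sup>2)))
      = theta_term x y (b - m) * (cexpt (of_int k * x) * cexpt (of_int b * y))" for m k b :: int and x y :: real
  proof -
    have "(x + of_int m) * of_int k = of_int k * x + of_int (m * k)"
      by (simp add: algebra_simps)
    then have 1: "cexpt ((x + of_int m) * of_int k) = cexpt (of_int k * x)"
      by (simp only: cexpt_add cexpt_of_int mult_1_right)
    have 2: "cexpt (of_int m * y) = cexpt (- of_int (b - m) * y) * cexpt (of_int b * y)"
      unfolding cexpt_add[symmetric] by (simp add: algebra_simps)
    have 3: "x + of_int m - of_int b = x - of_int (b - m)"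
      by simp
    show ?thesis
      unfolding theta_term_def 1 2 3 by (simp only: ac_simps)
  qed
  have "zak_summand (gabor_term c (int_point b, int_point k)) ?p m
      = bimult (theta_term x1 y1 (fst (b - m))) (theta_term x2 y2 (snd (b - m))) ?q" for m
  proof -
    obtain b1 b2 k1 k2 m1 m2 where bkm: "b = (b1, b2)" "k = (k1, k2)" "m = (m1, m2)"
      by fastforce
    show ?thesis
      by (simp add: zak_summand_def gabor_term_eq bkm bimult_bimult lchar2_eq rchar2_eq lchar4_eq rchar4_eq one[unfolded mult_minus_left])
  qed
  then have "zak_refl (gabor_term c (int_point b, int_point k)) ?p
      = (\<Sum>\<^sub>\<infinity>m. bimult (theta_term x1 y1 (fst (b - m))) (theta_term x2 y2 (snd (b - m))) ?q)"
    by (simp add: zak_refl_def)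
  also have "\<dots> = (\<Sum>\<^sub>\<infinity>m. bimult (theta_term x1 y1 (fst m)) (theta_term x2 y2 (snd m)) ?q)"
    by (rule infsum_reindex_bij_witness[where i = "\<lambda>m. b - m" and j = "\<lambda>m. b - m"]) auto
  also have "\<dots> = bimult (theta x1 y1) (theta x2 y2) ?q"
    unfolding theta_def by (intro infsum_bimult_product theta_term_abs_summable)
  finally show ?thesis .
qed

section \<open>Comparison of plane and cube norms\<close>

text \<open>
  The line is the disjoint union of the integer translates of the half-open unit interval. The integers are
  enumerated by naturals so that the sum of integrals is an ordinary series.
\<close>

lemma nn_integral_suminf_shift:
  assumes [measurable]: "f \<in> borel_measurable borel"
  shows "(\<integral>\<^sup>+x. f x \<partial>lborel) = (\<integral>\<^sup>+x. (\<Sum>k. f (x + of_int (int_decode k))) \<partial>unit_lebesgue)"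
proof -
  let ?I = "\<lambda>k. {real_of_int (int_decode k)..<real_of_int (int_decode k) + 1}"
  have pt: "f x = (\<Sum>k. f x * indicator (?I k) x)" for x
  proof -
    have "(\<Sum>k. f x * indicator (?I k) x) = (\<Sum>k\<in>{int_encode \<lfloor>x\<rfloor>}. f x * indicator (?I k) x)"
    proof (rule suminf_finite)
      fix k assume "k \<notin> {int_encode \<lfloor>x\<rfloor>}"
      then have "int_decode k \<noteq> \<lfloor>x\<rfloor>"
        by (metis int_decode_inverse singletonI)
      then have "x \<notin> ?I k"
        by (auto simp: floor_unique)
      then show "f x * indicator (?I k) x = 0"
        by simp
    qed simp
    also have "\<dots> = f x"
      by (simp add: indicator_def)
    finally show ?thesis by simp
  qed
  have shift: "(\<integral>\<^sup>+x. f x * indicator (?I k) x \<partial>lborel) = (\<integral>\<^sup>+x. f (x + of_int (int_decode k)) \<partial>unit_lebesgue)" for k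
  proof -
    have "(\<integral>\<^sup>+x. f x * indicator (?I k) x \<partial>lborel)
        = (\<integral>\<^sup>+x. f (of_int (int_decode k) + 1 * x) * indicator (?I k) (of_int (int_decode k) + 1 * x) \<partial>lborel)"
      by (subst nn_integral_real_affine[where c = 1 and t = "of_int (int_decode k)"]) auto
    also have "\<dots> = (\<integral>\<^sup>+x. f (x + of_int (int_decode k)) * indicator {0..1} x \<partial>lborel)"
    proof (rule nn_integral_cong_AE)
      show "AE x in lborel. f (of_int (int_decode k) + 1 * x) * indicator (?I k) (of_int (int_decode k) + 1 * x)
          = f (x + of_int (int_decode k)) * indicator {0..1} x"
        using AE_lborel_singleton[of "1::real"]
        by eventually_elim (auto simp: indicator_def add.commute)
    qed
    also have "\<dots> = (\<integral>\<^sup>+x. f (x + of_int (int_decode k)) \<partial>unit_lebesgue)"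
      by (rule nn_integral_unit_lebesgue[symmetric]) measurable
    finally show ?thesis .
  qed
  have "(\<integral>\<^sup>+x. f x \<partial>lborel) = (\<integral>\<^sup>+x. (\<Sum>k. f x * indicator (?I k) x) \<partial>lborel)"
    using pt by simp
  also have "\<dots> = (\<Sum>k. \<integral>\<^sup>+x. f x * indicator (?I k) x \<partial>lborel)"
    by (rule nn_integral_suminf) measurable
  also have "\<dots> = (\<integral>\<^sup>+x. (\<Sum>k. f (x + of_int (int_decode k))) \<partial>unit_lebesgue)"
    unfolding shift by (rule nn_integral_suminf[symmetric]) measurable
  finally show ?thesis .
qed

lemma distr_plane_point: "distr (lborel \<Otimes>\<^sub>M lborel) borel plane_point = (lborel :: (real^2) measure)"
proof (rule lborel_eqI[symmetric])
  have m: "plane_point \<in> borel_measurable (lborel \<Otimes>\<^sub>M lborel)"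
    using plane_point_measurable[of fst "lborel \<Otimes>\<^sub>M lborel" snd] by simp
  fix l u :: "real^2" assume le: "\<And>b. b \<in> Basis \<Longrightarrow> l \<bullet> b \<le> u \<bullet> b"
  have B: "Basis = {axis 1 1 :: real^2, axis 2 1}" "axis 1 1 \<noteq> (axis 2 1 :: real^2)"
    by (auto simp: Basis_vec_def UNIV_2 axis_eq_axis)
  have le': "l $ 1 \<le> u $ 1" "l $ 2 \<le> u $ 2"
    using le[of "axis 1 1"] le[of "axis 2 1"] by (simp_all add: B inner_axis)
  have pre: "plane_point -` box l u \<inter> space (lborel \<Otimes>\<^sub>M lborel) = {l $ 1<..<u $ 1} \<times> {l $ 2<..<u $ 2}"
    by (auto simp: mem_box_cart forall_2 space_pair_measure)
  have "emeasure (distr (lborel \<Otimes>\<^sub>M lborel) borel plane_point) (box l u)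
      = emeasure (lborel \<Otimes>\<^sub>M lborel) ({l $ 1<..<u $ 1} \<times> {l $ 2<..<u $ 2})"
    using m by (subst emeasure_distr) (auto simp: pre)
  also have "\<dots> = ennreal ((u $ 1 - l $ 1) * (u $ 2 - l $ 2))"
    using le' by (subst lborel.emeasure_pair_measure_Times) (auto simp: ennreal_mult)
  also have "(u $ 1 - l $ 1) * (u $ 2 - l $ 2) = (\<Prod>b\<in>Basis. (u - l) \<bullet> b)"
    using B(2) by (simp add: B(1) inner_axis)
  finally show "emeasure (distr (lborel \<Otimes>\<^sub>M lborel) borel plane_point) (box l u) = ennreal (\<Prod>b\<in>Basis. (u - l) \<bullet> b)" .
qed simp

lemma nn_integral_plane:
  fixes f :: "real^2 \<Rightarrow> ennreal"
  assumes [measurable]: "f \<in> borel_measurable borel"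
  shows "(\<integral>\<^sup>+z. f z \<partial>lborel) = (\<integral>\<^sup>+x. (\<Sum>j. \<Sum>k. f (plane_point x + int_point (int_decode j, int_decode k))) \<partial>square_lebesgue)"
proof -
  have m [measurable]: "plane_point \<in> borel_measurable (borel \<Otimes>\<^sub>M borel)"
    using plane_point_measurable[of fst "borel \<Otimes>\<^sub>M borel" snd] by simp
  have "(\<integral>\<^sup>+z. f z \<partial>lborel) = (\<integral>\<^sup>+p. f (plane_point p) \<partial>(lborel \<Otimes>\<^sub>M lborel))"
    unfolding distr_plane_point[symmetric] by (subst nn_integral_distr) auto
  also have "\<dots> = (\<integral>\<^sup>+u. \<integral>\<^sup>+v. f (plane_point (u, v)) \<partial>lborel \<partial>lborel)"
    by (subst lborel.nn_integral_fst[symmetric]) auto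
  also have "\<dots> = (\<integral>\<^sup>+x. (\<Sum>j. \<integral>\<^sup>+v. f (plane_point (x + of_int (int_decode j), v)) \<partial>lborel) \<partial>unit_lebesgue)"
    by (rule nn_integral_suminf_shift) measurable
  also have "\<dots> = (\<integral>\<^sup>+x. (\<Sum>j. \<integral>\<^sup>+y. (\<Sum>k. f (plane_point (x + of_int (int_decode j), y + of_int (int_decode k)))) \<partial>unit_lebesgue) \<partial>unit_lebesgue)"
    by (subst nn_integral_suminf_shift) auto
  also have "\<dots> = (\<integral>\<^sup>+x. \<integral>\<^sup>+y. (\<Sum>j. \<Sum>k. f (plane_point (x + of_int (int_decode j), y + of_int (int_decode k)))) \<partial>unit_lebesgue \<partial>unit_lebesgue)"
    by (subst nn_integral_suminf[symmetric]) auto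
  also have "\<dots> = (\<integral>\<^sup>+x. \<integral>\<^sup>+y. (\<Sum>j. \<Sum>k. f (plane_point (x, y) + int_point (int_decode j, int_decode k))) \<partial>unit_lebesgue \<partial>unit_lebesgue)"
  proof -
    have "plane_point (x + of_int (int_decode j), y + of_int (int_decode k)) = plane_point (x, y) + int_point (int_decode j, int_decode k)" for x y j k
      by (simp add: vec2_eq_iff)
    then show ?thesis by simp
  qed
  also have "\<dots> = (\<integral>\<^sup>+x. (\<Sum>j. \<Sum>k. f (plane_point x + int_point (int_decode j, int_decode k))) \<partial>square_lebesgue)"
    by (subst unit_lebesgue.nn_integral_fst[symmetric]) auto
  finally show ?thesis .
qed

lemma suminf_suminf_le:
  fixes t :: "nat \<Rightarrow> nat \<Rightarrow> ennreal"
  assumes "\<And>M N. (\<Sum>j<M. \<Sum>k<N. t j k) \<le> B"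
  shows "(\<Sum>j. \<Sum>k. t j k) \<le> B"
proof (rule suminf_le_const)
  fix M
  have "(\<Sum>j<M. \<Sum>k. t j k) = (\<Sum>k. \<Sum>j<M. t j k)"
    by (rule suminf_sum[symmetric]) simp
  also have "\<dots> \<le> B"
  proof (rule suminf_le_const)
    show "(\<Sum>k<N. \<Sum>j<M. t j k) \<le> B" for N
      by (subst sum.swap) (rule assms)
  qed simp
  finally show "(\<Sum>j<M. \<Sum>k. t j k) \<le> B" .
qed simp

text \<open>
  The cell bounds make the series \<open>zak_refl\<close> converge uniformly when its first argument lies in the unit
  square. The value zero elsewhere gives a function that is measurable on the whole space.
\<close>

definition zak_cut :: "(real^2 \<Rightarrow> quat) \<Rightarrow> phase \<Rightarrow> quat" where
  "zak_cut f p = (if fst p \<in> unit_square then zak_refl f p else 0)"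

lemma sets_square_lebesgue: "sets square_lebesgue = sets borel"
proof -
  have "sets square_lebesgue = sets (borel \<Otimes>\<^sub>M borel :: (real \<times> real) measure)"
    by (rule sets_pair_measure_cong) auto
  then show ?thesis
    by (simp only: borel_prod)
qed

lemma sets_cube_lebesgue: "sets cube_lebesgue = sets borel"
proof -
  have "sets cube_lebesgue = sets (borel \<Otimes>\<^sub>M borel :: phase measure)"
    by (rule sets_pair_measure_cong) (rule sets_square_lebesgue)+
  then show ?thesis
    by (simp only: borel_prod)
qed

lemma borel_cube: "f \<in> borel_measurable borel \<Longrightarrow> f \<in> borel_measurable cube_lebesgue"
  using measurable_cong_sets[OF sets_cube_lebesgue refl] by blast

lemma closed_unit_square: "closed unit_square"
  by (simp add: unit_square_def closed_Times)

lemma zak_cut_measurable: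
  assumes "f \<in> W0"
  shows "zak_cut f \<in> borel_measurable cube_lebesgue"
proof (rule borel_cube)
  have "(\<lambda>p. if p \<in> unit_square \<times> UNIV then zak_refl f p else 0) \<in> borel_measurable borel"
    using zak_refl_continuous[OF assms]
    by (intro borel_measurable_continuous_on_if borel_closed closed_Times closed_unit_square continuous_intros) auto
  moreover have "zak_cut f = (\<lambda>p. if p \<in> unit_square \<times> UNIV then zak_refl f p else 0)"
    by (auto simp: zak_cut_def mem_Times_iff)
  ultimately show "zak_cut f \<in> borel_measurable borel"
    by simp
qed

lemma norm_zak_cut_le: "f \<in> W0 \<Longrightarrow> norm (zak_cut f p) \<le> enn2real (W_norm f)"
  using norm_zak_refl_le[of f "fst p" "snd p"] by (simp add: zak_cut_def)

lemma zak_cut_add: "f \<in> W0 \<Longrightarrow> g \<in> W0 \<Longrightarrow> zak_cut (\<lambda>x. f x + g x) p = zak_cut f p + zak_cut g p"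
  using zak_refl_add[of f g "fst p" "snd p"] by (simp add: zak_cut_def)

lemma zak_cut_diff: "f \<in> W0 \<Longrightarrow> g \<in> W0 \<Longrightarrow> zak_cut (\<lambda>x. f x - g x) p = zak_cut f p - zak_cut g p"
  using zak_refl_diff[of f g "fst p" "snd p"] by (simp add: zak_cut_def)

lemma zak_cut_scaleR: "zak_cut (\<lambda>x. r *\<^sub>R f x) p = r *\<^sub>R zak_cut f p"
  by (simp add: zak_cut_def zak_refl_scaleR)

lemma zak_cut_sum: "finite A \<Longrightarrow> (\<And>i. i \<in> A \<Longrightarrow> f i \<in> W0) \<Longrightarrow> zak_cut (\<lambda>x. \<Sum>i\<in>A. f i x) p = (\<Sum>i\<in>A. zak_cut (f i) p)"
  using zak_refl_sum[of A f "fst p" "snd p"] by (simp add: zak_cut_def)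

text \<open>
  For fixed \<open>x\<close> the values of \<open>f\<close> on the translates of \<open>x\<close> by integers are the Fourier coefficients of the
  Zak transform in \<open>y\<close>. Bessel's inequality in \<open>y\<close>, integrated over \<open>x\<close>, sums up to the integral
  over the plane.
\<close>

lemma zak_plancherel_le:
  assumes f: "f \<in> W0"
  shows "(\<integral>\<^sup>+z. ennreal ((norm (f z))\<^sup>2) \<partial>lborel) \<le> (\<integral>\<^sup>+p. ennreal ((norm (zak_cut f p))\<^sup>2) \<partial>cube_lebesgue)"
proof -
  have [measurable]: "f \<in> borel_measurable borel"
    by (rule W0_measurable[OF f])
  note zak_cut_measurable[OF f, measurable]
  have fib: "(\<Sum>j. \<Sum>k. ennreal ((norm (f (plane_point x + int_point (int_decode j, int_decode k))))\<^sup>2))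
      \<le> (\<integral>\<^sup>+y. ennreal ((norm (zak_cut f (x, y)))\<^sup>2) \<partial>square_lebesgue)" if x: "x \<in> unit_square" for x
  proof (rule suminf_suminf_le)
    fix M N
    let ?g = "\<lambda>(j, k). (int_decode j, int_decode k)"
    have inj: "inj_on ?g ({..<M} \<times> {..<N})"
      by (auto simp: inj_on_def int_decode_eq)
    have "(\<Sum>j<M. \<Sum>k<N. ennreal ((norm (f (plane_point x + int_point (int_decode j, int_decode k))))\<^sup>2))
        = (\<Sum>n\<in>?g ` ({..<M} \<times> {..<N}). ennreal ((norm (f (plane_point x + int_point n)))\<^sup>2))"
      unfolding sum.reindex[OF inj] sum.cartesian_product by (intro sum.cong) auto
    also have "\<dots> \<le> (\<integral>\<^sup>+y. ennreal ((norm (zak_cut f (x, y)))\<^sup>2) \<partial>square_lebesgue)"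
    proof (rule sq.abs_summable_bessel)
      show "(\<lambda>n. norm (f (plane_point x + int_point n))) summable_on UNIV"
        by (rule zak_summand_abs_summable[OF f x])
      show "zak_cut f (x, y) = (\<Sum>\<^sub>\<infinity>n. bimult (lchar2 n y) (rchar2 n y) (f (plane_point x + int_point n)))" for y
        using x by (simp add: zak_cut_def zak_refl_def zak_summand_def)
      show "(\<lambda>y. zak_cut f (x, y)) \<in> borel_measurable square_lebesgue"
        by (rule measurable_Pair2[OF zak_cut_measurable[OF f]]) (simp add: space_pair_measure)
    qed simp
    finally show "(\<Sum>j<M. \<Sum>k<N. ennreal ((norm (f (plane_point x + int_point (int_decode j, int_decode k))))\<^sup>2))
        \<le> (\<integral>\<^sup>+y. ennreal ((norm (zak_cut f (x, y)))\<^sup>2) \<partial>square_lebesgue)" .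
  qed
  have "(\<integral>\<^sup>+z. ennreal ((norm (f z))\<^sup>2) \<partial>lborel)
      = (\<integral>\<^sup>+x. (\<Sum>j. \<Sum>k. ennreal ((norm (f (plane_point x + int_point (int_decode j, int_decode k))))\<^sup>2)) \<partial>square_lebesgue)"
    by (rule nn_integral_plane) measurable
  also have "\<dots> \<le> (\<integral>\<^sup>+x. \<integral>\<^sup>+y. ennreal ((norm (zak_cut f (x, y)))\<^sup>2) \<partial>square_lebesgue \<partial>square_lebesgue)"
    using AE_square
    by (intro nn_integral_mono_AE, eventually_elim) (rule fib, auto simp: unit_square_def offcentre_def mem_Times_iff)
  also have "\<dots> = (\<integral>\<^sup>+p. ennreal ((norm (zak_cut f p))\<^sup>2) \<partial>cube_lebesgue)"
    by (rule sq.nn_integral_fst) measurable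
  finally show ?thesis .
qed

section \<open>Uniform approximation by trigonometric polynomials\<close>

context char_system begin

lemma l_zero [simp]: "l 0 p = 1"
  using l_diff[of 0 0 p] by (simp flip: complex_norm_square)

lemma r_zero [simp]: "r 0 p = 1"
  using r_diff[of 0 0 p] by (simp flip: complex_norm_square)

lemma l_add: "l (n + m) p = l n p * l m p"
  using l_diff[of n "- m" p] l_diff[of 0 m p] by simp

lemma r_add: "r (n + m) p = r n p * r m p"
  using r_diff[of n "- m" p] r_diff[of 0 m p] by simp

definition trig_polys :: "('a \<Rightarrow> quat) set" where
  "trig_polys = {P. \<exists>N c. finite N \<and> P = (\<lambda>p. \<Sum>n\<in>N. bimult (l n p) (r n p) (c n))}"

lemma trig_polysI: "finite N \<Longrightarrow> (\<lambda>p. \<Sum>n\<in>N. bimult (l n p) (r n p) (c n)) \<in> trig_polys"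
  unfolding trig_polys_def by (rule CollectI, rule exI[of _ N], rule exI[of _ c]) simp

lemma trig_char: "(\<lambda>p. bimult (l n p) (r n p) q) \<in> trig_polys"
  using trig_polysI[of "{n}" "\<lambda>_. q"] by simp

lemma trig_const: "(\<lambda>p. q) \<in> trig_polys"
  using trig_char[of 0 q] by simp

lemma trig_add:
  assumes "P \<in> trig_polys" "Q \<in> trig_polys"
  shows "(\<lambda>p. P p + Q p) \<in> trig_polys"
proof -
  obtain N c where P: "finite N" "P = (\<lambda>p. \<Sum>n\<in>N. bimult (l n p) (r n p) (c n))"
    using assms(1) by (auto simp: trig_polys_def)
  obtain N' c' where Q: "finite N'" "Q = (\<lambda>p. \<Sum>n\<in>N'. bimult (l n p) (r n p) (c' n))"
    using assms(2) by (auto simp: trig_polys_def)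
  have "(\<Sum>n\<in>N. bimult (l n p) (r n p) (c n)) = (\<Sum>n\<in>N \<union> N'. bimult (l n p) (r n p) (if n \<in> N then c n else 0))"
    "(\<Sum>n\<in>N'. bimult (l n p) (r n p) (c' n)) = (\<Sum>n\<in>N \<union> N'. bimult (l n p) (r n p) (if n \<in> N' then c' n else 0))" for p
    using P(1) Q(1) by (auto intro!: sum.mono_neutral_cong_left)
  then have "(\<lambda>p. P p + Q p) = (\<lambda>p. \<Sum>n\<in>N \<union> N'. bimult (l n p) (r n p) ((if n \<in> N then c n else 0) + (if n \<in> N' then c' n else 0)))"
    unfolding P(2) Q(2) by (simp add: bimult_add sum.distrib)
  then show ?thesis
    using trig_polysI[of "N \<union> N'"] P(1) Q(1) by simp
qed

lemma trig_sum:
  "finite A \<Longrightarrow> (\<And>a. a \<in> A \<Longrightarrow> P a \<in> trig_polys) \<Longrightarrow> (\<lambda>p. \<Sum>a\<in>A. P a p) \<in> trig_polys"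
  by (induction A rule: finite_induct) (auto intro: trig_add trig_const)

lemma trig_scaleR:
  assumes "P \<in> trig_polys"
  shows "(\<lambda>p. x *\<^sub>R P p) \<in> trig_polys"
proof -
  obtain N c where P: "finite N" "P = (\<lambda>p. \<Sum>n\<in>N. bimult (l n p) (r n p) (c n))"
    using assms(1) by (auto simp: trig_polys_def)
  have "(\<lambda>p. x *\<^sub>R P p) = (\<lambda>p. \<Sum>n\<in>N. bimult (l n p) (r n p) (x *\<^sub>R c n))"
    by (simp add: P(2) scaleR_sum_right bimult_scaleR)
  then show ?thesis
    using trig_polysI[OF P(1)] by simp
qed

text \<open>
  Real functions that preserve trigonometric polynomials under multiplication. They form an algebra,
  which makes induction over real polynomials in the torus coordinates possible although the
  trigonometric polynomials themselves have quaternion values.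
\<close>

definition trig_multiplier :: "('a \<Rightarrow> real) \<Rightarrow> bool" where
  "trig_multiplier \<kappa> \<longleftrightarrow> (\<forall>P\<in>trig_polys. (\<lambda>p. \<kappa> p *\<^sub>R P p) \<in> trig_polys)"

lemma trig_multiplier_add:
  "trig_multiplier \<kappa> \<Longrightarrow> trig_multiplier \<kappa>' \<Longrightarrow> trig_multiplier (\<lambda>p. \<kappa> p + \<kappa>' p)"
  by (auto simp: trig_multiplier_def scaleR_add_left intro!: trig_add)

lemma trig_multiplier_mult:
  "trig_multiplier \<kappa> \<Longrightarrow> trig_multiplier \<kappa>' \<Longrightarrow> trig_multiplier (\<lambda>p. \<kappa> p * \<kappa>' p)"
  unfolding trig_multiplier_def by (simp flip: scaleR_scaleR)

lemma trig_multiplier_const: "trig_multiplier (\<lambda>p. x)"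
  by (simp add: trig_multiplier_def trig_scaleR)

lemma bimult_scaleR_left: "bimult (of_real x * z) w q = x *\<^sub>R bimult z w q" "bimult z (of_real x * w) q = x *\<^sub>R bimult z w q"
  using linear_cmul[OF bounded_linear.linear[OF bounded_linear_bimult_left[of w q]], of x z]
    linear_cmul[OF bounded_linear.linear[OF bounded_linear_bimult_right[of z q]], of x w]
  by (simp_all add: scaleR_conv_of_real)

lemma trig_bimult_char:
  assumes "P \<in> trig_polys"
  shows "(\<lambda>p. bimult z w (bimult (l e p) (r e p) (P p))) \<in> trig_polys"
proof -
  obtain N c where P: "finite N" "P = (\<lambda>p. \<Sum>n\<in>N. bimult (l n p) (r n p) (c n))"
    using assms by (auto simp: trig_polys_def)
  have "(\<lambda>p. \<Sum>n\<in>N. bimult (l (n + e) p) (r (n + e) p) (bimult z w (c n))) \<in> trig_polys"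
    by (intro trig_sum P(1) trig_char)
  then show ?thesis
    by (simp add: P(2) bimult_sum bimult_bimult l_add r_add mult_ac)
qed

text \<open>
  Real and imaginary part of a character are complex combinations of it and its conjugate, and the
  complex scalars can be absorbed into the coefficients on the side on which the character acts.
\<close>

lemma trig_multiplier_coordinate:
  assumes "(\<forall>p. r e p = 1) \<and> \<psi> = l e \<or> (\<forall>p. l e p = 1) \<and> \<psi> = r e"
  shows "trig_multiplier (\<lambda>p. Re (\<psi> p))" "trig_multiplier (\<lambda>p. Im (\<psi> p))"
proof -
  have re: "of_real (Re z) = (1/2) * z + (1/2) * cnj z"
    and im: "of_real (Im z) = (1/(2*\<i>)) * z + (- 1/(2*\<i>)) * cnj z" for z
    by (auto simp: complex_eq_iff Re_divide Im_divide power2_eq_square)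
  have minus: "l (- e) p = cnj (l e p)" "r (- e) p = cnj (r e p)" for p
    using l_diff[of 0 e p] r_diff[of 0 e p] by simp_all
  have combine: "trig_multiplier \<kappa>" if \<kappa>: "\<And>p. of_real (\<kappa> p) = u * \<psi> p + v * cnj (\<psi> p)" for \<kappa> u v
    unfolding trig_multiplier_def
  proof
    fix P assume P: "P \<in> trig_polys"
    from assms show "(\<lambda>p. \<kappa> p *\<^sub>R P p) \<in> trig_polys"
    proof (elim disjE conjE)
      assume e: "\<forall>p. r e p = 1" "\<psi> = l e"
      have "\<kappa> p *\<^sub>R P p = bimult u 1 (bimult (l e p) (r e p) (P p)) + bimult v 1 (bimult (l (- e) p) (r (- e) p) (P p))" for p
        using bimult_scaleR_left(1)[of "\<kappa> p" 1 1 "P p"] \<kappa>[of p] e by (simp add: bimult_bimult minus bimult_add_left)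
      then show ?thesis
        by (simp add: trig_add trig_bimult_char P)
    next
      assume e: "\<forall>p. l e p = 1" "\<psi> = r e"
      have "\<kappa> p *\<^sub>R P p = bimult 1 u (bimult (l e p) (r e p) (P p)) + bimult 1 v (bimult (l (- e) p) (r (- e) p) (P p))" for p
        using bimult_scaleR_left(2)[of 1 "\<kappa> p" 1 "P p"] \<kappa>[of p] e by (simp add: bimult_bimult minus bimult_add_right)
      then show ?thesis
        by (simp add: trig_add trig_bimult_char P)
    qed
  qed
  show "trig_multiplier (\<lambda>p. Re (\<psi> p))" "trig_multiplier (\<lambda>p. Im (\<psi> p))"
    by (rule combine, rule re) (rule combine, rule im)
qed

end

definition torus :: "phase \<Rightarrow> (complex \<times> complex) \<times> (complex \<times> complex)" where
  "torus p = ((cexpt (fst (fst p)), cexpt (snd (fst p))), (cexpt (fst (snd p)), cexpt (snd (snd p))))"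

lemma trig_multiplier_torus:
  "cube.trig_multiplier (\<lambda>p. Re (fst (fst (torus p))))" "cube.trig_multiplier (\<lambda>p. Im (fst (fst (torus p))))"
  "cube.trig_multiplier (\<lambda>p. Re (snd (fst (torus p))))" "cube.trig_multiplier (\<lambda>p. Im (snd (fst (torus p))))"
  "cube.trig_multiplier (\<lambda>p. Re (fst (snd (torus p))))" "cube.trig_multiplier (\<lambda>p. Im (fst (snd (torus p))))"
  "cube.trig_multiplier (\<lambda>p. Re (snd (snd (torus p))))" "cube.trig_multiplier (\<lambda>p. Im (snd (snd (torus p))))"
proof -
  have "(\<forall>p. rchar4 ((1, 0), (0, 0)) p = 1) \<and> (\<lambda>p. fst (fst (torus p))) = lchar4 ((1, 0), (0, 0))"
    "(\<forall>p. lchar4 ((0, 1), (0, 0)) p = 1) \<and> (\<lambda>p. snd (fst (torus p))) = rchar4 ((0, 1), (0, 0))"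
    "(\<forall>p. rchar4 ((0, 0), (1, 0)) p = 1) \<and> (\<lambda>p. fst (snd (torus p))) = lchar4 ((0, 0), (1, 0))"
    "(\<forall>p. lchar4 ((0, 0), (0, 1)) p = 1) \<and> (\<lambda>p. snd (snd (torus p))) = rchar4 ((0, 0), (0, 1))"
    by (auto simp: torus_def lchar4_eq rchar4_eq)
  note * = this[THEN disjI1] this[THEN disjI2]
  show "cube.trig_multiplier (\<lambda>p. Re (fst (fst (torus p))))" "cube.trig_multiplier (\<lambda>p. Im (fst (fst (torus p))))"
    by (rule cube.trig_multiplier_coordinate[OF *(1)])+
  show "cube.trig_multiplier (\<lambda>p. Re (snd (fst (torus p))))" "cube.trig_multiplier (\<lambda>p. Im (snd (fst (torus p))))"
    by (rule cube.trig_multiplier_coordinate[OF *(6)])+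
  show "cube.trig_multiplier (\<lambda>p. Re (fst (snd (torus p))))" "cube.trig_multiplier (\<lambda>p. Im (fst (snd (torus p))))"
    by (rule cube.trig_multiplier_coordinate[OF *(3)])+
  show "cube.trig_multiplier (\<lambda>p. Re (snd (snd (torus p))))" "cube.trig_multiplier (\<lambda>p. Im (snd (snd (torus p))))"
    by (rule cube.trig_multiplier_coordinate[OF *(8)])+
qed

lemma real_polynomial_torus:
  "real_polynomial_function h \<Longrightarrow> cube.trig_multiplier (\<lambda>p. h (torus p))"
proof (induction h rule: real_polynomial_function.induct)
  case (linear h)
  interpret h: bounded_linear h by fact
  \<comment> \<open>A linear form on the torus coordinates is a real combination of eight real and imaginary parts.\<close>
  have dec: "((z1, z2), (z3, z4)) = Re z1 *\<^sub>R ((1, 0), (0, 0)) + Im z1 *\<^sub>R ((\<i>, 0), (0, 0))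
      + Re z2 *\<^sub>R ((0, 1), (0, 0)) + Im z2 *\<^sub>R ((0, \<i>), (0, 0))
      + Re z3 *\<^sub>R ((0, 0), (1, 0)) + Im z3 *\<^sub>R ((0, 0), (\<i>, 0))
      + Re z4 *\<^sub>R ((0, 0), (0, 1)) + Im z4 *\<^sub>R ((0, 0), (0, \<i>))" for z1 z2 z3 z4 :: complex
    by (simp add: complex_eq_iff)
  have "h (torus p) = Re (fst (fst (torus p))) * h ((1, 0), (0, 0)) + Im (fst (fst (torus p))) * h ((\<i>, 0), (0, 0))
      + Re (snd (fst (torus p))) * h ((0, 1), (0, 0)) + Im (snd (fst (torus p))) * h ((0, \<i>), (0, 0))
      + Re (fst (snd (torus p))) * h ((0, 0), (1, 0)) + Im (fst (snd (torus p))) * h ((0, 0), (\<i>, 0))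
      + Re (snd (snd (torus p))) * h ((0, 0), (0, 1)) + Im (snd (snd (torus p))) * h ((0, 0), (0, \<i>))" for p
    using arg_cong[OF dec[of "fst (fst (torus p))" "snd (fst (torus p))" "fst (snd (torus p))" "snd (snd (torus p))"], of h]
    unfolding prod.collapse h.add h.scaleR real_scaleR_def .
  then show ?case
    by (simp only: cube.trig_multiplier_add cube.trig_multiplier_mult cube.trig_multiplier_const trig_multiplier_torus)
next
  case (const c)
  show ?case by (rule cube.trig_multiplier_const)
next
  case (add f g)
  then show ?case by (intro cube.trig_multiplier_add)
next
  case (mult f g)
  then show ?case by (intro cube.trig_multiplier_mult)
qed

lemma polynomial_torus:
  assumes "polynomial_function (g :: _ \<Rightarrow> quat)"
  shows "(\<lambda>p. g (torus p)) \<in> cube.trig_polys"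
proof -
  have "(\<lambda>p. \<Sum>b\<in>Basis. (g (torus p) \<bullet> b) *\<^sub>R b) \<in> cube.trig_polys"
  proof (rule cube.trig_sum)
    fix b :: quat assume "b \<in> Basis"
    then have "cube.trig_multiplier (\<lambda>p. g (torus p) \<bullet> b)"
      using assms real_polynomial_torus[of "\<lambda>x. g x \<bullet> b"] by (simp add: polynomial_function_iff_Basis_inner)
    then show "(\<lambda>p. (g (torus p) \<bullet> b) *\<^sub>R b) \<in> cube.trig_polys"
      using cube.trig_const[of b] by (simp add: cube.trig_multiplier_def)
  qed simp
  then show ?thesis
    by (simp add: euclidean_representation)
qed

lemma cexpt_eq_unit:
  assumes "cexpt a = cexpt b" "0 \<le> a" "a \<le> 1" "0 \<le> b" "b \<le> 1"
  shows "a = b \<or> a \<in> {0, 1} \<and> b \<in> {0, 1}"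
proof -
  have "cexpt (a - b) = 1"
    using assms(1) cexpt_add[of a "- b"] by (simp add: cexpt_minus flip: complex_norm_square)
  then have "cos (2 * pi * (a - b)) = 1"
    by (simp add: cexpt_def complex_eq_iff)
  then obtain n :: int where "2 * pi * (a - b) = real_of_int n * (2 * pi)"
    by (auto simp: cos_one_2pi_int mult.assoc)
  then have n: "a - b = real_of_int n"
    by simp
  then have "-1 \<le> real_of_int n" "real_of_int n \<le> 1"
    using assms by auto
  then have "n \<in> {-1, 0, 1}"
    by auto
  with n assms show ?thesis
    by auto
qed

definition unit_cube :: "phase set" where
  "unit_cube = unit_square \<times> unit_square"

lemma compact_unit_cube: "compact unit_cube"
  by (simp add: unit_cube_def unit_square_def compact_Times)

text \<open>
  A continuous function on the cube that vanishes on the boundary factors through the torus, since two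
  points of the cube with the same image are equal or both on the boundary. On the torus, a compact subset of
  a Euclidean space, the Stone-Weierstrass theorem provides a polynomial in the coordinates.
\<close>

lemma trig_poly_approx:
  fixes G :: "phase \<Rightarrow> quat"
  assumes cont: "continuous_on unit_cube G"
    and bdry: "\<And>p. p \<in> unit_cube \<Longrightarrow> {fst (fst p), snd (fst p), fst (snd p), snd (snd p)} \<inter> {0, 1} \<noteq> {} \<Longrightarrow> G p = 0"
    and "\<epsilon> > 0"
  obtains P where "P \<in> cube.trig_polys" "\<And>p. p \<in> unit_cube \<Longrightarrow> norm (G p - P p) < \<epsilon>"
proof -
  have tc: "continuous_on S torus" for S
    unfolding torus_def by (intro continuous_intros)
  have eq: "G p = G p'" if "p \<in> unit_cube" "p' \<in> unit_cube" "torus p = torus p'" for p p'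
  proof (cases "p = p'")
    case False
    obtain x1 x2 y1 y2 x1' x2' y1' y2' where p: "p = ((x1, x2), (y1, y2))" "p' = ((x1', x2'), (y1', y2'))"
      by (metis surj_pair)
    from that(3) have e: "cexpt x1 = cexpt x1'" "cexpt x2 = cexpt x2'" "cexpt y1 = cexpt y1'" "cexpt y2 = cexpt y2'"
      by (simp_all add: torus_def p)
    have range: "0 \<le> x1" "x1 \<le> 1" "0 \<le> x2" "x2 \<le> 1" "0 \<le> y1" "y1 \<le> 1" "0 \<le> y2" "y2 \<le> 1"
      "0 \<le> x1'" "x1' \<le> 1" "0 \<le> x2'" "x2' \<le> 1" "0 \<le> y1'" "y1' \<le> 1" "0 \<le> y2'" "y2' \<le> 1"
      using that(1,2) by (auto simp: p unit_cube_def unit_square_def)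
    have "{x1, x2, y1, y2} \<inter> {0, 1} \<noteq> {} \<and> {x1', x2', y1', y2'} \<inter> {0, 1} \<noteq> {}"
    proof -
      have "x1 = x1' \<or> x1 \<in> {0, 1} \<and> x1' \<in> {0, 1}" "x2 = x2' \<or> x2 \<in> {0, 1} \<and> x2' \<in> {0, 1}"
        "y1 = y1' \<or> y1 \<in> {0, 1} \<and> y1' \<in> {0, 1}" "y2 = y2' \<or> y2 \<in> {0, 1} \<and> y2' \<in> {0, 1}"
        using cexpt_eq_unit[OF e(1)] cexpt_eq_unit[OF e(2)] cexpt_eq_unit[OF e(3)] cexpt_eq_unit[OF e(4)] range
        by simp_all
      moreover have "\<not> (x1 = x1' \<and> x2 = x2' \<and> y1 = y1' \<and> y2 = y2')"
        using False by (simp add: p)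
      ultimately show ?thesis
        by auto
    qed
    then show ?thesis
      using bdry[OF that(1)] bdry[OF that(2)] by (simp add: p)
  qed simp
  define H where "H t = G (SOME p. p \<in> unit_cube \<and> torus p = t)" for t
  have H: "H (torus p) = G p" if "p \<in> unit_cube" for p
  proof -
    have "(SOME q. q \<in> unit_cube \<and> torus q = torus p) \<in> unit_cube \<and> torus (SOME q. q \<in> unit_cube \<and> torus q = torus p) = torus p"
      by (rule someI[of _ p]) (use that in simp)
    then show ?thesis
      unfolding H_def using eq that by blast
  qed
  have cT: "compact (torus ` unit_cube)"
    by (intro compact_continuous_image tc compact_unit_cube)
  have Hc: "continuous_on (torus ` unit_cube) H"
  proof (subst continuous_on_closed_vimage[OF compact_imp_closed[OF cT]], intro allI impI)
    fix C :: "quat set" assume "closed C"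
    have "H -` C \<inter> torus ` unit_cube = torus ` (G -` C \<inter> unit_cube)"
      using H by auto
    moreover have "compact (torus ` (G -` C \<inter> unit_cube))"
    proof (intro compact_continuous_image tc)
      have "closed (G -` C \<inter> unit_cube)"
        using cont \<open>closed C\<close> continuous_on_closed_vimage[OF compact_imp_closed[OF compact_unit_cube]] by blast
      then show "compact (G -` C \<inter> unit_cube)"
        using compact_Int_closed[OF compact_unit_cube] by (metis Int_absorb2 Int_commute inf_le2)
    qed
    ultimately show "closed (H -` C \<inter> torus ` unit_cube)"
      by (simp add: compact_imp_closed)
  qed
  obtain g where g: "polynomial_function g" "\<And>t. t \<in> torus ` unit_cube \<Longrightarrow> norm (H t - g t) < \<epsilon>"
    using Stone_Weierstrass_polynomial_function[OF cT Hc \<open>\<epsilon> > 0\<close>] by blast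
  show thesis
  proof (rule that[OF polynomial_torus[OF g(1)]])
    fix p assume "p \<in> unit_cube"
    then show "norm (G p - g (torus p)) < \<epsilon>"
      using g(2)[of "torus p"] H[of p] by simp
  qed
qed

section \<open>Quotient of the Zak transform by the theta functions\<close>

definition theta_left :: "phase \<Rightarrow> complex" where
  "theta_left p = theta (fst (fst p)) (fst (snd p))"

definition theta_right :: "phase \<Rightarrow> complex" where
  "theta_right p = theta (snd (fst p)) (snd (snd p))"

definition zak_quot :: "(real^2 \<Rightarrow> quat) \<Rightarrow> phase \<Rightarrow> quat" where
  "zak_quot f p = bimult (inverse (theta_left p)) (inverse (theta_right p)) (zak_cut f p)"

text \<open>
  A set of full measure on which neither theta factor vanishes. It avoids the points where \<open>0 powr (- a)\<close>
  in a weight takes its default value \<open>0\<close>.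
\<close>

definition off_singular :: "phase \<Rightarrow> bool" where
  "off_singular p \<longleftrightarrow> (fst (fst p) \<in> offcentre \<and> snd (fst p) \<in> offcentre)
    \<and> fst (snd p) \<in> offcentre \<and> snd (snd p) \<in> offcentre"

lemma AE_off_singular: "AE p in cube_lebesgue. off_singular p"
  unfolding off_singular_def by (rule AE_cube)

lemma th_measurable [measurable]: "theta_left \<in> borel_measurable cube_lebesgue" "theta_right \<in> borel_measurable cube_lebesgue"
  unfolding theta_left_def[abs_def] theta_right_def[abs_def] by measurable

lemma continuous_on_th [continuous_intros]: "continuous_on S theta_left" "continuous_on S theta_right"
  unfolding theta_left_def[abs_def] theta_right_def[abs_def] by (intro continuous_intros)+

lemma zak_quot_measurable: "f \<in> W0 \<Longrightarrow> zak_quot f \<in> borel_measurable cube_lebesgue"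
  unfolding zak_quot_def[abs_def] using zak_cut_measurable by measurable

lemma nn_integral_cube_product:
  assumes [measurable]: "g \<in> borel_measurable borel"
  shows "(\<integral>\<^sup>+p. (g (fst (fst p)) * g (snd (fst p))) * (g (fst (snd p)) * g (snd (snd p))) \<partial>cube_lebesgue)
    = (\<integral>\<^sup>+x. g x \<partial>unit_lebesgue) ^ 4"
proof -
  let ?I = "\<integral>\<^sup>+x. g x \<partial>unit_lebesgue"
  have sq: "(\<integral>\<^sup>+p. g (fst p) * g (snd p) \<partial>square_lebesgue) = ?I * ?I"
    by (subst unit_lebesgue.nn_integral_fst[symmetric]) (auto simp: nn_integral_cmult nn_integral_multc)
  have "(\<integral>\<^sup>+p. (g (fst (fst p)) * g (snd (fst p))) * (g (fst (snd p)) * g (snd (snd p))) \<partial>cube_lebesgue)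
      = (\<integral>\<^sup>+x. \<integral>\<^sup>+y. (g (fst x) * g (snd x)) * (g (fst y) * g (snd y)) \<partial>square_lebesgue \<partial>square_lebesgue)"
    by (subst sq.nn_integral_fst[symmetric]) auto
  also have "\<dots> = (\<integral>\<^sup>+x. (g (fst x) * g (snd x)) * (?I * ?I) \<partial>square_lebesgue)"
    by (simp add: nn_integral_cmult sq)
  also have "\<dots> = (?I * ?I) * (?I * ?I)"
    by (simp add: nn_integral_multc sq)
  finally show ?thesis
    by (simp add: power4_eq_xxxx mult.assoc)
qed

definition power_weight :: "real \<Rightarrow> phase \<Rightarrow> real" where
  "power_weight a p = (\<bar>fst (fst p) - 1/2\<bar> powr (- a) * \<bar>snd (fst p) - 1/2\<bar> powr (- a)) *
     (\<bar>fst (snd p) - 1/2\<bar> powr (- a) * \<bar>snd (snd p) - 1/2\<bar> powr (- a))"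

lemma power_weight_measurable [measurable]: "power_weight a \<in> borel_measurable cube_lebesgue"
  unfolding power_weight_def[abs_def] by measurable

lemma power_weight_nonneg: "power_weight a p \<ge> 0"
  by (simp add: power_weight_def)

lemma nn_integral_power_weight:
  assumes "0 \<le> a" "a < 1"
  shows "(\<integral>\<^sup>+p. ennreal (power_weight a p) \<partial>cube_lebesgue) < \<infinity>"
proof -
  have "(\<integral>\<^sup>+p. ennreal (power_weight a p) \<partial>cube_lebesgue) = (\<integral>\<^sup>+x. ennreal (\<bar>x - 1/2\<bar> powr (- a)) \<partial>unit_lebesgue) ^ 4"
    by (subst nn_integral_cube_product[symmetric]) (auto simp: power_weight_def ennreal_mult)
  also have "\<dots> < \<infinity>"
    using nn_integral_power_singularity[OF assms] by (simp add: power_less_top_ennreal)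
  finally show ?thesis .
qed

text \<open>
  Both follow from a^s b^(s') \<le> (a + b)^(s + s'), once with exponents 1/2 + 1/2 = 1 and once with
  5/4 + 3/4 = 2. In the second case the factor a^(1/2) leaves a^(-3/4) b^(-3/4), and both exponents are above
  -1, so that the bound is integrable in each variable.
\<close>

lemma theta_pair_ineqs:
  fixes a b c t :: real
  assumes "a > 0" "b > 0" "c > 0" "c * (a + b) \<le> t"
  shows "inverse t \<le> (1/c) * (a powr (-1/2) * b powr (-1/2))"
    and "(sqrt a + sqrt b) * (inverse t)\<^sup>2 \<le> (2/c\<^sup>2) * (a powr (-3/4) * b powr (-3/4))"
proof -
  have t: "t > 0"
  proof -
    have "0 < c * (a + b)"
      using assms by (intro mult_pos_pos) auto
    with assms(4) show ?thesis by linarith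
  qed
  have le: "u powr s * v powr s' \<le> (u + v) powr (s + s')" if "u > 0" "v > 0" "s \<ge> 0" "s' \<ge> 0" for u v s s' :: real
    unfolding powr_add using that by (intro mult_mono powr_mono2) auto
  have neg: "u powr (-1/2) = inverse (u powr (1/2))" "u powr (-3/4) = inverse (u powr (3/4))"
    "u powr (-5/4) = inverse (u powr (5/4))" for u :: real
    using powr_minus[of u "1/2"] powr_minus[of u "3/4"] powr_minus[of u "5/4"] by simp_all
  have inv: "inverse t \<le> inverse (c * (a + b))"
    using assms by (intro le_imp_inverse_le mult_pos_pos) auto
  have "a powr (1/2) * b powr (1/2) \<le> a + b"
    using le[of a b "1/2" "1/2"] assms by simp
  then have "inverse (a + b) \<le> inverse (a powr (1/2) * b powr (1/2))"
    using assms by (intro le_imp_inverse_le) auto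
  then have "inverse c * inverse (a + b) \<le> inverse c * inverse (a powr (1/2) * b powr (1/2))"
    using assms(3) by (intro mult_left_mono) auto
  then have "inverse (c * (a + b)) \<le> (1/c) * (a powr (-1/2) * b powr (-1/2))"
    by (simp only: neg inverse_mult_distrib inverse_eq_divide[of c])
  with inv show "inverse t \<le> (1/c) * (a powr (-1/2) * b powr (-1/2))"
    by linarith
  have one: "sqrt u * (inverse (u + v))\<^sup>2 \<le> u powr (-3/4) * v powr (-3/4)" if "u > 0" "v > 0" for u v :: real
  proof -
    have "u powr (5/4) * v powr (3/4) \<le> (u + v)\<^sup>2"
      using le[of u v "5/4" "3/4"] that by simp
    then have "inverse ((u + v)\<^sup>2) \<le> inverse (u powr (5/4) * v powr (3/4))"
      using that by (intro le_imp_inverse_le) auto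
    then have "(inverse (u + v))\<^sup>2 \<le> u powr (-5/4) * v powr (-3/4)"
      by (simp only: neg inverse_mult_distrib power_inverse)
    then have "u powr (1/2) * (inverse (u + v))\<^sup>2 \<le> u powr (1/2) * (u powr (-5/4) * v powr (-3/4))"
      by (intro mult_left_mono) auto
    also have "\<dots> = u powr (1/2 + -5/4) * v powr (-3/4)"
      by (simp only: powr_add mult.assoc)
    finally show ?thesis
      using that by (simp add: powr_half_sqrt)
  qed
  have "(inverse t)\<^sup>2 \<le> (inverse (c * (a + b)))\<^sup>2"
    using inv t by (intro power_mono) auto
  then have "(sqrt a + sqrt b) * (inverse t)\<^sup>2 \<le> (sqrt a + sqrt b) * (inverse (c * (a + b)))\<^sup>2"
    using assms by (intro mult_left_mono) auto
  also have "\<dots> = (1/c\<^sup>2) * (sqrt a * (inverse (a + b))\<^sup>2 + sqrt b * (inverse (b + a))\<^sup>2)"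
  proof -
    have "(inverse (c * (a + b)))\<^sup>2 = (1/c\<^sup>2) * (inverse (a + b))\<^sup>2"
      by (simp add: power_mult_distrib inverse_mult_distrib power_one_over inverse_eq_divide)
    then show ?thesis
      by (simp only: add.commute[of b a]) (simp add: algebra_simps add_divide_distrib)
  qed
  also have "\<dots> \<le> (1/c\<^sup>2) * (a powr (-3/4) * b powr (-3/4) + b powr (-3/4) * a powr (-3/4))"
    using assms by (intro mult_left_mono add_mono one) auto
  finally show "(sqrt a + sqrt b) * (inverse t)\<^sup>2 \<le> (2/c\<^sup>2) * (a powr (-3/4) * b powr (-3/4))"
    by (simp add: mult.commute)
qed

lemma zak_quot_bounds:
  obtains K where "K > 0"
    "\<And>f p. f \<in> W0 \<Longrightarrow> off_singular p \<Longrightarrow> norm (zak_quot f p) \<le> K * enn2real (W_norm f) * power_weight (1/2) p"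
    "\<And>f p. f \<in> W0 \<Longrightarrow> off_singular p \<Longrightarrow> sing_weight p * (norm (zak_quot f p))\<^sup>2 \<le> K * (enn2real (W_norm f))\<^sup>2 * power_weight (3/4) p"
    "\<And>p. off_singular p \<Longrightarrow> theta_left p \<noteq> 0 \<and> theta_right p \<noteq> 0"
proof -
  obtain c where c: "c > 0"
    "\<And>x y. x \<in> {0..1} \<Longrightarrow> y \<in> {0..1} \<Longrightarrow> c * (\<bar>x - 1/2\<bar> + \<bar>y - 1/2\<bar>) \<le> norm (theta x y)"
    using theta_bounds by metis
  define K where "K = max ((1/c) * (1/c)) ((2/c\<^sup>2) * (2/c\<^sup>2))"
  have K: "K > 0" "(1/c) * (1/c) \<le> K" "(2/c\<^sup>2) * (2/c\<^sup>2) \<le> K"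
    using c(1) by (auto simp: K_def less_max_iff_disj)
  show thesis
  proof (rule that[OF K(1)])
    fix p assume gen: "off_singular p"
    obtain x1 x2 y1 y2 where p: "p = ((x1, x2), (y1, y2))"
      by (metis surj_pair)
    let ?d = "\<lambda>x. \<bar>x - 1/2\<bar>"
    have mem: "x1 \<in> {0..1}" "x2 \<in> {0..1}" "y1 \<in> {0..1}" "y2 \<in> {0..1}"
      and pos: "?d x1 > 0" "?d x2 > 0" "?d y1 > 0" "?d y2 > 0"
      using gen by (auto simp: off_singular_def offcentre_def p)
    have t: "c * (?d x1 + ?d y1) \<le> norm (theta_left p)" "c * (?d x2 + ?d y2) \<le> norm (theta_right p)"
      using c(2) mem by (auto simp: theta_left_def theta_right_def p)
    moreover have "0 < c * (?d x1 + ?d y1)" "0 < c * (?d x2 + ?d y2)"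
      using c(1) pos by (auto intro!: mult_pos_pos)
    ultimately have "norm (theta_left p) > 0" "norm (theta_right p) > 0"
      by linarith+
    then show "theta_left p \<noteq> 0 \<and> theta_right p \<noteq> 0"
      by auto
    fix f assume f: "f \<in> W0"
    let ?W = "enn2real (W_norm f)"
    have Fn: "norm (zak_quot f p) = (inverse (norm (theta_left p)) * inverse (norm (theta_right p))) * norm (zak_cut f p)"
      by (simp add: zak_quot_def norm_inverse)
    have "norm (zak_quot f p) \<le> (((1/c) * (?d x1 powr (-1/2) * ?d y1 powr (-1/2))) * ((1/c) * (?d x2 powr (-1/2) * ?d y2 powr (-1/2)))) * ?W"
      unfolding Fn by (intro mult_mono theta_pair_ineqs norm_zak_cut_le f pos c(1) t) (use c(1) in auto)
    also have "\<dots> = ((1/c) * (1/c)) * (?W * power_weight (1/2) p)"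
      by (simp add: power_weight_def p)
    also have "\<dots> \<le> K * (?W * power_weight (1/2) p)"
      by (intro mult_right_mono K) (simp add: power_weight_nonneg)
    finally show "norm (zak_quot f p) \<le> K * ?W * power_weight (1/2) p"
      by (simp add: mult.assoc)
    have "sing_weight p * (norm (zak_quot f p))\<^sup>2
        = (((sqrt (?d x1) + sqrt (?d y1)) * (inverse (norm (theta_left p)))\<^sup>2) * ((sqrt (?d x2) + sqrt (?d y2)) * (inverse (norm (theta_right p)))\<^sup>2))
          * (norm (zak_cut f p))\<^sup>2"
      unfolding Fn by (simp add: sing_weight_def p power_mult_distrib)
    also have "\<dots> \<le> (((2/c\<^sup>2) * (?d x1 powr (-3/4) * ?d y1 powr (-3/4))) * ((2/c\<^sup>2) * (?d x2 powr (-3/4) * ?d y2 powr (-3/4)))) * ?W\<^sup>2"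
      by (intro mult_mono theta_pair_ineqs power_mono norm_zak_cut_le f pos c(1) t) auto
    also have "\<dots> = ((2/c\<^sup>2) * (2/c\<^sup>2)) * (?W\<^sup>2 * power_weight (3/4) p)"
      by (simp add: power_weight_def p)
    also have "\<dots> \<le> K * (?W\<^sup>2 * power_weight (3/4) p)"
      by (intro mult_right_mono K) (simp add: power_weight_nonneg)
    finally show "sing_weight p * (norm (zak_quot f p))\<^sup>2 \<le> K * ?W\<^sup>2 * power_weight (3/4) p"
      by (simp add: mult.assoc)
  qed
qed

lemma zak_quot_integrable:
  obtains K where "\<And>f. f \<in> W0 \<Longrightarrow> integrable cube_lebesgue (zak_quot f)"
    "\<And>f. f \<in> W0 \<Longrightarrow> (\<integral>p. norm (zak_quot f p) \<partial>cube_lebesgue) \<le> K * enn2real (W_norm f)"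
proof -
  obtain K where K: "K > 0"
    "\<And>f p. f \<in> W0 \<Longrightarrow> off_singular p \<Longrightarrow> norm (zak_quot f p) \<le> K * enn2real (W_norm f) * power_weight (1/2) p"
    using zak_quot_bounds by metis
  have wint: "integrable cube_lebesgue (power_weight (1/2))"
    using nn_integral_power_weight[of "1/2"] by (intro integrableI_bounded) (auto simp: power_weight_nonneg)
  have bint: "integrable cube_lebesgue (\<lambda>p. K * enn2real (W_norm f) * power_weight (1/2) p)" for f
    using wint by simp
  have Fint: "integrable cube_lebesgue (zak_quot f)" if f: "f \<in> W0" for f
  proof (rule Bochner_Integration.integrable_bound[OF bint[of f]])
    show "AE p in cube_lebesgue. norm (zak_quot f p) \<le> norm (K * enn2real (W_norm f) * power_weight (1/2) p)"
      using AE_off_singular by eventually_elim (use K(2)[OF f] abs_ge_self order_trans in fastforce)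
  qed (rule zak_quot_measurable[OF f])
  show thesis
  proof (rule that)
    fix f assume f: "f \<in> W0"
    show "integrable cube_lebesgue (zak_quot f)" by (rule Fint[OF f])
    have "(\<integral>p. norm (zak_quot f p) \<partial>cube_lebesgue) \<le> (\<integral>p. K * enn2real (W_norm f) * power_weight (1/2) p \<partial>cube_lebesgue)"
    proof (rule integral_mono_AE)
      show "AE p in cube_lebesgue. norm (zak_quot f p) \<le> K * enn2real (W_norm f) * power_weight (1/2) p"
        using AE_off_singular by eventually_elim (rule K(2)[OF f])
    qed (use Fint[OF f] bint in auto)
    then show "(\<integral>p. norm (zak_quot f p) \<partial>cube_lebesgue) \<le> (K * (\<integral>p. power_weight (1/2) p \<partial>cube_lebesgue)) * enn2real (W_norm f)"
      by (simp add: ac_simps)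
  qed
qed

lemma zak_quot_weighted_L2:
  assumes f: "f \<in> W0"
  shows "energy sing_weight (zak_quot f) < \<infinity>"
proof -
  obtain K where K: "K > 0"
    "\<And>f p. f \<in> W0 \<Longrightarrow> off_singular p \<Longrightarrow> sing_weight p * (norm (zak_quot f p))\<^sup>2 \<le> K * (enn2real (W_norm f))\<^sup>2 * power_weight (3/4) p"
    using zak_quot_bounds by metis
  have "energy sing_weight (zak_quot f)
      \<le> (\<integral>\<^sup>+p. ennreal (K * (enn2real (W_norm f))\<^sup>2) * ennreal (power_weight (3/4) p) \<partial>cube_lebesgue)"
  proof -
    have "0 \<le> K * (enn2real (W_norm f))\<^sup>2"
      using K(1) by simp
    note ennreal_mult[OF this power_weight_nonneg]
    then have "ennreal (sing_weight p * (norm (zak_quot f p))\<^sup>2)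
        \<le> ennreal (K * (enn2real (W_norm f))\<^sup>2) * ennreal (power_weight (3/4) p)" if "off_singular p" for p
      using ennreal_leI[OF K(2)[OF f that]] by (simp only:)
    then show ?thesis
      using AE_off_singular by (intro nn_integral_mono_AE) (auto elim!: eventually_mono simp del: split_paired_All)
  qed
  also have "\<dots> = ennreal (K * (enn2real (W_norm f))\<^sup>2) * (\<integral>\<^sup>+p. ennreal (power_weight (3/4) p) \<partial>cube_lebesgue)"
    by (rule nn_integral_cmult) measurable
  also have "\<dots> < \<infinity>"
    using nn_integral_power_weight[of "3/4"] by (simp add: ennreal_mult_less_top)
  finally show ?thesis .
qed

text \<open>
  A continuous substitute for \<open>inverse z\<close> that never exceeds it in norm and tends to it as \<open>n\<close> grows.
\<close>

definition reg_inv :: "nat \<Rightarrow> complex \<Rightarrow> complex" where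
  "reg_inv n z = cnj z / of_real ((norm z)\<^sup>2 + 1 / real (Suc n))"

lemma reg_inv_den: "(norm z)\<^sup>2 + 1 / real (Suc n) > 0" for z :: complex
  by (simp add: add_nonneg_pos)

lemma continuous_on_reg_inv [continuous_intros]:
  "continuous_on S f \<Longrightarrow> continuous_on S (\<lambda>x. reg_inv n (f x))"
  unfolding reg_inv_def
proof (intro continuous_intros ballI)
  show "of_real ((norm (f x))\<^sup>2 + 1 / real (Suc n)) \<noteq> (0::complex)" for x
    using reg_inv_den[of "f x" n] unfolding of_real_eq_0_iff by linarith
qed

lemma reg_inv_measurable [measurable]: "reg_inv n \<in> borel_measurable borel"
  by (intro borel_measurable_continuous_onI continuous_intros)

lemma norm_reg_inv_le:
  assumes "z \<noteq> 0"
  shows "norm (reg_inv n z) \<le> norm (inverse z)"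
proof -
  have "norm (reg_inv n z) = norm z / ((norm z)\<^sup>2 + 1 / real (Suc n))"
    unfolding reg_inv_def norm_divide norm_of_real complex_mod_cnj using reg_inv_den[of z n] by simp
  also have "\<dots> \<le> norm z / (norm z)\<^sup>2"
    using assms by (intro divide_left_mono mult_pos_pos add_nonneg_pos) auto
  also have "\<dots> = norm (inverse z)"
    unfolding norm_inverse using assms by (simp add: power2_eq_square inverse_eq_divide)
  finally show ?thesis .
qed

lemma reg_inv_tendsto:
  assumes "z \<noteq> 0"
  shows "(\<lambda>n. reg_inv n z) \<longlonglongrightarrow> inverse z"
proof -
  have "(\<lambda>n. (norm z)\<^sup>2 + 1 / real (Suc n)) \<longlonglongrightarrow> (norm z)\<^sup>2 + 0"
    using LIMSEQ_inverse_real_of_nat by (intro tendsto_add tendsto_const) (simp add: inverse_eq_divide)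
  then have "(\<lambda>n. reg_inv n z) \<longlonglongrightarrow> cnj z / of_real ((norm z)\<^sup>2 + 0)"
    unfolding reg_inv_def using assms by (intro tendsto_divide tendsto_const tendsto_of_real) auto
  moreover have "cnj z / of_real ((norm z)\<^sup>2 + 0) = inverse z"
  proof -
    have "of_real ((norm z)\<^sup>2 + 0) = z * cnj z"
      using complex_norm_square[of z] by simp
    then show ?thesis
      using assms by (simp only:) (simp add: field_simps)
  qed
  ultimately show ?thesis by simp
qed

text \<open>
  A continuous function that vanishes on the boundary of the cube and tends to \<open>1\<close> inside, so that products
  with it extend periodically.
\<close>

definition cutoff :: "nat \<Rightarrow> phase \<Rightarrow> real" where
  "cutoff n p = min 1 (real n * ((fst (fst p) * (1 - fst (fst p))) * (snd (fst p) * (1 - snd (fst p))) *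
     ((fst (snd p) * (1 - fst (snd p))) * (snd (snd p) * (1 - snd (snd p))))))"

lemma cutoff_off_singular:
  assumes "off_singular p"
  shows "0 \<le> cutoff n p" "cutoff n p \<le> 1" "(\<lambda>n. cutoff n p) \<longlonglongrightarrow> 1"
proof -
  let ?r = "(fst (fst p) * (1 - fst (fst p))) * (snd (fst p) * (1 - snd (fst p))) *
     ((fst (snd p) * (1 - fst (snd p))) * (snd (snd p) * (1 - snd (snd p))))"
  have r: "?r > 0"
    using assms by (auto simp: off_singular_def offcentre_def intro!: mult_pos_pos)
  then show "0 \<le> cutoff n p" "cutoff n p \<le> 1"
    by (auto simp: cutoff_def)
  obtain N where N: "1 \<le> real N * ?r"
    using reals_Archimedean3[OF r, rule_format, of 1] by (auto intro: less_imp_le)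
  have "cutoff n p = 1" if "n \<ge> N" for n
  proof -
    have "real N * ?r \<le> real n * ?r"
      using that r by (intro mult_right_mono) auto
    with N show ?thesis
      unfolding cutoff_def by simp
  qed
  then have "\<forall>\<^sub>F n in sequentially. cutoff n p = 1"
    using eventually_sequentially by blast
  then show "(\<lambda>n. cutoff n p) \<longlonglongrightarrow> 1"
    by (rule tendsto_eventually)
qed

lemma cutoff_measurable [measurable]: "cutoff n \<in> borel_measurable cube_lebesgue"
  unfolding cutoff_def[abs_def] by measurable

lemma trig_poly_measurable: "P \<in> cube.trig_polys \<Longrightarrow> P \<in> borel_measurable cube_lebesgue"
  by (auto simp: cube.trig_polys_def)

lemma sing_weight_le: "p \<in> unit_cube \<Longrightarrow> sing_weight p \<le> 4"
proof -
  assume p: "p \<in> unit_cube"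
  have one: "sqrt \<bar>x - 1/2\<bar> \<le> 1" if "x \<in> {0..1}" for x :: real
    using that by (auto simp: abs_le_iff)
  have "sqrt \<bar>x - 1/2\<bar> + sqrt \<bar>y - 1/2\<bar> \<le> 2" if "x \<in> {0..1}" "y \<in> {0..1}" for x y :: real
    using one[OF that(1)] one[OF that(2)] by linarith
  then have "(sqrt \<bar>x - 1/2\<bar> + sqrt \<bar>y - 1/2\<bar>) * (sqrt \<bar>x' - 1/2\<bar> + sqrt \<bar>y' - 1/2\<bar>) \<le> 2 * 2"
    if "x \<in> {0..1}" "y \<in> {0..1}" "x' \<in> {0..1}" "y' \<in> {0..1}" for x y x' y' :: real
    using that by (intro mult_mono) auto
  with p show ?thesis
    by (auto simp: sing_weight_def unit_cube_def unit_square_def)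
qed

text \<open>
  Regularised inverses and cutoffs turn the quotient into functions that are continuous on the cube and
  vanish on its boundary. They are dominated by the quotient, which has finite weighted energy, so they
  converge to it in the weighted norm; trigonometric polynomials approximate them uniformly, and
  the weight is bounded.
\<close>

lemma zak_quot_trig_approx:
  assumes f: "f \<in> W0" and "\<epsilon> > 0"
  obtains P where "P \<in> cube.trig_polys"
    "energy sing_weight (\<lambda>p. zak_quot f p - P p) \<le> ennreal \<epsilon>"
proof -
  note [measurable] = zak_cut_measurable[OF f] zak_quot_measurable[OF f]
  define G where "G n p = cutoff n p *\<^sub>R bimult (reg_inv n (theta_left p)) (reg_inv n (theta_right p)) (zak_cut f p)" for n p
  have Gm [measurable]: "G n \<in> borel_measurable cube_lebesgue" for n
    unfolding G_def[abs_def] by measurable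
  have th: "theta_left p \<noteq> 0" "theta_right p \<noteq> 0" if "off_singular p" for p
    using zak_quot_bounds that by metis+
  have Gle: "norm (G n p) \<le> norm (zak_quot f p)" if "off_singular p" for n p
  proof -
    have "norm (G n p) = cutoff n p * (norm (reg_inv n (theta_left p)) * norm (reg_inv n (theta_right p)) * norm (zak_cut f p))"
      using cutoff_off_singular(1)[OF that] by (simp add: G_def)
    also have "\<dots> \<le> 1 * (norm (inverse (theta_left p)) * norm (inverse (theta_right p)) * norm (zak_cut f p))"
      by (intro mult_mono norm_reg_inv_le th that cutoff_off_singular) auto
    finally show ?thesis
      by (simp add: zak_quot_def)
  qed
  have Glim: "(\<lambda>n. G n p) \<longlonglongrightarrow> zak_quot f p" if "off_singular p" for p
  proof -
    have "(\<lambda>n. bimult (reg_inv n (theta_left p)) (reg_inv n (theta_right p)) (zak_cut f p)) \<longlonglongrightarrow> zak_quot f p"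
      unfolding bimult_def zak_quot_def
      by (intro tendsto_mult tendsto_const bounded_linear.tendsto[OF bounded_linear_emb(1)]
          bounded_linear.tendsto[OF bounded_linear_emb(2)] reg_inv_tendsto th that)
    from tendsto_scaleR[OF cutoff_off_singular(3)[OF that] this] show ?thesis
      by (simp add: G_def)
  qed
  have "(\<lambda>n. \<integral>\<^sup>+p. ennreal (sing_weight p * (norm (zak_quot f p - G n p))\<^sup>2) \<partial>cube_lebesgue) \<longlonglongrightarrow> (\<integral>\<^sup>+p. 0 \<partial>cube_lebesgue)"
  proof (rule nn_integral_dominated_convergence[where w = "\<lambda>p. 4 * ennreal (sing_weight p * (norm (zak_quot f p))\<^sup>2)"])
    fix n
    show "AE p in cube_lebesgue. ennreal (sing_weight p * (norm (zak_quot f p - G n p))\<^sup>2) \<le> 4 * ennreal (sing_weight p * (norm (zak_quot f p))\<^sup>2)"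
      using AE_off_singular
    proof eventually_elim
      case (elim p)
      have "norm (zak_quot f p - G n p) \<le> 2 * norm (zak_quot f p)"
        using norm_triangle_ineq4[of "zak_quot f p" "G n p"] Gle[OF elim, of n] by linarith
      then have "(norm (zak_quot f p - G n p))\<^sup>2 \<le> (2 * norm (zak_quot f p))\<^sup>2"
        by (intro power_mono) auto
      then have "sing_weight p * (norm (zak_quot f p - G n p))\<^sup>2 \<le> sing_weight p * (4 * (norm (zak_quot f p))\<^sup>2)"
        by (intro mult_left_mono sing_weight_nonneg) (simp add: power_mult_distrib)
      then have "ennreal (sing_weight p * (norm (zak_quot f p - G n p))\<^sup>2) \<le> ennreal (4 * (sing_weight p * (norm (zak_quot f p))\<^sup>2))"
        by (intro ennreal_leI) (simp add: ac_simps)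
      then show ?case
        by (simp add: ennreal_mult sing_weight_nonneg)
    qed
  next
    show "(\<integral>\<^sup>+p. 4 * ennreal (sing_weight p * (norm (zak_quot f p))\<^sup>2) \<partial>cube_lebesgue) < \<infinity>"
      using zak_quot_weighted_L2[OF f] by (subst nn_integral_cmult) (auto simp: ennreal_mult_less_top)
    show "AE p in cube_lebesgue. (\<lambda>n. ennreal (sing_weight p * (norm (zak_quot f p - G n p))\<^sup>2)) \<longlonglongrightarrow> 0"
      using AE_off_singular
    proof eventually_elim
      case (elim p)
      have "(\<lambda>n. sing_weight p * (norm (zak_quot f p - G n p))\<^sup>2) \<longlonglongrightarrow> sing_weight p * (norm (zak_quot f p - zak_quot f p))\<^sup>2"
        by (intro tendsto_intros Glim elim)
      from tendsto_ennrealI[OF this] show ?case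
        by simp
    qed
  qed measurable
  then have "\<forall>\<^sub>F n in sequentially. energy sing_weight (\<lambda>p. zak_quot f p - G n p) < ennreal (\<epsilon>/4)"
    using \<open>\<epsilon> > 0\<close> by (intro order_tendstoD) auto
  then obtain n where n: "energy sing_weight (\<lambda>p. zak_quot f p - G n p) < ennreal (\<epsilon>/4)"
    using eventually_happens'[OF sequentially_bot] by blast
  have "continuous_on unit_cube (G n)"
  proof -
    have z: "continuous_on unit_cube (zak_refl f)"
      by (rule continuous_on_subset[OF zak_refl_continuous[OF f]]) (auto simp: unit_cube_def)
    have "continuous_on unit_cube (\<lambda>p. cutoff n p *\<^sub>R bimult (reg_inv n (theta_left p)) (reg_inv n (theta_right p)) (zak_refl f p))"
      unfolding cutoff_def by (intro continuous_intros z)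
    then show ?thesis
      by (rule continuous_on_eq) (auto simp: G_def zak_cut_def unit_cube_def mem_Times_iff)
  qed
  moreover have "G n p = 0"
    if "p \<in> unit_cube" "{fst (fst p), snd (fst p), fst (snd p), snd (snd p)} \<inter> {0, 1} \<noteq> {}" for p
  proof -
    have "cutoff n p = 0"
      using that(2) by (auto simp: cutoff_def)
    then show ?thesis by (simp add: G_def)
  qed
  moreover have "sqrt (\<epsilon>/16) > 0"
    using \<open>\<epsilon> > 0\<close> by simp
  ultimately obtain P where P: "P \<in> cube.trig_polys" "\<And>p. p \<in> unit_cube \<Longrightarrow> norm (G n p - P p) < sqrt (\<epsilon>/16)"
    using trig_poly_approx by metis
  have [measurable]: "P \<in> borel_measurable cube_lebesgue"
    by (rule trig_poly_measurable[OF P(1)])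
  have "energy sing_weight (\<lambda>p. zak_quot f p - P p)
      \<le> (\<integral>\<^sup>+p. 2 * ennreal (sing_weight p * (norm (zak_quot f p - G n p))\<^sup>2) + ennreal (\<epsilon>/2) \<partial>cube_lebesgue)"
  proof (rule nn_integral_mono_AE)
    show "AE p in cube_lebesgue. ennreal (sing_weight p * (norm (zak_quot f p - P p))\<^sup>2)
        \<le> 2 * ennreal (sing_weight p * (norm (zak_quot f p - G n p))\<^sup>2) + ennreal (\<epsilon>/2)"
      using AE_off_singular
    proof eventually_elim
      case (elim p)
      then have pc: "p \<in> unit_cube"
        by (auto simp: off_singular_def offcentre_def unit_cube_def unit_square_def mem_Times_iff)
      let ?a = "norm (zak_quot f p - G n p)" and ?b = "norm (G n p - P p)"
      have "norm (zak_quot f p - P p) \<le> ?a + ?b"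
        using norm_triangle_ineq[of "zak_quot f p - G n p" "G n p - P p"] by simp
      then have "(norm (zak_quot f p - P p))\<^sup>2 \<le> (?a + ?b)\<^sup>2"
        by (intro power_mono) auto
      also have "\<dots> \<le> 2 * ?a\<^sup>2 + 2 * ?b\<^sup>2"
        using zero_le_power2[of "?a - ?b"] by (simp add: power2_eq_square algebra_simps)
      finally have "sing_weight p * (norm (zak_quot f p - P p))\<^sup>2 \<le> sing_weight p * (2 * ?a\<^sup>2 + 2 * ?b\<^sup>2)"
        by (intro mult_left_mono sing_weight_nonneg)
      also have "\<dots> = 2 * (sing_weight p * ?a\<^sup>2) + sing_weight p * (2 * ?b\<^sup>2)"
        by (simp add: algebra_simps)
      also have "sing_weight p * (2 * ?b\<^sup>2) \<le> 4 * (2 * (sqrt (\<epsilon>/16))\<^sup>2)"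
        using P(2)[OF pc] by (intro mult_mono sing_weight_le pc power_mono) auto
      also have "4 * (2 * (sqrt (\<epsilon>/16))\<^sup>2) = \<epsilon>/2"
        using \<open>\<epsilon> > 0\<close> by simp
      finally have "ennreal (sing_weight p * (norm (zak_quot f p - P p))\<^sup>2) \<le> ennreal (2 * (sing_weight p * ?a\<^sup>2) + \<epsilon>/2)"
        by (intro ennreal_leI) simp
      then show ?case
        using \<open>\<epsilon> > 0\<close> by (simp add: ennreal_mult sing_weight_nonneg)
    qed
  qed
  also have "\<dots> = 2 * energy sing_weight (\<lambda>p. zak_quot f p - G n p) + ennreal (\<epsilon>/2)"
    by (subst nn_integral_add) (auto simp: nn_integral_cmult cube.emeasure_space_1)
  also have "\<dots> \<le> 2 * ennreal (\<epsilon>/4) + ennreal (\<epsilon>/2)"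
    using n by (intro add_mono mult_left_mono) auto
  also have "\<dots> = ennreal \<epsilon>"
  proof -
    have "2 * ennreal (\<epsilon>/4) = ennreal (2 * (\<epsilon>/4))"
      using \<open>\<epsilon> > 0\<close> by (subst ennreal_mult) auto
    then show ?thesis
      using \<open>\<epsilon> > 0\<close> by (simp flip: ennreal_plus)
  qed
  finally show thesis
    using that P(1) by blast
qed

section \<open>Gabor coefficients and convergence\<close>

text \<open>
  The index consists of frequency and position, in this order, matching \<open>lattice_point\<close>.
\<close>

definition gabor_coef :: "index \<Rightarrow> (real^2 \<Rightarrow> quat) \<Rightarrow> quat" where
  "gabor_coef n f = coef cube_lebesgue lchar4 rchar4 (zak_quot f) n"

definition lattice_point :: "index \<Rightarrow> (real^2) \<times> (real^2)" where
  "lattice_point n = (int_point (snd n), int_point (fst n))"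

lemma inj_lattice_point: "inj lattice_point"
  using inj_int_point by (auto simp: inj_on_def lattice_point_def prod_eq_iff)

lemma range_lattice_point: "range lattice_point = lattice"
proof -
  have "(int_point b, int_point k) \<in> range lattice_point" for b k
    by (rule range_eqI[of _ _ "(k, b)"]) (simp add: lattice_point_def)
  then show ?thesis
    unfolding lattice_def range_int_point[symmetric] by (auto simp: lattice_point_def)
qed

lemma zak_quot_add: "f \<in> W0 \<Longrightarrow> g \<in> W0 \<Longrightarrow> zak_quot (\<lambda>x. f x + g x) = (\<lambda>p. zak_quot f p + zak_quot g p)"
  by (auto simp: zak_quot_def zak_cut_add bimult_add)

lemma zak_quot_scaleR: "zak_quot (\<lambda>x. r *\<^sub>R f x) = (\<lambda>p. r *\<^sub>R zak_quot f p)"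
  by (auto simp: zak_quot_def zak_cut_scaleR bimult_scaleR)

lemma integrable_zak_quot: "f \<in> W0 \<Longrightarrow> integrable cube_lebesgue (zak_quot f)"
  using zak_quot_integrable by blast

lemma gabor_coef_add: "f \<in> W0 \<Longrightarrow> g \<in> W0 \<Longrightarrow> gabor_coef n (\<lambda>x. f x + g x) = gabor_coef n f + gabor_coef n g"
  by (simp add: gabor_coef_def zak_quot_add cube.coef_add[OF integrable_zak_quot integrable_zak_quot])

lemma gabor_coef_scaleR: "gabor_coef n (\<lambda>x. r *\<^sub>R f x) = r *\<^sub>R gabor_coef n f"
  by (simp add: gabor_coef_def zak_quot_scaleR coef_def bimult_scaleR)

lemma gabor_coef_bound:
  obtains K where "\<And>n f. f \<in> W0 \<Longrightarrow> norm (gabor_coef n f) \<le> K * enn2real (W_norm f)"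
proof -
  obtain K where K: "\<And>f. f \<in> W0 \<Longrightarrow> integrable cube_lebesgue (zak_quot f)"
    "\<And>f. f \<in> W0 \<Longrightarrow> (\<integral>p. norm (zak_quot f p) \<partial>cube_lebesgue) \<le> K * enn2real (W_norm f)"
    using zak_quot_integrable by metis
  show thesis
    by (rule that[of K]) (auto simp: gabor_coef_def intro: order_trans[OF cube.norm_coef_le[OF K(1)] K(2)])
qed

lemma continuous_functional_W0I:
  assumes add: "\<And>f g. f \<in> W0 \<Longrightarrow> g \<in> W0 \<Longrightarrow> T (\<lambda>x. f x + g x) = T f + T g"
    and scale: "\<And>r f. f \<in> W0 \<Longrightarrow> T (\<lambda>x. r *\<^sub>R f x) = r *\<^sub>R T f"
    and bound: "\<And>f. f \<in> W0 \<Longrightarrow> norm (T f) \<le> K * enn2real (W_norm f)"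
  shows "continuous_functional_W0 T"
  unfolding continuous_functional_W0_def
proof (intro conjI ballI allI impI)
  fix f and \<epsilon> :: real assume f: "f \<in> W0" and "\<epsilon> > 0"
  define \<delta> where "\<delta> = \<epsilon> / (\<bar>K\<bar> + 1)"
  have "\<delta> > 0"
    using \<open>\<epsilon> > 0\<close> by (simp add: \<delta>_def add_nonneg_pos)
  moreover have "norm (T g - T f) < \<epsilon>" if g: "g \<in> W0" and lt: "W_norm (\<lambda>x. g x - f x) < ennreal \<delta>" for g
  proof -
    have "T (\<lambda>x. g x - f x) = T g - T f"
      using add[OF g W0_scaleR[OF f, of "-1"]] scale[OF f, of "-1"] by simp
    then have "norm (T g - T f) \<le> K * enn2real (W_norm (\<lambda>x. g x - f x))"
      using bound[OF W0_diff[OF g f]] by simp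
    also have "\<dots> \<le> (\<bar>K\<bar> + 1) * enn2real (W_norm (\<lambda>x. g x - f x))"
      by (intro mult_right_mono) auto
    also have "enn2real (W_norm (\<lambda>x. g x - f x)) < \<delta>"
    proof -
      have "W_norm (\<lambda>x. g x - f x) = ennreal (enn2real (W_norm (\<lambda>x. g x - f x)))"
        using lt by (intro ennreal_enn2real[symmetric]) (auto simp: less_top[symmetric])
      with lt show ?thesis
        by (metis enn2real_nonneg ennreal_less_iff)
    qed
    then have "(\<bar>K\<bar> + 1) * enn2real (W_norm (\<lambda>x. g x - f x)) < (\<bar>K\<bar> + 1) * \<delta>"
      by (intro mult_strict_left_mono) auto
    also have "\<dots> = \<epsilon>"
      by (simp add: \<delta>_def add_nonneg_eq_0_iff)
    finally show ?thesis by simp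
  qed
  ultimately show "\<exists>\<delta>>0. \<forall>g\<in>W0. W_norm (\<lambda>x. g x - f x) < ennreal \<delta> \<longrightarrow> norm (T g - T f) < \<epsilon>"
    by blast
qed (use add scale in auto)

lemma sharp_poisson_eq:
  "sharp_poisson f = inverse (quat_i * of_real theta0) * zak_refl f ((1/2, 1/2), (- (1/2), - (1/2))) * inverse (quat_j * of_real theta0)"
proof -
  have sharp: "sharp = (plane_point (1/2, 1/2), plane_point (1/2, 1/2))"
    by (simp add: sharp_def vec2_eq_iff)
  have "zak f sharp = zak_refl f ((1/2, 1/2), (- (1/2), - (1/2)))"
    using zak_eq_zak_refl[of f "(1/2, 1/2)" "(- (1/2), - (1/2))"] by (simp add: sharp)
  then show ?thesis
    by (simp add: sharp_poisson_def)
qed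

lemma sharp_poisson_props:
  shows "f \<in> W0 \<Longrightarrow> g \<in> W0 \<Longrightarrow> sharp_poisson (\<lambda>x. f x + g x) = sharp_poisson f + sharp_poisson g"
    and "sharp_poisson (\<lambda>x. r *\<^sub>R f x) = r *\<^sub>R sharp_poisson f"
    and "f \<in> W0 \<Longrightarrow> norm (sharp_poisson f) \<le>
      norm (inverse (quat_i * of_real theta0)) * norm (inverse (quat_j * of_real theta0)) * enn2real (W_norm f)"
proof -
  have half: "(1/2, 1/2) \<in> unit_square"
    by (simp add: unit_square_def)
  show "f \<in> W0 \<Longrightarrow> g \<in> W0 \<Longrightarrow> sharp_poisson (\<lambda>x. f x + g x) = sharp_poisson f + sharp_poisson g"
    by (simp add: sharp_poisson_eq zak_refl_add half distrib_left distrib_right)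
  show "sharp_poisson (\<lambda>x. r *\<^sub>R f x) = r *\<^sub>R sharp_poisson f"
    by (simp add: sharp_poisson_eq zak_refl_scaleR)
  assume f: "f \<in> W0"
  have "norm (sharp_poisson f) = (norm (inverse (quat_i * of_real theta0)) * norm (inverse (quat_j * of_real theta0)))
      * norm (zak_refl f ((1/2, 1/2), (- (1/2), - (1/2))))"
    unfolding sharp_poisson_eq norm_mult by (simp only: ac_simps)
  also have "\<dots> \<le> (norm (inverse (quat_i * of_real theta0)) * norm (inverse (quat_j * of_real theta0))) * enn2real (W_norm f)"
    by (intro mult_left_mono norm_zak_refl_le f half) auto
  finally show "norm (sharp_poisson f) \<le>
      norm (inverse (quat_i * of_real theta0)) * norm (inverse (quat_j * of_real theta0)) * enn2real (W_norm f)" .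
qed

text \<open>
  What is left to expand over the lattice once the term at the sharp point has been split off.
\<close>

definition residual :: "(real^2 \<Rightarrow> quat) \<Rightarrow> real^2 \<Rightarrow> quat" where
  "residual f x = f x - gabor_term (sharp_poisson f) sharp x"

lemma residual_W0: "f \<in> W0 \<Longrightarrow> residual f \<in> W0"
  unfolding residual_def[abs_def] by (intro W0_diff gabor_term_W0)

text \<open>
  The coefficient of the fixed atom at the sharp point is a linear function of its quaternion factor,
  hence bounded, and the sharp Poisson functional is bounded on \<open>W0\<close>.
\<close>

lemma continuous_functional_gabor_coef_residual: "continuous_functional_W0 (\<lambda>f. gabor_coef n (residual f))"
proof -
  obtain K where K: "\<And>n f. f \<in> W0 \<Longrightarrow> norm (gabor_coef n f) \<le> K * enn2real (W_norm f)"
    using gabor_coef_bound by blast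
  define h where "h q = gabor_coef n (gabor_term q sharp)" for q
  have "linear h"
  proof
    show "h (p + q) = h p + h q" for p q
    proof -
      have "gabor_term (p + q) sharp = (\<lambda>x. gabor_term p sharp x + gabor_term q sharp x)"
        by (auto simp: gabor_term_add)
      then show ?thesis
        by (simp add: h_def gabor_coef_add gabor_term_W0)
    qed
    show "h (r *\<^sub>R q) = r *\<^sub>R h q" for r q
    proof -
      have "gabor_term (r *\<^sub>R q) sharp = (\<lambda>x. r *\<^sub>R gabor_term q sharp x)"
        by (auto simp: gabor_term_scaleR)
      then show ?thesis
        by (simp add: h_def gabor_coef_scaleR)
    qed
  qed
  then have hb: "bounded_linear h"
    by (simp add: linear_conv_bounded_linear)
  then obtain B where B: "B \<ge> 0" "\<And>q. norm (h q) \<le> norm q * B"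
    using bounded_linear.nonneg_bounded by blast
  have split: "gabor_coef n (residual f) = gabor_coef n f - h (sharp_poisson f)" if f: "f \<in> W0" for f
  proof -
    have "gabor_coef n (\<lambda>x. residual f x + gabor_term (sharp_poisson f) sharp x) = gabor_coef n (residual f) + h (sharp_poisson f)"
      unfolding h_def by (intro gabor_coef_add residual_W0 gabor_term_W0 f)
    then show ?thesis
      by (simp add: residual_def)
  qed
  define S where "S = norm (inverse (quat_i * of_real theta0)) * norm (inverse (quat_j * of_real theta0))"
  show ?thesis
  proof (rule continuous_functional_W0I[where K = "K + S * B"])
    fix f assume f: "f \<in> W0"
    show "gabor_coef n (residual (\<lambda>x. f x + g x)) = gabor_coef n (residual f) + gabor_coef n (residual g)" if g: "g \<in> W0" for g
      using f g by (simp add: split W0_add gabor_coef_add sharp_poisson_props(1) linear_add[OF \<open>linear h\<close>])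
    show "gabor_coef n (residual (\<lambda>x. r *\<^sub>R f x)) = r *\<^sub>R gabor_coef n (residual f)" for r
      using f by (simp add: split W0_scaleR gabor_coef_scaleR sharp_poisson_props(2) linear_cmul[OF \<open>linear h\<close>] scaleR_diff_right)
    have "norm (h (sharp_poisson f)) \<le> (S * enn2real (W_norm f)) * B"
      using B(2)[of "sharp_poisson f"] mult_right_mono[OF sharp_poisson_props(3)[OF f] B(1)] unfolding S_def by linarith
    then have "norm (gabor_coef n f - h (sharp_poisson f)) \<le> K * enn2real (W_norm f) + (S * enn2real (W_norm f)) * B"
      using norm_triangle_ineq4[of "gabor_coef n f" "h (sharp_poisson f)"] K[OF f, of n] by linarith
    then show "norm (gabor_coef n (residual f)) \<le> (K + S * B) * enn2real (W_norm f)"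
      using f by (simp add: split algebra_simps)
  qed
qed

lemma theta_weight_bounds:
  obtains C where "C > 0"
    "\<And>p. p \<in> unit_cube \<Longrightarrow> (norm (theta_left p) * norm (theta_right p))\<^sup>2 \<le> C * edge_weight p"
    "\<And>p. p \<in> unit_cube \<Longrightarrow> (norm (theta_left p) * norm (theta_right p))\<^sup>2 \<le> C * sing_weight p"
proof -
  obtain A where A: "A > 0" "\<And>x y. x \<in> {0..1} \<Longrightarrow> y \<in> {0..1} \<Longrightarrow>
      (norm (theta x y))\<^sup>2 \<le> A * ((norm (1 + cexpt x))\<^sup>2 + (norm (1 + cexpt y))\<^sup>2)"
    using theta_bounds by metis
  have e: "(norm (1 + cexpt x))\<^sup>2 \<le> 4 * pi\<^sup>2 * sqrt \<bar>x - 1/2\<bar>" if "x \<in> {0..1}" for x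
    using that by (intro one_plus_cexpt_sq_le) auto
  define C where "C = max (A * A) ((A * A) * ((4 * pi\<^sup>2) * (4 * pi\<^sup>2)))"
  have C: "C > 0" "A * A \<le> C" "(A * A) * ((4 * pi\<^sup>2) * (4 * pi\<^sup>2)) \<le> C"
    using A(1) by (auto simp: C_def less_max_iff_disj)
  have "(norm (theta_left p) * norm (theta_right p))\<^sup>2 \<le> C * edge_weight p \<and> (norm (theta_left p) * norm (theta_right p))\<^sup>2 \<le> C * sing_weight p"
    if "p \<in> unit_cube" for p
  proof -
    obtain x1 x2 y1 y2 where p: "p = ((x1, x2), (y1, y2))"
      by (metis surj_pair)
    have mem: "x1 \<in> {0..1}" "x2 \<in> {0..1}" "y1 \<in> {0..1}" "y2 \<in> {0..1}"
      using that by (auto simp: unit_cube_def unit_square_def p)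
    let ?e = "\<lambda>x. (norm (1 + cexpt x))\<^sup>2" and ?s = "\<lambda>x. sqrt \<bar>x - 1/2\<bar>"
    have "(norm (theta_left p) * norm (theta_right p))\<^sup>2 = (norm (theta x1 y1))\<^sup>2 * (norm (theta x2 y2))\<^sup>2"
      by (simp add: theta_left_def theta_right_def p power_mult_distrib)
    also have "\<dots> \<le> (A * (?e x1 + ?e y1)) * (A * (?e x2 + ?e y2))"
      by (intro mult_mono A mem) (use A(1) in auto)
    also have "\<dots> = (A * A) * edge_weight p"
      by (simp add: edge_weight_def p)
    finally have 1: "(norm (theta_left p) * norm (theta_right p))\<^sup>2 \<le> (A * A) * edge_weight p" .
    also have "\<dots> \<le> C * edge_weight p"
      by (intro mult_right_mono C edge_weight_nonneg)
    finally have E: "(norm (theta_left p) * norm (theta_right p))\<^sup>2 \<le> C * edge_weight p" .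
    have "edge_weight p = (?e x1 + ?e y1) * (?e x2 + ?e y2)"
      by (simp add: edge_weight_def p)
    also have "\<dots> \<le> (4 * pi\<^sup>2 * ?s x1 + 4 * pi\<^sup>2 * ?s y1) * (4 * pi\<^sup>2 * ?s x2 + 4 * pi\<^sup>2 * ?s y2)"
      by (intro mult_mono add_mono e mem) auto
    also have "\<dots> = ((4 * pi\<^sup>2) * (4 * pi\<^sup>2)) * sing_weight p"
      by (simp add: sing_weight_def p distrib_left[symmetric])
    finally have "(A * A) * edge_weight p \<le> (A * A) * (((4 * pi\<^sup>2) * (4 * pi\<^sup>2)) * sing_weight p)"
      using A(1) by (intro mult_left_mono) auto
    also have "\<dots> = ((A * A) * ((4 * pi\<^sup>2) * (4 * pi\<^sup>2))) * sing_weight p"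
      by (simp only: mult.assoc)
    also have "\<dots> \<le> C * sing_weight p"
      by (rule mult_right_mono[OF C(3) sing_weight_nonneg])
    finally show ?thesis
      using 1 E by linarith
  qed
  then show thesis
    using that[OF C(1)] by blast
qed

lemma off_singular_unit_cube: "off_singular p \<Longrightarrow> p \<in> unit_cube"
  by (auto simp: off_singular_def offcentre_def unit_cube_def unit_square_def mem_Times_iff)

text \<open>
  Compare \<open>F\<close> with a trigonometric polynomial \<open>P\<close> that is close in the weighted norm. If the box contains
  the frequencies of \<open>P\<close>, then \<open>F - S F = (F - P) - S (F - P)\<close>, and the uniform bound for \<open>S\<close> applies to \<open>F - P\<close>.
\<close>

lemma box_sums_converge:
  assumes f: "f \<in> W0" and "\<epsilon> > 0"
  obtains N0 where "finite N0"
    "\<And>N. N \<in> index_boxes \<Longrightarrow> N0 \<subseteq> N \<Longrightarrow>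
      (\<integral>\<^sup>+p. ennreal ((norm (theta_left p) * norm (theta_right p) * norm (zak_quot f p - box_sum N (zak_quot f) p))\<^sup>2) \<partial>cube_lebesgue)
      \<le> ennreal \<epsilon>"
proof -
  obtain C where C: "C > 0"
    "\<And>N G. N \<in> index_boxes \<Longrightarrow> integrable cube_lebesgue G \<Longrightarrow>
      energy edge_weight (box_sum N G)
      \<le> ennreal C * energy sing_weight G"
    using box_partial_sum_bound by blast
  obtain D where D: "D > 0"
    "\<And>p. p \<in> unit_cube \<Longrightarrow> (norm (theta_left p) * norm (theta_right p))\<^sup>2 \<le> D * edge_weight p"
    "\<And>p. p \<in> unit_cube \<Longrightarrow> (norm (theta_left p) * norm (theta_right p))\<^sup>2 \<le> D * sing_weight p"
    using theta_weight_bounds by blast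
  \<comment> \<open>Both \<open>F - P\<close> and its partial sum contribute, each with a factor \<open>2 * D\<close>, the partial sum with a further factor \<open>C\<close>.\<close>
  define \<eta> where "\<eta> = \<epsilon> / (2 * D * (1 + C))"
  have "\<eta> > 0"
    using \<open>\<epsilon> > 0\<close> C(1) D(1) by (simp add: \<eta>_def)
  obtain P where P: "P \<in> cube.trig_polys"
    "energy sing_weight (\<lambda>p. zak_quot f p - P p) \<le> ennreal \<eta>"
    using zak_quot_trig_approx[OF f \<open>\<eta> > 0\<close>] by blast
  obtain N0 c where N0: "finite N0" "P = (\<lambda>p. \<Sum>n\<in>N0. bimult (lchar4 n p) (rchar4 n p) (c n))"
    using P(1) by (auto simp: cube.trig_polys_def)
  have Fi: "integrable cube_lebesgue (zak_quot f)"
    by (rule integrable_zak_quot[OF f])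
  have Pi: "integrable cube_lebesgue P"
    unfolding N0(2) by (intro Bochner_Integration.integrable_sum) simp
  let ?G = "\<lambda>p. zak_quot f p - P p"
  have Gi: "integrable cube_lebesgue ?G"
    by (rule Bochner_Integration.integrable_diff[OF Fi Pi])
  note [measurable] = borel_measurable_integrable[OF Fi] borel_measurable_integrable[OF Pi]
  show thesis
  proof (rule that[OF N0(1)])
    fix N assume N: "N \<in> index_boxes" "N0 \<subseteq> N"
    let ?S = "box_sum N"
    have pt: "zak_quot f p - ?S (zak_quot f) p = ?G p - ?S ?G p" for p
      using cube.psum_diff[OF Fi Pi, of N p] cube.psum_trig[OF N0(1) N(2) finite_index_boxes[OF N(1)], of c p]
      by (simp add: N0(2))
    have "(\<integral>\<^sup>+p. ennreal ((norm (theta_left p) * norm (theta_right p) * norm (zak_quot f p - ?S (zak_quot f) p))\<^sup>2) \<partial>cube_lebesgue)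
        \<le> (\<integral>\<^sup>+p. ennreal (2 * D) * (ennreal (sing_weight p * (norm (?G p))\<^sup>2) + ennreal (edge_weight p * (norm (?S ?G p))\<^sup>2)) \<partial>cube_lebesgue)"
    proof (rule nn_integral_mono_AE)
      show "AE p in cube_lebesgue. ennreal ((norm (theta_left p) * norm (theta_right p) * norm (zak_quot f p - ?S (zak_quot f) p))\<^sup>2)
          \<le> ennreal (2 * D) * (ennreal (sing_weight p * (norm (?G p))\<^sup>2) + ennreal (edge_weight p * (norm (?S ?G p))\<^sup>2))"
        using AE_off_singular
      proof eventually_elim
        case (elim p)
        let ?a = "norm (?G p)" and ?b = "norm (?S ?G p)" and ?t = "(norm (theta_left p) * norm (theta_right p))\<^sup>2"
        have "(norm (?G p - ?S ?G p))\<^sup>2 \<le> (?a + ?b)\<^sup>2"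
          by (intro power_mono norm_triangle_ineq4) auto
        also have "\<dots> \<le> 2 * ?a\<^sup>2 + 2 * ?b\<^sup>2"
          using zero_le_power2[of "?a - ?b"] by (simp add: power2_eq_square algebra_simps)
        finally have "?t * (norm (?G p - ?S ?G p))\<^sup>2 \<le> ?t * (2 * ?a\<^sup>2 + 2 * ?b\<^sup>2)"
          by (intro mult_left_mono) auto
        also have "\<dots> = 2 * (?t * ?a\<^sup>2) + 2 * (?t * ?b\<^sup>2)"
          by (simp add: algebra_simps)
        also have "\<dots> \<le> 2 * (D * sing_weight p * ?a\<^sup>2) + 2 * (D * edge_weight p * ?b\<^sup>2)"
          by (intro add_mono mult_left_mono mult_right_mono D off_singular_unit_cube elim) auto
        also have "\<dots> = (2 * D) * (sing_weight p * ?a\<^sup>2 + edge_weight p * ?b\<^sup>2)"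
          by (simp add: algebra_simps)
        finally have "(norm (theta_left p) * norm (theta_right p) * norm (zak_quot f p - ?S (zak_quot f) p))\<^sup>2
            \<le> (2 * D) * (sing_weight p * ?a\<^sup>2 + edge_weight p * ?b\<^sup>2)"
          unfolding pt power_mult_distrib[of "norm (theta_left p) * norm (theta_right p)"] .
        then have "ennreal ((norm (theta_left p) * norm (theta_right p) * norm (zak_quot f p - ?S (zak_quot f) p))\<^sup>2)
            \<le> ennreal ((2 * D) * (sing_weight p * ?a\<^sup>2 + edge_weight p * ?b\<^sup>2))"
          by (rule ennreal_leI)
        also have "\<dots> = ennreal (2 * D) * (ennreal (sing_weight p * ?a\<^sup>2) + ennreal (edge_weight p * ?b\<^sup>2))"
          using D(1) by (subst ennreal_mult) (auto simp: sing_weight_nonneg edge_weight_nonneg)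
        finally show ?case .
      qed
    qed
    also have "\<dots> = ennreal (2 * D) * (energy sing_weight ?G
        + energy edge_weight (?S ?G))"
      by (subst nn_integral_cmult, measurable, subst nn_integral_add) auto
    also have "\<dots> \<le> ennreal (2 * D) * (ennreal \<eta> + ennreal C * ennreal \<eta>)"
      by (intro mult_left_mono add_mono P(2) order_trans[OF C(2)[OF N(1) Gi]]) auto
    also have "\<dots> = ennreal ((2 * D) * (\<eta> + C * \<eta>))"
      using C(1) D(1) \<open>\<eta> > 0\<close> by (simp add: ennreal_mult ennreal_plus)
    also have "(2 * D) * (\<eta> + C * \<eta>) = (2 * D * (1 + C)) * \<eta>"
      by (simp add: algebra_simps)
    also have "\<dots> = \<epsilon>"
      using C(1) D(1) by (simp add: \<eta>_def add_nonneg_eq_0_iff)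
    finally show "(\<integral>\<^sup>+p. ennreal ((norm (theta_left p) * norm (theta_right p) * norm (zak_quot f p - ?S (zak_quot f) p))\<^sup>2) \<partial>cube_lebesgue) \<le> ennreal \<epsilon>" .
  qed
qed

lemma zak_cut_gabor:
  assumes "fst p \<in> unit_square"
  shows "zak_cut (gabor_term c (lattice_point n)) p = bimult (theta_left p) (theta_right p) (bimult (lchar4 n p) (rchar4 n p) c)"
proof -
  obtain x1 x2 y1 y2 where p: "p = ((x1, x2), (y1, y2))"
    by (metis surj_pair)
  show ?thesis
    using assms zak_refl_gabor[of c "snd n" "fst n" x1 x2 y1 y2]
    by (simp add: zak_cut_def lattice_point_def p theta_left_def theta_right_def)
qed

text \<open>
  Multiplying the quotient by the theta factors restores the Zak transform, and the sum of Gabor atoms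
  becomes the partial sum of the Fourier series of the quotient multiplied by the same factors.
\<close>

lemma zak_cut_error:
  assumes f: "f \<in> W0" and p: "off_singular p" and N: "finite N"
  shows "norm (zak_cut (\<lambda>x. f x - (\<Sum>n\<in>N. gabor_term (gabor_coef n f) (lattice_point n) x)) p)
    = norm (theta_left p) * norm (theta_right p) * norm (zak_quot f p - box_sum N (zak_quot f) p)"
proof -
  have x: "fst p \<in> unit_square"
    using off_singular_unit_cube[OF p] by (simp add: unit_cube_def mem_Times_iff)
  have nz: "theta_left p \<noteq> 0" "theta_right p \<noteq> 0"
    using zak_quot_bounds p by metis+
  have "zak_cut f p = bimult (theta_left p) (theta_right p) (zak_quot f p)"
    using nz by (simp add: zak_quot_def bimult_bimult)
  moreover have "zak_cut (\<lambda>x. \<Sum>n\<in>N. gabor_term (gabor_coef n f) (lattice_point n) x) p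
      = bimult (theta_left p) (theta_right p) (box_sum N (zak_quot f) p)"
    by (simp add: zak_cut_sum N gabor_term_W0 zak_cut_gabor[OF x] psum_def gabor_coef_def bimult_sum)
  ultimately have "zak_cut (\<lambda>x. f x - (\<Sum>n\<in>N. gabor_term (gabor_coef n f) (lattice_point n) x)) p
      = bimult (theta_left p) (theta_right p) (zak_quot f p - box_sum N (zak_quot f) p)"
    by (simp add: zak_cut_diff f W0_sum N gabor_term_W0 bimult_diff)
  then show ?thesis
    by simp
qed

lemma nn_integral_W0_finite:
  assumes f: "f \<in> W0"
  shows "(\<integral>\<^sup>+z. ennreal ((norm (f z))\<^sup>2) \<partial>lborel) < \<infinity>"
proof -
  note zak_plancherel_le[OF f]
  also have "(\<integral>\<^sup>+p. ennreal ((norm (zak_cut f p))\<^sup>2) \<partial>cube_lebesgue) \<le> (\<integral>\<^sup>+p. ennreal ((enn2real (W_norm f))\<^sup>2) \<partial>cube_lebesgue)"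
    by (intro nn_integral_mono ennreal_leI power_mono norm_zak_cut_le f) auto
  also have "\<dots> < \<infinity>"
    by (simp add: cube.emeasure_space_1)
  finally show ?thesis .
qed

lemma W0_L2:
  assumes f: "f \<in> W0"
  shows "f \<in> L2"
proof -
  have m [measurable]: "f \<in> borel_measurable borel"
    by (rule W0_measurable[OF f])
  have "integrable lborel (\<lambda>x. (norm (f x))\<^sup>2)"
    using nn_integral_W0_finite[OF f] by (intro integrableI_bounded) auto
  then have "integrable lebesgue (\<lambda>x. (norm (f x))\<^sup>2)"
    by (subst integrable_completion) auto
  moreover have "f \<in> borel_measurable lebesgue"
    by (rule measurable_completion) simp
  ultimately show ?thesis
    by (simp add: L2_def)
qed

lemma L2_norm_le:
  assumes f: "f \<in> W0" and le: "(\<integral>\<^sup>+z. ennreal ((norm (f z))\<^sup>2) \<partial>lborel) \<le> ennreal \<epsilon>" and "\<epsilon> \<ge> 0"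
  shows "L2_norm f \<le> sqrt \<epsilon>"
proof -
  have m [measurable]: "f \<in> borel_measurable borel"
    by (rule W0_measurable[OF f])
  have "(LINT x|lebesgue. (norm (f x))\<^sup>2) = (LINT x|lborel. (norm (f x))\<^sup>2)"
    by (rule integral_completion) measurable
  also have "\<dots> = enn2real (\<integral>\<^sup>+z. ennreal ((norm (f z))\<^sup>2) \<partial>lborel)"
    by (rule integral_eq_nn_integral) auto
  also have "\<dots> \<le> \<epsilon>"
    using enn2real_mono[OF le] \<open>\<epsilon> \<ge> 0\<close> by simp
  finally show ?thesis
    by (simp add: L2_norm_def)
qed

text \<open>
  Rounding the sides of the box inwards to integers gives a box of indices, since position and frequency
  are restricted coordinate by coordinate.
\<close>

lemma lattice_box:
  fixes u v :: "(real^2) \<times> (real^2)"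
  defines "N \<equiv> {n. lattice_point n \<in> cbox u v}"
  shows "N \<in> index_boxes" "lattice \<inter> cbox u v = lattice_point ` N"
proof -
  let ?i = "\<lambda>w k. {\<lceil>(w u :: real^2) $ k\<rceil>..\<lfloor>w v $ k\<rfloor>}"
  have "N = (?i snd 1 \<times> ?i snd 2) \<times> (?i fst 1 \<times> ?i fst 2)"
    by (cases u; cases v)
      (auto simp: N_def lattice_point_def cbox_Pair_eq mem_box_cart forall_2 ceiling_le_iff le_floor_iff)
  then show "N \<in> index_boxes"
    unfolding index_boxes_def by blast
  show "lattice \<inter> cbox u v = lattice_point ` N"
    unfolding range_lattice_point[symmetric] N_def by auto
qed

lemma gabor_box_sums_converge:
  assumes f: "f \<in> W0" and "\<epsilon> > 0"
  obtains R where "\<And>u v. cball 0 R \<subseteq> cbox u v \<Longrightarrow>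
    L2_norm (\<lambda>x. f x - (\<Sum>p\<in>lattice \<inter> cbox u v. gabor_term (gabor_coef (inv lattice_point p) f) p x)) < \<epsilon>"
proof -
  have "(\<epsilon>/2)\<^sup>2 > 0"
    using \<open>\<epsilon> > 0\<close> by simp
  then obtain N0 where N0: "finite N0"
    "\<And>N. N \<in> index_boxes \<Longrightarrow> N0 \<subseteq> N \<Longrightarrow>
      (\<integral>\<^sup>+p. ennreal ((norm (theta_left p) * norm (theta_right p) * norm (zak_quot f p - box_sum N (zak_quot f) p))\<^sup>2) \<partial>cube_lebesgue)
      \<le> ennreal ((\<epsilon>/2)\<^sup>2)"
    using box_sums_converge[OF f] by blast
  show thesis
  proof (rule that[of "\<Sum>n\<in>N0. norm (lattice_point n)"])
    fix u v :: "(real^2) \<times> (real^2)"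
    assume uv: "cball 0 (\<Sum>n\<in>N0. norm (lattice_point n)) \<subseteq> cbox u v"
    define N where "N = {n. lattice_point n \<in> cbox u v}"
    have N: "N \<in> index_boxes" "lattice \<inter> cbox u v = lattice_point ` N"
      unfolding N_def by (rule lattice_box)+
    have fin: "finite N"
      by (rule finite_index_boxes[OF N(1)])
    have "N0 \<subseteq> N"
    proof
      fix n assume "n \<in> N0"
      then have "norm (lattice_point n) \<le> (\<Sum>n\<in>N0. norm (lattice_point n))"
        using N0(1) by (intro member_le_sum) auto
      then show "n \<in> N"
        using uv by (auto simp: N_def)
    qed
    define g where "g = (\<lambda>x. f x - (\<Sum>n\<in>N. gabor_term (gabor_coef n f) (lattice_point n) x))"
    have g: "g \<in> W0"
      unfolding g_def by (intro W0_diff W0_sum gabor_term_W0 f fin)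
    have "(\<lambda>x. f x - (\<Sum>p\<in>lattice \<inter> cbox u v. gabor_term (gabor_coef (inv lattice_point p) f) p x)) = g"
    proof
      fix x
      have "inj_on lattice_point N"
        using inj_lattice_point by (rule inj_on_subset) simp
      then have "(\<Sum>p\<in>lattice \<inter> cbox u v. gabor_term (gabor_coef (inv lattice_point p) f) p x)
          = (\<Sum>n\<in>N. gabor_term (gabor_coef n f) (lattice_point n) x)"
        unfolding N(2) by (simp add: sum.reindex inv_f_f[OF inj_lattice_point])
      then show "f x - (\<Sum>p\<in>lattice \<inter> cbox u v. gabor_term (gabor_coef (inv lattice_point p) f) p x) = g x"
        by (simp add: g_def)
    qed
    moreover have "L2_norm g \<le> sqrt ((\<epsilon>/2)\<^sup>2)"
    proof (rule L2_norm_le[OF g])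
      note zak_plancherel_le[OF g]
      also have "(\<integral>\<^sup>+p. ennreal ((norm (zak_cut g p))\<^sup>2) \<partial>cube_lebesgue)
          = (\<integral>\<^sup>+p. ennreal ((norm (theta_left p) * norm (theta_right p) * norm (zak_quot f p - box_sum N (zak_quot f) p))\<^sup>2) \<partial>cube_lebesgue)"
        using AE_off_singular
        by (intro nn_integral_cong_AE, eventually_elim) (simp only: g_def zak_cut_error[OF f _ fin])
      also note N0(2)[OF N(1) \<open>N0 \<subseteq> N\<close>]
      finally show "(\<integral>\<^sup>+z. ennreal ((norm (g z))\<^sup>2) \<partial>lborel) \<le> ennreal ((\<epsilon>/2)\<^sup>2)" .
    qed simp
    ultimately show "L2_norm (\<lambda>x. f x - (\<Sum>p\<in>lattice \<inter> cbox u v. gabor_term (gabor_coef (inv lattice_point p) f) p x)) < \<epsilon>"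
      using \<open>\<epsilon> > 0\<close> by simp
  qed
qed

lemma sharp_notin_lattice: "sharp \<notin> lattice"
proof
  assume "sharp \<in> lattice"
  then have "(1/2 :: real) \<in> \<int>"
    by (auto simp: sharp_def lattice_def int_vecs_def)
  then obtain k :: int where "1/2 = real_of_int k"
    by (elim Ints_cases)
  then have "real_of_int (2 * k) = real_of_int 1"
    by simp
  then have "2 * k = 1"
    by (simp only: of_int_eq_iff)
  then show False
    by presburger
qed

theorem theorem2:
  shows "\<exists>\<gamma> :: (real^2) \<times> (real^2) \<Rightarrow> (real^2 \<Rightarrow> quat) \<Rightarrow> quat.
    (\<forall>p\<in>lattice. continuous_functional_W0 (\<gamma> p)) \<and>
    \<gamma> sharp = sharp_poisson \<and>
    (\<forall>f\<in>W0. has_box_sum_L2 (\<lambda>p. gabor_term (\<gamma> p f) p) relaxed_lattice f)"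
proof -
  define \<gamma> where "\<gamma> p = (if p = sharp then sharp_poisson else (\<lambda>f. gabor_coef (inv lattice_point p) (residual f)))" for p
  have "\<forall>p\<in>lattice. continuous_functional_W0 (\<gamma> p)"
    using sharp_notin_lattice continuous_functional_gabor_coef_residual by (auto simp: \<gamma>_def)
  moreover have "\<gamma> sharp = sharp_poisson"
    by (simp add: \<gamma>_def)
  moreover have "has_box_sum_L2 (\<lambda>p. gabor_term (\<gamma> p f) p) relaxed_lattice f" if f: "f \<in> W0" for f
    unfolding has_box_sum_L2_def
  proof (intro conjI ballI allI impI)
    show "f \<in> L2" "gabor_term (\<gamma> p f) p \<in> L2" for p
      by (intro W0_L2 f gabor_term_W0)+
    fix \<epsilon> :: real assume "\<epsilon> > 0"
    then obtain R where R: "\<And>u v. cball 0 R \<subseteq> cbox u v \<Longrightarrow>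
        L2_norm (\<lambda>x. residual f x - (\<Sum>p\<in>lattice \<inter> cbox u v. gabor_term (gabor_coef (inv lattice_point p) (residual f)) p x)) < \<epsilon>"
      using gabor_box_sums_converge[OF residual_W0[OF f]] by blast
    have "L2_norm (\<lambda>x. f x - (\<Sum>p\<in>relaxed_lattice \<inter> cbox u v. gabor_term (\<gamma> p f) p x)) < \<epsilon>"
      if uv: "cball 0 (max R (norm sharp)) \<subseteq> cbox u v" for u v
    proof -
      have "cball 0 R \<subseteq> cbox u v"
        using uv by (auto intro: subset_trans[OF subset_cball])
      have "sharp \<in> cbox u v"
        using uv by auto
      then have idx: "relaxed_lattice \<inter> cbox u v = insert sharp (lattice \<inter> cbox u v)"
        by (auto simp: relaxed_lattice_def)
      have fin: "finite (lattice \<inter> cbox u v)"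
        unfolding lattice_box(2) by (intro finite_imageI finite_index_boxes lattice_box(1))
      have "(\<Sum>p\<in>relaxed_lattice \<inter> cbox u v. gabor_term (\<gamma> p f) p x)
          = gabor_term (sharp_poisson f) sharp x
            + (\<Sum>p\<in>lattice \<inter> cbox u v. gabor_term (gabor_coef (inv lattice_point p) (residual f)) p x)" for x
      proof -
        have "(\<Sum>p\<in>lattice \<inter> cbox u v. gabor_term (\<gamma> p f) p x)
            = (\<Sum>p\<in>lattice \<inter> cbox u v. gabor_term (gabor_coef (inv lattice_point p) (residual f)) p x)"
          using sharp_notin_lattice by (intro sum.cong) (auto simp: \<gamma>_def)
        then show ?thesis
          unfolding idx using fin sharp_notin_lattice by (simp add: \<gamma>_def)
      qed
      then have "(\<lambda>x. f x - (\<Sum>p\<in>relaxed_lattice \<inter> cbox u v. gabor_term (\<gamma> p f) p x))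
          = (\<lambda>x. residual f x - (\<Sum>p\<in>lattice \<inter> cbox u v. gabor_term (gabor_coef (inv lattice_point p) (residual f)) p x))"
        by (simp add: residual_def diff_diff_eq)
      then show ?thesis
        using R[OF \<open>cball 0 R \<subseteq> cbox u v\<close>] by simp
    qed
    then show "\<exists>R. \<forall>u v. cball 0 R \<subseteq> cbox u v \<longrightarrow>
        L2_norm (\<lambda>x. f x - (\<Sum>p\<in>relaxed_lattice \<inter> cbox u v. gabor_term (\<gamma> p f) p x)) < \<epsilon>"
      by blast
  qed
  ultimately show ?thesis
    by blast
qed

end
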